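(* Let $\lambda,\mu,\nu$ be partitions all of whose parts are even (the empty partition is allowed), and let $a_{\lambda\mu}^{\nu}(n)\in\mathbb Z$ be the structure constants of the even centers $\mathcal Z_n$ of the spin symmetric group algebras with respect to the class sum basis, as defined in the context. (1) There is a unique polynomial $f_{\lambda\mu}^{\nu}(x)$ such that $a_{\lambda\mu}^{\nu}(n)=f_{\lambda\mu}^{\nu}(n)$ for all integers $n\ge |\nu|+\ell(\nu)$. The degree of $f_{\lambda\mu}^{\nu}(x)$ is no greater than the maximum value of $|\mathbb N(\mathcal C)|-|\nu|-\ell(\nu)$, taken over all conjugacy classes $\mathcal C$ of pairs $(a,b)$ in $\widetilde S_\infty$ such that $a\in D_\lambda$, $b\in D_\mu$, and either $ab\in D_\nu$ or $ab\in zD_\nu$. (2) The polynomial $f_{\lambda\mu}^{\nu}(x)$ is $0$ unless $|\nu|\le|\lambda|+|\mu|$. (3) If $|\nu|=|\lambda|+|\mu|$, then the polynomial $f_{\lambda\mu}^{\nu}(x)$ is constant, i.e. the structure constants $a_{\lambda\mu}^{\nu}(n)$ are independent of $n$.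
   Context: Partitions: for a partition $\lambda$, $|\lambda|$ is the sum of its parts and $\ell(\lambda)$ the number of its parts. $\mathcal{EP}$ is the set of partitions all of whose parts are even (including $\emptyset$). Double cover: $\widetilde S_n$ is the group generated by $t_1,\dots,t_{n-1},z$ with relations: $z$ central, $z^2=1$, $t_i^2=z$, $t_it_{i+1}t_i=t_{i+1}t_it_{i+1}$, $t_jt_i=zt_it_j$ for $|i-j|>1$. The map $\theta_n:\widetilde S_n\to S_n$, $t_i\mapsto (i,i+1)$, $z\mapsto 1$, is a surjective homomorphism with kernel $\{1,z\}$. There are natural embeddings $\widetilde S_n\subset\widetilde S_{n+1}$; $\widetilde S_\infty=\bigcup_n\widetilde S_n$, and $\theta:\widetilde S_\infty\to S_\infty$ is the induced map. Permutations are multiplied from right to left. Cycles: in $\widetilde S_{n+1}$ put $x_i=t_it_{i+1}\cdots t_{n-1}t_nt_{n-1}\cdots t_{i+1}t_i$ for $1\le i\le n$ (so $x_n=t_n$). For distinct $i_1,\dots,i_m\in\{1,\dots,n\}$ with $m\ge2$ put $[i_1,\dots,i_m]=x_{i_1}x_{i_m}x_{i_{m-1}}\cdots x_{i_2}x_{i_1}$. This element lies in $\widetilde S_n$, does not depend on $n$, and $\theta_n([i_1,\dots,i_m])$ is the cycle $(i_1,\dots,i_m)$. Classes: for $\lambda=(\lambda_1,\dots,\lambda_\ell)\in\mathcal{EP}$, $D_\lambda(n)$ is the set of all products of disjoint cycles $[i_1,\dots,i_{\lambda_1+1}][j_1,\dots,j_{\lambda_2+1}]\cdots[k_1,\dots,k_{\lambda_\ell+1}]$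 in $\widetilde S_n$; it is empty if $|\lambda|+\ell(\lambda)>n$, and otherwise it is a conjugacy class of $\widetilde S_n$ with $zD_\lambda(n)\cap D_\lambda(n)=\emptyset$. Put $D_\lambda=\bigcup_nD_\lambda(n)\subset\widetilde S_\infty$. Structure constants: $\mathbb ZS_n^-=\mathbb Z\widetilde S_n/\langle z+1\rangle$, a superalgebra with every $t_i$ odd; $\mathcal Z_n$ is its even center (the set of even central elements). For $\lambda\in\mathcal{EP}$, $d_\lambda(n)$ is the image in $\mathbb ZS_n^-$ of the class sum $\sum_{g\in D_\lambda(n)}g$ (so $d_\lambda(n)=0$ if $|\lambda|+\ell(\lambda)>n$). The $d_\lambda(n)$ with $\lambda\in\mathcal{EP}$, $|\lambda|+\ell(\lambda)\le n$, form a basis of $\mathcal Z_n$. Write $d_\lambda(n)d_\mu(n)=\sum_{\nu\in\mathcal{EP}}a_{\lambda\mu}^\nu(n)d_\nu(n)$, where $a_{\lambda\mu}^\nu(n)$ is defined for $n\ge|\nu|+\ell(\nu)$. Pairs: two pairs $(a,b),(a',b')$ of elements of $\widetilde S_\infty$ are conjugate if $a'=waw^{-1}$ and $b'=wbw^{-1}$ for some $w\in\widetilde S_\infty$. For a conjugacy class $\mathcal C$ of pairs, $|\mathbb N(\mathcal C)|$ is the number of $j\in\mathbb N$ such that $\theta(a)(j)\ne j$ or $\theta(b)(j)\ne j$, for any $(a,b)\in\mathcal C$. (The zero polynomial is regarded as satisfying any degree bound.) *)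

theory Defs
  imports
    "HOL-Algebra.QuotRing"
    "HOL-Library.Poly_Mapping"
    "HOL-Combinatorics.Transposition"
    "HOL-Computational_Algebra.Polynomial"
begin

section \<open>Partitions with even parts\<close>

definition even_partitions :: "nat list set" where
  "even_partitions = {lam. sorted_wrt (\<ge>) lam \<and> (\<forall>p\<in>set lam. 0 < p \<and> even p)}"

text \<open>For a partition \<open>lam\<close>, the number of parts is \<^term>\<open>length lam\<close> and the sum of the parts is
  \<^term>\<open>sum_list lam\<close>.\<close>

section \<open>Groups given by generators and relations\<close>

text \<open>The letter \<open>(x, True)\<close> stands for the generator \<open>x\<close>, and \<open>(x, False)\<close> for its formal inverse.\<close>

type_synonym 'g word = "('g \<times> bool) list"

abbreviation words_over :: "'g set \<Rightarrow> 'g word set" where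
  "words_over X \<equiv> lists (X \<times> UNIV)"

inductive_set presentation_rel ::
  "'g set \<Rightarrow> ('g word \<times> 'g word) set \<Rightarrow> ('g word \<times> 'g word) set"
  for X :: "'g set" and R :: "('g word \<times> 'g word) set"
where
  relation: "(u, v) \<in> R \<Longrightarrow> p \<in> words_over X \<Longrightarrow> q \<in> words_over X
    \<Longrightarrow> (p @ u @ q, p @ v @ q) \<in> presentation_rel X R"
| cancel: "x \<in> X \<Longrightarrow> p \<in> words_over X \<Longrightarrow> q \<in> words_over X
    \<Longrightarrow> (p @ [(x, b), (x, \<not> b)] @ q, p @ q) \<in> presentation_rel X R"
| refl: "w \<in> words_over X \<Longrightarrow> (w, w) \<in> presentation_rel X R"
| sym: "(u, v) \<in> presentation_rel X R \<Longrightarrow> (v, u) \<in> presentation_rel X R"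
| trans: "(u, v) \<in> presentation_rel X R \<Longrightarrow> (v, w) \<in> presentation_rel X R
    \<Longrightarrow> (u, w) \<in> presentation_rel X R"

definition word_group :: "'g word set \<Rightarrow> ('g word \<times> 'g word) set \<Rightarrow> 'g word set monoid" where
  "word_group W E =
    \<lparr>carrier = W // E,
     monoid.mult = (\<lambda>A B. \<Union>u\<in>A. \<Union>v\<in>B. E `` {u @ v}),
     one = E `` {[]}\<rparr>"

section \<open>The double covers of the symmetric groups\<close>

datatype spin_gen = GenT nat | GenZ

abbreviation t_letter :: "nat \<Rightarrow> spin_gen \<times> bool" where "t_letter i \<equiv> (GenT i, True)"
abbreviation z_letter :: "spin_gen \<times> bool" where "z_letter \<equiv> (GenZ, True)"

definition spin_gens :: "nat \<Rightarrow> spin_gen set" where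
  "spin_gens n = insert GenZ {GenT i | i. 1 \<le> i \<and> i < n}"

definition spin_relations :: "nat \<Rightarrow> (spin_gen word \<times> spin_gen word) set" where
  "spin_relations n =
     {([z_letter, z_letter], [])}
   \<union> {([z_letter, t_letter i], [t_letter i, z_letter]) | i. 1 \<le> i \<and> i < n}
   \<union> {([t_letter i, t_letter i], [z_letter]) | i. 1 \<le> i \<and> i < n}
   \<union> {([t_letter i, t_letter (i+1), t_letter i],
        [t_letter (i+1), t_letter i, t_letter (i+1)]) | i. 1 \<le> i \<and> i + 1 < n}
   \<union> {([t_letter j, t_letter i], [z_letter, t_letter i, t_letter j]) | i j.
        1 \<le> i \<and> i < n \<and> 1 \<le> j \<and> j < n \<and> (i + 1 < j \<or> j + 1 < i)}"

definition spin_words :: "nat \<Rightarrow> spin_gen word set" where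
  "spin_words n = words_over (spin_gens n)"

definition spin_rel :: "nat \<Rightarrow> (spin_gen word \<times> spin_gen word) set" where
  "spin_rel n = presentation_rel (spin_gens n) (spin_relations n)"

definition spin_group :: "nat \<Rightarrow> spin_gen word set monoid" where
  "spin_group n = word_group (spin_words n) (spin_rel n)"

text \<open>The union of the groups \<open>spin_group n\<close> is their direct limit along the natural maps. If \<open>A\<close> is an
  element of \<open>spin_group n\<close>, that is, a class of words, then its image in \<open>spin_group m\<close>, for
  \<open>n \<le> m\<close>, is \<open>spin_rel m `` A\<close>, and its image in the union is \<open>spin_rel_inf `` A\<close>.\<close>

definition spin_rel_inf :: "(spin_gen word \<times> spin_gen word) set" where
  "spin_rel_inf = (\<Union>n. spin_rel n)"

definition spin_group_inf :: "spin_gen word set monoid" where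
  "spin_group_inf = word_group (\<Union>n. spin_words n) spin_rel_inf"

definition z_inf :: "spin_gen word set" where
  "z_inf = spin_rel_inf `` {[z_letter]}"

text \<open>The map to permutations; products are composed from right to left.\<close>

fun letter_perm :: "spin_gen \<times> bool \<Rightarrow> nat \<Rightarrow> nat" where
  "letter_perm (GenT i, b) = transpose i (i + 1)"
| "letter_perm (GenZ, b) = id"

definition word_perm :: "spin_gen word \<Rightarrow> nat \<Rightarrow> nat" where
  "word_perm w = foldr (\<lambda>l p. letter_perm l \<circ> p) w id"

definition theta :: "spin_gen word set \<Rightarrow> nat \<Rightarrow> nat" where
  "theta A = (THE p. \<forall>w\<in>A. word_perm w = p)"

section \<open>Cycles and the classes indexed by even partitions\<close>

text \<open>Words for the elements \<open>x\<^sub>i\<close> and \<open>[i\<^sub>1, \<dots>, i\<^sub>m]\<close> of \<open>spin_group (n+1)\<close>, for indices in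
  \<open>{1..n}\<close>.\<close>

definition x_word :: "nat \<Rightarrow> nat \<Rightarrow> spin_gen word" where
  "x_word n i = map t_letter [i..<n] @ [t_letter n] @ rev (map t_letter [i..<n])"

definition cycle_word :: "nat \<Rightarrow> nat list \<Rightarrow> spin_gen word" where
  "cycle_word n is = x_word n (hd is) @ concat (map (x_word n) (rev is))"

text \<open>The cycles are products in \<open>spin_group (n+1)\<close>, whence the membership test after embedding.\<close>

definition D_class :: "nat \<Rightarrow> nat list \<Rightarrow> spin_gen word set set" where
  "D_class n lam = {A \<in> carrier (spin_group n). \<exists>cs :: nat list list.
      map length cs = map (\<lambda>p. p + 1) lam \<and> distinct (concat cs) \<and> set (concat cs) \<subseteq> {1..n} \<and>
      spin_rel (n + 1) `` A = spin_rel (n + 1) `` {concat (map (cycle_word n) cs)}}"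

definition D_class_inf :: "nat list \<Rightarrow> spin_gen word set set" where
  "D_class_inf lam = (\<Union>n. (\<lambda>A. spin_rel_inf `` A) ` D_class n lam)"

section \<open>Spin group algebras and their even centers\<close>

definition int_group_ring :: "('a, 'b) monoid_scheme \<Rightarrow> ('a \<Rightarrow>\<^sub>0 int) ring" where
  "int_group_ring G =
    \<lparr>carrier = {f. Poly_Mapping.keys f \<subseteq> carrier G},
     monoid.mult = (\<lambda>f h. \<Sum>a\<in>Poly_Mapping.keys f. \<Sum>b\<in>Poly_Mapping.keys h.
       Poly_Mapping.single (a \<otimes>\<^bsub>G\<^esub> b) (Poly_Mapping.lookup f a * Poly_Mapping.lookup h b)),
     one = Poly_Mapping.single \<one>\<^bsub>G\<^esub> 1,
     zero = 0,
     add = (+)\<rparr>"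

definition spin_ideal :: "nat \<Rightarrow> (spin_gen word set \<Rightarrow>\<^sub>0 int) set" where
  "spin_ideal n = Idl\<^bsub>int_group_ring (spin_group n)\<^esub>
     {Poly_Mapping.single (spin_rel n `` {[z_letter]}) 1 + Poly_Mapping.single \<one>\<^bsub>spin_group n\<^esub> 1}"

definition spin_ring :: "nat \<Rightarrow> (spin_gen word set \<Rightarrow>\<^sub>0 int) set ring" where
  "spin_ring n = int_group_ring (spin_group n) Quot spin_ideal n"

definition spin_image :: "nat \<Rightarrow> (spin_gen word set \<Rightarrow>\<^sub>0 int) \<Rightarrow> (spin_gen word set \<Rightarrow>\<^sub>0 int) set" where
  "spin_image n f = spin_ideal n +>\<^bsub>int_group_ring (spin_group n)\<^esub> f"

text \<open>In the superalgebra \<open>spin_ring n\<close> every \<open>GenT i\<close> is odd, and \<open>GenZ\<close> (the scalar \<open>-1\<close>) is even.\<close>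

definition even_word :: "spin_gen word \<Rightarrow> bool" where
  "even_word w \<longleftrightarrow> even (length (filter (\<lambda>l. fst l \<noteq> GenZ) w))"

definition spin_ring_even_part :: "nat \<Rightarrow> (spin_gen word set \<Rightarrow>\<^sub>0 int) set set" where
  "spin_ring_even_part n = spin_image n `
     {f \<in> carrier (int_group_ring (spin_group n)). \<forall>A\<in>Poly_Mapping.keys f. \<exists>w\<in>A. even_word w}"

definition even_center :: "nat \<Rightarrow> (spin_gen word set \<Rightarrow>\<^sub>0 int) set ring" where
  "even_center n = (spin_ring n)\<lparr>carrier := {a \<in> spin_ring_even_part n.
     \<forall>b\<in>carrier (spin_ring n). a \<otimes>\<^bsub>spin_ring n\<^esub> b = b \<otimes>\<^bsub>spin_ring n\<^esub> a}\<rparr>"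

definition d_elem :: "nat \<Rightarrow> nat list \<Rightarrow> (spin_gen word set \<Rightarrow>\<^sub>0 int) set" where
  "d_elem n lam = spin_image n (\<Sum>A\<in>D_class n lam. Poly_Mapping.single A 1)"

definition basis_index :: "nat \<Rightarrow> nat list set" where
  "basis_index n = {lam \<in> even_partitions. sum_list lam + length lam \<le> n}"

text \<open>The family of coordinates of \<open>d_elem n lam \<otimes> d_elem n mu\<close> in the basis \<open>d_elem n kap\<close> of the even center,
  extended by \<open>0\<close> to all \<open>kap\<close>; only its values on \<open>basis_index n\<close> are meaningful.\<close>

definition structure_constant :: "nat \<Rightarrow> nat list \<Rightarrow> nat list \<Rightarrow> nat list \<Rightarrow> int" where
  "structure_constant n lam mu = (THE a.
     (\<forall>kap. kap \<notin> basis_index n \<longrightarrow> a kap = 0) \<and>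
     d_elem n lam \<otimes>\<^bsub>even_center n\<^esub> d_elem n mu =
       finsum (even_center n) (\<lambda>kap. [a kap] \<cdot>\<^bsub>even_center n\<^esub> d_elem n kap) (basis_index n))"

definition interpolates :: "rat poly \<Rightarrow> nat list \<Rightarrow> nat list \<Rightarrow> nat list \<Rightarrow> bool" where
  "interpolates f lam mu nu \<longleftrightarrow>
     (\<forall>n \<ge> sum_list nu + length nu. of_int (structure_constant n lam mu nu) = poly f (of_nat n))"

section \<open>Conjugacy classes of pairs\<close>

definition pair_conj :: "((spin_gen word set \<times> spin_gen word set) \<times>
    (spin_gen word set \<times> spin_gen word set)) set" where
  "pair_conj = {((a, b), (a', b')) | a b a' b'.
     a \<in> carrier spin_group_inf \<and> b \<in> carrier spin_group_inf \<and>
     (\<exists>w\<in>carrier spin_group_inf.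
        a' = w \<otimes>\<^bsub>spin_group_inf\<^esub> a \<otimes>\<^bsub>spin_group_inf\<^esub> inv\<^bsub>spin_group_inf\<^esub> w \<and>
        b' = w \<otimes>\<^bsub>spin_group_inf\<^esub> b \<otimes>\<^bsub>spin_group_inf\<^esub> inv\<^bsub>spin_group_inf\<^esub> w)}"

definition pair_classes :: "(spin_gen word set \<times> spin_gen word set) set set" where
  "pair_classes = (carrier spin_group_inf \<times> carrier spin_group_inf) // pair_conj"

definition moved_points :: "(spin_gen word set \<times> spin_gen word set) set \<Rightarrow> nat" where
  "moved_points C = (THE k. \<forall>(a, b)\<in>C. k = card {j. 1 \<le> j \<and> (theta a j \<noteq> j \<or> theta b j \<noteq> j)})"

definition pair_classes_over ::
    "nat list \<Rightarrow> nat list \<Rightarrow> nat list \<Rightarrow> (spin_gen word set \<times> spin_gen word set) set set" where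
  "pair_classes_over lam mu nu = {C \<in> pair_classes. \<forall>(a, b)\<in>C.
     a \<in> D_class_inf lam \<and> b \<in> D_class_inf mu \<and>
     (a \<otimes>\<^bsub>spin_group_inf\<^esub> b \<in> D_class_inf nu \<or>
      a \<otimes>\<^bsub>spin_group_inf\<^esub> b \<in> z_inf <#\<^bsub>spin_group_inf\<^esub> D_class_inf nu)}"

end

theory Submission
  imports Defs "HOL-Combinatorics.Cycles"
begin

text \<open>All the groups involved live in one type, the infinite double cover, written additively. An action
  on a Clifford algebra shows that \<open>z\<close> is not trivial, and Coxeter's argument that only \<open>1\<close> and \<open>z\<close> lie
  over the identity permutation; so the double cover of the symmetric group on \<open>{1..n}\<close> consists of the
  elements whose permutation fixes all other points. Conjugation by \<open>w\<close> takes \<open>x\<^sub>j\<close> to \<open>x\<^sub>i\<close>, where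
  \<open>i = w(j)\<close>, up to the sign of \<open>w\<close>. Hence the products of disjoint cycles of odd length form conjugacy
  classes. Such an element is not conjugate to \<open>z\<close> times itself, since it has odd order modulo \<open>z\<close>, while
  an even element whose permutation has a cycle of even length is: conjugate it by that cycle. Therefore
  the coefficient at \<open>g\<close> in a product of two class sums is the number of factorizations of \<open>g\<close> minus
  that of \<open>z g\<close>.

  The factorizations \<open>g = a b\<close> are sorted by the set \<open>T\<close> of points moved by \<open>a\<close> or \<open>b\<close>, which contains
  the \<open>N\<close> points moved by \<open>g\<close>. Their number depends on the cardinality of \<open>T\<close> only, so that the
  coefficient is a combination of the binomial coefficients \<open>n - N\<close> over \<open>k\<close>, where \<open>k\<close> is the
  cardinality of \<open>T\<close> minus \<open>N\<close>. A permutation with cycle type given by \<open>\<lambda>\<close> has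
  \<open>2\<close> to the power \<open>n - |\<lambda>|\<close> invariant subsets of \<open>{1..n}\<close>; they form a vector space over the field with
  two elements, and the subsets invariant under \<open>a\<close> and \<open>b\<close> are invariant under \<open>a b\<close>. Comparing
  dimensions gives \<open>|\<nu>| \<le> |\<lambda>| + |\<mu>|\<close>, and if equality holds then \<open>a b\<close> moves every point that is moved by
  \<open>a\<close> or \<open>b\<close>, so that only \<open>k = 0\<close> contributes.\<close>

section \<open>Words modulo relations\<close>

text \<open>A permutation determines its lift only up to \<open>z\<close>, and the recurring
  obstacle is to fix this sign. One principle settles it: two conjugate lifts of the same
  permutation of odd order coincide. It yields the independence of a cycle from the \<open>n\<close>
  used to compute it, the uniqueness of the lift within a class, and the fact that an element of a
  class commutes with whatever fixes all points it moves, and not merely up to \<open>z\<close>. A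
  second obstacle is the encoding. Elements of the finite groups are sets of words, so one and the
  same element is a different set for each \<open>n\<close>; moreover the structure constants, the
  permutation of an element and the number of moved points are definite descriptions. Existence and
  uniqueness of the coordinates therefore have to be proved before anything can be counted. The
  counts carry signs and may cancel. This is harmless, since only one direction is required: a
  nonzero coefficient at a binomial forces a pair that moves the corresponding number of points, and
  such pairs are what the degree bound and the vanishing statements are about.\<close>

lemma presentation_rel_words:
  assumes "(u, v) \<in> presentation_rel X R" "R \<subseteq> words_over X \<times> words_over X"
  shows "u \<in> words_over X \<and> v \<in> words_over X"
  using assms by (induction rule: presentation_rel.induct) auto

lemma presentation_rel_context:
  assumes "(u, v) \<in> presentation_rel X R" "p \<in> words_over X" "q \<in> words_over X"
  shows "(p @ u @ q, p @ v @ q) \<in> presentation_rel X R"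
  using assms
proof (induction rule: presentation_rel.induct)
  case (relation u v p' q')
  then show ?case
    using presentation_rel.relation[of u v R "p @ p'" X "q' @ q"] by simp
next
  case (cancel x p' q' b)
  then show ?case
    using presentation_rel.cancel[of x X "p @ p'" "q' @ q" b] by simp
next
  case (refl w)
  then show ?case by (intro presentation_rel.refl) auto
next
  case (sym u v)
  then show ?case by (blast intro: presentation_rel.sym)
next
  case (trans u v w)
  then show ?case by (blast intro: presentation_rel.trans)
qed

lemma presentation_rel_mono:
  assumes "(u, v) \<in> presentation_rel X R" "X \<subseteq> Y" "R \<subseteq> S"
  shows "(u, v) \<in> presentation_rel Y S"
  using assms
proof (induction rule: presentation_rel.induct)
  case (relation u v p q)
  then show ?case by (intro presentation_rel.relation) auto
next
  case (cancel x p q b)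
  then show ?case by (intro presentation_rel.cancel) auto
next
  case (refl w)
  then show ?case by (intro presentation_rel.refl) auto
next
  case (sym u v)
  then show ?case by (blast intro: presentation_rel.sym)
next
  case (trans u v w)
  then show ?case by (blast intro: presentation_rel.trans)
qed

text \<open>Universal property of the presentation, with an arbitrary operation \<open>m\<close> on
  the values of \<open>F\<close>. It serves for the permutation, the Clifford operator and the
  parity of a word.\<close>

lemma presentation_rel_invariant:
  assumes "(u, v) \<in> presentation_rel X R"
    and hom: "\<And>u v. F (u @ v) = m (F u) (F v)"
    and rel: "\<And>u v. (u, v) \<in> R \<Longrightarrow> F u = F v"
    and inv: "\<And>x b. x \<in> X \<Longrightarrow> F [(x, b), (x, \<not> b)] = F []"
  shows "F u = F v"
  using assms(1)
proof (induction rule: presentation_rel.induct)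
  case (relation u v p q)
  then show ?case using rel by (simp add: hom)
next
  case (cancel x p q b)
  have "F (p @ [(x, b), (x, \<not> b)] @ q) = m (F p) (m (F [(x, b), (x, \<not> b)]) (F q))"
    by (simp only: hom)
  also have "\<dots> = F (p @ [] @ q)"
    using inv[OF cancel(1)] by (simp only: hom)
  finally show ?case by simp
qed auto

definition inverse_word :: "'g word \<Rightarrow> 'g word" where
  "inverse_word w = rev (map (\<lambda>(g, b). (g, \<not> b)) w)"

lemma inverse_word_inverse_word [simp]: "inverse_word (inverse_word w) = w"
  by (simp add: inverse_word_def rev_map o_def case_prod_unfold)

lemma inverse_word_words: "w \<in> words_over X \<Longrightarrow> inverse_word w \<in> words_over X"
  by (auto simp: inverse_word_def)

lemma inverse_word_left:
  assumes "w \<in> words_over X"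
  shows "(inverse_word w @ w, []) \<in> presentation_rel X R"
  using assms
proof (induction w rule: list.induct)
  case Nil
  then show ?case by (simp add: inverse_word_def presentation_rel.refl)
next
  case (Cons l w)
  obtain x b where l: "l = (x, b)" by fastforce
  have w: "w \<in> words_over X" and x: "x \<in> X" using Cons.prems unfolding l by simp_all
  have "(inverse_word w @ [(x, \<not> b), (x, \<not> \<not> b)] @ w, inverse_word w @ w) \<in> presentation_rel X R"
    by (rule presentation_rel.cancel) (use x w inverse_word_words[OF w] in auto)
  then show ?case
    using Cons.IH[OF w] l by (auto simp: inverse_word_def intro: presentation_rel.trans)
qed

section \<open>The relations of the double covers\<close>

lemma spin_gens_mono: "n \<le> m \<Longrightarrow> spin_gens n \<subseteq> spin_gens m"
  by (fastforce simp: spin_gens_def)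

lemma spin_relations_mono: "n \<le> m \<Longrightarrow> spin_relations n \<subseteq> spin_relations m"
  unfolding spin_relations_def
  by (intro Un_mono) (fastforce)+

lemma spin_relations_words: "spin_relations n \<subseteq> spin_words n \<times> spin_words n"
  by (auto simp: spin_relations_def spin_words_def spin_gens_def)

lemma spin_words_mono: "n \<le> m \<Longrightarrow> spin_words n \<subseteq> spin_words m"
  using spin_gens_mono unfolding spin_words_def by (auto intro!: lists_mono Sigma_mono)

lemma spin_words_append [simp]: "u @ v \<in> spin_words n \<longleftrightarrow> u \<in> spin_words n \<and> v \<in> spin_words n"
  by (simp add: spin_words_def)

lemma spin_words_Nil [simp]: "[] \<in> spin_words n"
  by (simp add: spin_words_def)

lemma spin_words_Cons [simp]: "(x, b) # w \<in> spin_words n \<longleftrightarrow> x \<in> spin_gens n \<and> w \<in> spin_words n"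
  by (auto simp: spin_words_def)

lemma GenT_spin_gens [simp]: "GenT i \<in> spin_gens n \<longleftrightarrow> 1 \<le> i \<and> i < n"
  by (auto simp: spin_gens_def)

lemma GenZ_spin_gens [simp]: "GenZ \<in> spin_gens n"
  by (auto simp: spin_gens_def)

lemma map_t_letter_spin_words [simp]:
  "map t_letter is \<in> spin_words n \<longleftrightarrow> set is \<subseteq> {1..<n}"
  by (induction "is") auto

lemma spin_words_inverse [simp]: "inverse_word w \<in> spin_words n \<longleftrightarrow> w \<in> spin_words n"
  using inverse_word_words[of w "spin_gens n"] inverse_word_words[of "inverse_word w" "spin_gens n"]
  unfolding spin_words_def inverse_word_inverse_word by blast

lemma spin_rel_words:
  assumes "(u, v) \<in> spin_rel n"
  shows "u \<in> spin_words n" "v \<in> spin_words n"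
  using presentation_rel_words[OF assms[unfolded spin_rel_def]] spin_relations_words
  by (auto simp: spin_words_def)

lemma spin_rel_mono: "n \<le> m \<Longrightarrow> spin_rel n \<subseteq> spin_rel m"
  using presentation_rel_mono[OF _ spin_gens_mono spin_relations_mono]
  by (auto simp: spin_rel_def)

lemma spin_rel_refl: "w \<in> spin_words n \<Longrightarrow> (w, w) \<in> spin_rel n"
  by (simp add: spin_rel_def spin_words_def presentation_rel.refl)

lemma spin_rel_sym: "(u, v) \<in> spin_rel n \<Longrightarrow> (v, u) \<in> spin_rel n"
  by (simp add: spin_rel_def presentation_rel.sym)

lemma spin_rel_trans: "(u, v) \<in> spin_rel n \<Longrightarrow> (v, w) \<in> spin_rel n \<Longrightarrow> (u, w) \<in> spin_rel n"
  unfolding spin_rel_def by (rule presentation_rel.trans)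

lemma spin_rel_context:
  "(u, v) \<in> spin_rel n \<Longrightarrow> p \<in> spin_words n \<Longrightarrow> q \<in> spin_words n \<Longrightarrow> (p @ u @ q, p @ v @ q) \<in> spin_rel n"
  unfolding spin_rel_def spin_words_def by (rule presentation_rel_context)

lemma spin_rel_append:
  assumes "(u, u') \<in> spin_rel n" "(v, v') \<in> spin_rel n"
  shows "(u @ v, u' @ v') \<in> spin_rel n"
  using spin_rel_context[OF assms(1), of "[]" v] spin_rel_context[OF assms(2), of u' "[]"]
    spin_rel_words[OF assms(1)] spin_rel_words[OF assms(2)] spin_rel_trans
  by fastforce

lemma spin_rel_relation:
  assumes "(u, v) \<in> spin_relations n"
  shows "(u, v) \<in> spin_rel n"
  using presentation_rel.relation[OF assms, of "[]" "spin_gens n" "[]"] by (simp add: spin_rel_def)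

lemma spin_rel_cancel:
  "x \<in> spin_gens n \<Longrightarrow> ([(x, b), (x, \<not> b)], []) \<in> spin_rel n"
  using presentation_rel.cancel[of x "spin_gens n" "[]" "[]" b] by (simp add: spin_rel_def)

lemma spin_rel_inverse_left: "w \<in> spin_words n \<Longrightarrow> (inverse_word w @ w, []) \<in> spin_rel n"
  unfolding spin_rel_def spin_words_def by (rule inverse_word_left)

lemma spin_rel_z_commute:
  assumes "w \<in> spin_words n"
  shows "(w @ [z_letter], z_letter # w) \<in> spin_rel n"
  using assms
proof (induction w)
  case Nil
  then show ?case by (simp add: spin_rel_refl)
next
  case (Cons l w)
  obtain x b where l: "l = (x, b)" by fastforce
  have w: "w \<in> spin_words n" and x: "x \<in> spin_gens n" using Cons(2) l by auto
  have zt: "([(x, True), z_letter], [z_letter, (x, True)]) \<in> spin_rel n"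
  proof (cases x)
    case (GenT i)
    then have "([z_letter, t_letter i], [t_letter i, z_letter]) \<in> spin_relations n"
      using x by (auto simp: spin_relations_def)
    then show ?thesis using GenT spin_rel_relation spin_rel_sym by blast
  next
    case GenZ
    then show ?thesis by (auto intro!: spin_rel_refl)
  qed
  have xz: "([(x, b), z_letter], [z_letter, (x, b)]) \<in> spin_rel n"
  proof (cases b)
    case False
    \<comment> \<open>The relations speak of the generators only; for a formal inverse one computes
      \<open>x^-1 z = x^-1 z x x^-1 = x^-1 x z x^-1 = z x^-1\<close>.\<close>
    have 1: "([(x, False), z_letter, (x, True), (x, False)], [(x, False), z_letter]) \<in> spin_rel n"
      using spin_rel_context[OF spin_rel_cancel[OF x, of True], of "[(x, False), z_letter]" "[]"] x
      by simp
    have 2: "([(x, False), (x, True), z_letter, (x, False)], [(x, False), z_letter, (x, True), (x, False)]) \<in> spin_rel n"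
      using spin_rel_context[OF zt, of "[(x, False)]" "[(x, False)]"] x by simp
    have 3: "([(x, False), (x, True), z_letter, (x, False)], [z_letter, (x, False)]) \<in> spin_rel n"
      using spin_rel_context[OF spin_rel_cancel[OF x, of False], of "[]" "[z_letter, (x, False)]"] x
      by simp
    show ?thesis
      using spin_rel_trans[OF spin_rel_sym[OF 1] spin_rel_trans[OF spin_rel_sym[OF 2] 3]] False by simp
  qed (use zt in simp)
  have "([(x, b)] @ w @ [z_letter], [(x, b)] @ z_letter # w) \<in> spin_rel n"
    using spin_rel_context[OF Cons.IH[OF w], of "[(x, b)]" "[]"] x by simp
  moreover have "([(x, b)] @ z_letter # w, z_letter # (x, b) # w) \<in> spin_rel n"
    using spin_rel_context[OF xz, of "[]" w] w by simp
  ultimately show ?case using spin_rel_trans l by auto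
qed

lemma word_perm_append: "word_perm (u @ v) = word_perm u \<circ> word_perm v"
  by (induction u) (simp_all add: word_perm_def o_assoc)

lemma word_perm_Nil [simp]: "word_perm [] = id"
  by (simp add: word_perm_def)

lemma word_perm_Cons: "word_perm (l # w) = letter_perm l \<circ> word_perm w"
  by (simp add: word_perm_def)

lemma braid_transpose:
  "transpose i (Suc i) \<circ> (transpose (Suc i) (Suc (Suc i)) \<circ> transpose i (Suc i)) =
   transpose (Suc i) (Suc (Suc i)) \<circ> (transpose i (Suc i) \<circ> transpose (Suc i) (Suc (Suc i)))"
  by (auto simp: fun_eq_iff transpose_def)

lemma word_perm_spin_rel:
  assumes "(u, v) \<in> spin_rel n"
  shows "word_perm u = word_perm v"
proof (rule presentation_rel_invariant[OF assms[unfolded spin_rel_def], where m = "(\<circ>)"])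
  fix u v assume "(u, v) \<in> spin_relations n"
  then show "word_perm u = word_perm v"
    unfolding spin_relations_def
    apply (auto simp: word_perm_Cons braid_transpose)
     apply (auto simp: fun_eq_iff transpose_def) 
    done
next
  fix x :: spin_gen and b
  show "word_perm [(x, b), (x, \<not> b)] = word_perm []"
    by (cases x) (simp_all add: word_perm_Cons)
qed (rule word_perm_append)

lemma word_perm_permutes:
  assumes "w \<in> spin_words n"
  shows "word_perm w permutes {1..n}"
  using assms
proof (induction w)
  case (Cons l w)
  obtain x b where l: "l = (x, b)" by fastforce
  have "letter_perm l permutes {1..n}"
    using Cons(2) l by (cases x) (auto intro!: permutes_swap_id permutes_id)
  then show ?case
    using Cons l by (simp only: word_perm_Cons) (rule permutes_compose, auto)
qed (simp add: permutes_id)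

section \<open>The Clifford action\<close>

text \<open>The operator \<open>clif i\<close> is left multiplication by a basis vector of the Clifford algebra with
  \<open>e\<^sub>i\<^sup>2 = -1\<close>; an element of the algebra is a function on the sets \<open>A\<close> of indices of the
  basis monomials \<open>e\<^sub>A\<close>.\<close>

definition flip :: "nat \<Rightarrow> nat set \<Rightarrow> nat set" where
  "flip i A = (if i \<in> A then A - {i} else insert i A)"

text \<open>The coefficient of \<open>e_A\<close> in \<open>e_i e_B\<close> for
  \<open>B = flip i A\<close>: moving \<open>e_i\<close> past the smaller indices gives the power of
  -1, and if \<open>i\<close> is not in \<open>A\<close>, then \<open>e_i\<close> meets itself and
  contributes its square -1.\<close>

definition clif_sign :: "nat \<Rightarrow> nat set \<Rightarrow> real" where
  "clif_sign i A = (- 1) ^ card {j \<in> A. j < i} * (if i \<in> A then 1 else - 1)"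

definition clif :: "nat \<Rightarrow> (nat set \<Rightarrow> real) \<Rightarrow> nat set \<Rightarrow> real" where
  "clif i f = (\<lambda>A. clif_sign i A * f (flip i A))"

lemma flip_flip [simp]: "flip i (flip i A) = A"
  by (auto simp: flip_def)

lemma flip_commute: "flip i (flip j A) = flip j (flip i A)"
  by (cases "i = j") (auto simp: flip_def)

lemma mem_flip [simp]: "i \<in> flip j A \<longleftrightarrow> (i \<in> A) \<noteq> (i = j)"
  by (auto simp: flip_def)

lemma clif_sign_square [simp]: "clif_sign i A * clif_sign i A = 1"
  by (simp add: clif_sign_def flip: power_mult_distrib)

lemma clif_sign_flip_same: "clif_sign i (flip i A) = - clif_sign i A"
proof -
  have "{j \<in> flip i A. j < i} = {j \<in> A. j < i}" by auto
  then show ?thesis by (simp add: clif_sign_def)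
qed

lemma clif_sign_flip_less:
  assumes "j < i"
  shows "clif_sign i (flip j A) = - clif_sign i A" "clif_sign j (flip i A) = clif_sign j A"
proof -
  have fin: "finite {k \<in> A. k < i}" by simp
  show "clif_sign i (flip j A) = - clif_sign i A"
  proof (cases "j \<in> A")
    case True
    have "{k \<in> flip j A. k < i} = {k \<in> A. k < i} - {j}" using assms True by auto
    moreover have "card {k \<in> A. k < i} = Suc (card ({k \<in> A. k < i} - {j}))"
      using True assms fin card_Suc_Diff1[of "{k \<in> A. k < i}" j] by simp
    ultimately show ?thesis using assms by (simp add: clif_sign_def)
  next
    case False
    have "{k \<in> flip j A. k < i} = insert j {k \<in> A. k < i}" using assms False by auto
    then show ?thesis using assms False by (simp add: clif_sign_def)
  qed
  have "{k \<in> flip i A. k < j} = {k \<in> A. k < j}" using assms by auto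
  then show "clif_sign j (flip i A) = clif_sign j A" using assms by (simp add: clif_sign_def)
qed

lemma clif_square: "clif i (clif i f) = (\<lambda>A. - f A)"
proof
  fix A
  have "clif i (clif i f) A = - (clif_sign i A * clif_sign i A) * f A"
    unfolding clif_def clif_sign_flip_same by simp
  then show "clif i (clif i f) A = - f A" by simp
qed

lemma clif_anticommute: "i \<noteq> j \<Longrightarrow> clif i (clif j f) = (\<lambda>A. - clif j (clif i f) A)"
  by (cases i j rule: linorder_cases)
    (auto simp: clif_def clif_sign_flip_less flip_commute[of i j] fun_eq_iff)

lemma clif_linear:
  "clif i (\<lambda>A. c * f A) = (\<lambda>A. c * clif i f A)"
  "clif i (\<lambda>A. - f A) = (\<lambda>A. - clif i f A)"
  "clif i (\<lambda>A. f A - g A) = (\<lambda>A. clif i f A - clif i g A)"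
  by (auto simp: clif_def algebra_simps)

text \<open>Left multiplication by the unit vector along the root \<open>e_i - e_(i+1)\<close> of
  the transposition. Orthogonal roots anticommute, and adjacent ones satisfy the braid relation. The
  normalization by \<open>sqrt 2\<close> is why the coefficients are real.\<close>

definition clif_t :: "nat \<Rightarrow> (nat set \<Rightarrow> real) \<Rightarrow> nat set \<Rightarrow> real" where
  "clif_t i f = (\<lambda>A. (clif i f A - clif (Suc i) f A) / sqrt 2)"

lemma clif_t_neg: "clif_t i (\<lambda>A. - f A) = (\<lambda>A. - clif_t i f A)"
  by (simp add: clif_t_def clif_linear fun_eq_iff field_simps)

lemma clif_t_twice:
  "clif_t i (clif_t j f) = (\<lambda>A. (clif i (clif j f) A - clif i (clif (Suc j) f) A
     - clif (Suc i) (clif j f) A + clif (Suc i) (clif (Suc j) f) A) / 2)"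
proof -
  have "clif k (clif_t j f) = (\<lambda>A. (clif k (clif j f) A - clif k (clif (Suc j) f) A) / sqrt 2)" for k
    by (simp add: clif_t_def clif_def fun_eq_iff field_simps)
  then show ?thesis
    unfolding clif_t_def[of i] by (simp add: diff_divide_distrib add_divide_distrib algebra_simps)
qed

lemma clif_t_square: "clif_t i (clif_t i f) = (\<lambda>A. - f A)"
  using clif_anticommute[of i "Suc i" f] by (simp add: clif_t_twice clif_square fun_eq_iff)

lemma clif_t_anticommute:
  assumes "Suc i < j \<or> Suc j < i"
  shows "clif_t i (clif_t j f) = (\<lambda>A. - clif_t j (clif_t i f) A)"
proof -
  have "i \<noteq> j" "i \<noteq> Suc j" "Suc i \<noteq> j" "Suc i \<noteq> Suc j" using assms by auto
  from this[THEN clif_anticommute, of f] show ?thesis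
    by (simp add: clif_t_twice fun_eq_iff field_simps)
qed

text \<open>For unit vectors with \<open>u v + v u = 1\<close> one has \<open>u v u = u + v\<close>, which is symmetric.\<close>

lemma clif_t_braid: "clif_t i (clif_t (Suc i) (clif_t i f)) = clif_t (Suc i) (clif_t i (clif_t (Suc i) f))"
proof -
  have sum: "clif_t i (clif_t (Suc i) g) = (\<lambda>A. g A - clif_t (Suc i) (clif_t i g) A)" for g
  proof
    fix A
    have "i \<noteq> Suc i" "i \<noteq> Suc (Suc i)" "Suc i \<noteq> Suc (Suc i)" by auto
    from this[THEN clif_anticommute, of g]
    show "clif_t i (clif_t (Suc i) g) A = g A - clif_t (Suc i) (clif_t i g) A"
      by (simp add: clif_t_twice clif_square field_simps)
  qed
  have diff: "clif_t k (\<lambda>A. g A - h A) = (\<lambda>A. clif_t k g A - clif_t k h A)" for k g h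
    by (simp add: clif_t_def clif_linear fun_eq_iff diff_divide_distrib)
  have "clif_t i (clif_t (Suc i) (clif_t i f)) = (\<lambda>A. clif_t i f A + clif_t (Suc i) f A)"
    unfolding sum[of "clif_t i f"] clif_t_square clif_t_neg by simp
  moreover have "clif_t (Suc i) (clif_t i (clif_t (Suc i) f)) = (\<lambda>A. clif_t (Suc i) f A + clif_t i f A)"
    unfolding sum[of f] diff clif_t_square by simp
  ultimately show ?thesis by (simp add: add.commute)
qed

text \<open>The square of \<open>clif_t i\<close> is -1, so its inverse is its negative.\<close>

fun letter_op :: "spin_gen \<times> bool \<Rightarrow> (nat set \<Rightarrow> real) \<Rightarrow> nat set \<Rightarrow> real" where
  "letter_op (GenT i, True) = clif_t i"
| "letter_op (GenT i, False) = (\<lambda>f A. - clif_t i f A)"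
| "letter_op (GenZ, b) = (\<lambda>f A. - f A)"

definition word_op :: "spin_gen word \<Rightarrow> (nat set \<Rightarrow> real) \<Rightarrow> nat set \<Rightarrow> real" where
  "word_op w = foldr (\<lambda>l p. letter_op l \<circ> p) w id"

lemma word_op_append: "word_op (u @ v) = word_op u \<circ> word_op v"
  by (induction u) (simp_all add: word_op_def o_assoc)

lemma word_op_Nil: "word_op [] = id"
  by (simp add: word_op_def)

lemma word_op_Cons: "word_op (l # w) = letter_op l \<circ> word_op w"
  by (simp add: word_op_def)

lemma word_op_spin_rel:
  assumes "(u, v) \<in> spin_rel n"
  shows "word_op u = word_op v"
proof (rule presentation_rel_invariant[OF assms[unfolded spin_rel_def], where m = "(\<circ>)"])
  fix u v assume "(u, v) \<in> spin_relations n"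
  then show "word_op u = word_op v"
    unfolding spin_relations_def
    by (auto simp: word_op_Cons word_op_Nil fun_eq_iff clif_t_square clif_t_neg clif_t_braid
        intro: fun_cong[OF clif_t_anticommute])
next
  fix x :: spin_gen and b
  show "word_op [(x, b), (x, \<not> b)] = word_op []"
    by (cases x; cases b) (simp_all add: word_op_Cons word_op_Nil fun_eq_iff clif_t_square clif_t_neg)
qed (rule word_op_append)

lemma z_letter_not_trivial: "([z_letter], []) \<notin> spin_rel n"
proof
  assume "([z_letter], []) \<in> spin_rel n"
  from word_op_spin_rel[OF this] have "word_op [z_letter] (\<lambda>_. 1) {} = word_op [] (\<lambda>_. 1) {}"
    by simp
  then show False by (simp add: word_op_Cons word_op_Nil)
qed

section \<open>Coxeter's presentation modulo the central element\<close>

definition zrel :: "nat \<Rightarrow> spin_gen word \<Rightarrow> spin_gen word \<Rightarrow> bool" where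
  "zrel n u v \<longleftrightarrow> (u, v) \<in> spin_rel n \<or> (u, z_letter # v) \<in> spin_rel n"

lemma spin_rel_zz: "([z_letter, z_letter], []) \<in> spin_rel n"
  by (rule spin_rel_relation) (simp add: spin_relations_def)

lemma zrel_words: "zrel n u v \<Longrightarrow> u \<in> spin_words n \<and> v \<in> spin_words n"
  unfolding zrel_def using spin_rel_words by fastforce

lemma zrel_refl: "w \<in> spin_words n \<Longrightarrow> zrel n w w"
  by (simp add: zrel_def spin_rel_refl)

lemma spin_rel_imp_zrel: "(u, v) \<in> spin_rel n \<Longrightarrow> zrel n u v"
  by (simp add: zrel_def)

lemma spin_rel_z_Cons: "(u, v) \<in> spin_rel n \<Longrightarrow> (z_letter # u, z_letter # v) \<in> spin_rel n"
  using spin_rel_append[of "[z_letter]" "[z_letter]" n u v] spin_rel_refl[of "[z_letter]" n] by simp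

lemma spin_rel_zz_Cons: "w \<in> spin_words n \<Longrightarrow> (z_letter # z_letter # w, w) \<in> spin_rel n"
  using spin_rel_append[OF spin_rel_zz spin_rel_refl] by fastforce

lemma zrel_sym:
  assumes "zrel n u v"
  shows "zrel n v u"
proof -
  have "v \<in> spin_words n" using zrel_words[OF assms] by simp
  show ?thesis
  proof (cases "(u, v) \<in> spin_rel n")
    case False
    then have "(z_letter # z_letter # v, z_letter # u) \<in> spin_rel n"
      using assms spin_rel_z_Cons spin_rel_sym by (auto simp: zrel_def)
    then show ?thesis
      unfolding zrel_def using spin_rel_trans spin_rel_sym spin_rel_zz_Cons[OF \<open>v \<in> spin_words n\<close>]
      by blast
  qed (auto simp: zrel_def spin_rel_sym)
qed

lemma zrel_trans:
  assumes "zrel n u v" "zrel n v w"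
  shows "zrel n u w"
proof -
  have "w \<in> spin_words n" using zrel_words[OF assms(2)] by simp
  from spin_rel_zz_Cons[OF this] show ?thesis
    using assms unfolding zrel_def by (meson spin_rel_trans spin_rel_z_Cons)
qed

lemma zrel_append:
  assumes "zrel n u u'" "zrel n v v'"
  shows "zrel n (u @ v) (u' @ v')"
proof -
  have "zrel n (u @ v) (u' @ v)"
    using assms spin_rel_append[OF _ spin_rel_refl, of u _ n v] zrel_words[OF assms(2)]
    unfolding zrel_def by fastforce
  moreover have "zrel n (u' @ v) (u' @ v')"
  proof (cases "(v, v') \<in> spin_rel n")
    case True
    then show ?thesis
      using zrel_words[OF assms(1)] spin_rel_append[OF spin_rel_refl] spin_rel_imp_zrel by blast
  next
    case False
    then have "(v, z_letter # v') \<in> spin_rel n" using assms(2) by (simp add: zrel_def)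
    then have "(u' @ v, u' @ z_letter # v') \<in> spin_rel n"
      using zrel_words[OF assms(1)] spin_rel_append[OF spin_rel_refl] by blast
    moreover have "((u' @ [z_letter]) @ v', (z_letter # u') @ v') \<in> spin_rel n"
      using zrel_words[OF assms(1)] zrel_words[OF assms(2)]
      by (intro spin_rel_append spin_rel_refl spin_rel_z_commute) auto
    ultimately show ?thesis unfolding zrel_def by (auto intro: spin_rel_trans)
  qed
  ultimately show ?thesis by (rule zrel_trans)
qed

lemma word_perm_zrel: "zrel n u v \<Longrightarrow> word_perm u = word_perm v"
  unfolding zrel_def using word_perm_spin_rel by (fastforce simp: word_perm_Cons)

section \<open>Coxeter's normal form for positive words\<close>

definition cox :: "nat \<Rightarrow> nat list \<Rightarrow> nat list \<Rightarrow> bool" where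
  "cox n is js \<longleftrightarrow> zrel n (map t_letter is) (map t_letter js)"

lemma cox_refl: "set is \<subseteq> {1..<n} \<Longrightarrow> cox n is is"
  by (simp add: cox_def zrel_refl)

lemma cox_sym: "cox n is js \<Longrightarrow> cox n js is"
  by (simp add: cox_def zrel_sym)

lemma cox_trans [trans]: "cox n is js \<Longrightarrow> cox n js ks \<Longrightarrow> cox n is ks"
  unfolding cox_def by (rule zrel_trans)

lemma cox_append: "cox n is is' \<Longrightarrow> cox n js js' \<Longrightarrow> cox n (is @ js) (is' @ js')"
  unfolding cox_def by (simp add: zrel_append)

lemma cox_context:
  "cox n is js \<Longrightarrow> set ps \<subseteq> {1..<n} \<Longrightarrow> set qs \<subseteq> {1..<n} \<Longrightarrow> cox n (ps @ is @ qs) (ps @ js @ qs)"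
  by (intro cox_append cox_refl)

lemma cox_square: "1 \<le> i \<Longrightarrow> i < n \<Longrightarrow> cox n [i, i] []"
  unfolding cox_def zrel_def by (auto intro!: spin_rel_relation simp: spin_relations_def)

lemma cox_braid: "1 \<le> i \<Longrightarrow> i + 1 < n \<Longrightarrow> cox n [i, i + 1, i] [i + 1, i, i + 1]"
  unfolding cox_def zrel_def by (auto intro!: spin_rel_relation simp: spin_relations_def)

lemma cox_commute:
  "1 \<le> i \<Longrightarrow> i < n \<Longrightarrow> 1 \<le> j \<Longrightarrow> j < n \<Longrightarrow> i + 1 < j \<or> j + 1 < i \<Longrightarrow> cox n [j, i] [i, j]"
  unfolding cox_def zrel_def by (rule disjI2, rule spin_rel_relation) (auto simp: spin_relations_def)

lemma cox_commute_list:
  assumes "set js \<subseteq> {1..<n}" "1 \<le> i" "i < n" "\<forall>j\<in>set js. i + 1 < j \<or> j + 1 < i"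
  shows "cox n (js @ [i]) (i # js)"
  using assms
proof (induction js)
  case Nil
  then show ?case by (auto intro: cox_refl)
next
  case (Cons j js)
  have "cox n ([j] @ (js @ [i])) ([j] @ (i # js))"
    using Cons by (intro cox_append cox_refl) auto
  also have "cox n ([j, i] @ js) ([i, j] @ js)"
    using Cons.prems by (intro cox_append cox_refl cox_commute) auto
  then have "cox n ([j] @ (i # js)) (i # j # js)" by simp
  finally show ?case by simp
qed

text \<open>As a permutation this word sends \<open>j\<close> to \<open>n\<close>. For
  \<open>j\<close> from 1 to \<open>Suc n\<close>, the words \<open>desc j (Suc n)\<close> represent
  the cosets of the permutations of \<open>{1..n}\<close> in those of
  \<open>{1..Suc n}\<close>.\<close>

definition desc :: "nat \<Rightarrow> nat \<Rightarrow> nat list" where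
  "desc j n = rev [j..<n]"

lemma set_desc [simp]: "set (desc j n) = {j..<n}"
  by (simp add: desc_def)

lemma desc_snoc: "j < n \<Longrightarrow> desc j n = desc (Suc j) n @ [j]"
  by (simp add: desc_def upt_conv_Cons)

lemma desc_split: "j \<le> k \<Longrightarrow> k \<le> n \<Longrightarrow> desc j n = desc k n @ desc j k"
  unfolding desc_def by (metis le_add_diff_inverse rev_append upt_add_eq_append)

lemma desc_self [simp]: "desc n n = []"
  by (simp add: desc_def)

text \<open>Right multiplication by a generator maps the coset representatives to coset
  representatives, up to a left factor from the smaller group. The new letter lengthens the
  descending word, cancels its last letter, or commutes with all of it. In the remaining case it
  enters the word from the right up to its neighbour, the braid relation lowers it by one, and it
  leaves on the left.\<close>

lemma cox_desc_snoc:
  assumes "1 \<le> j" "j \<le> Suc n" "1 \<le> i" "i \<le> n"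
  shows "\<exists>js j'. set js \<subseteq> {1..<n} \<and> 1 \<le> j' \<and> j' \<le> Suc n \<and>
    cox (Suc n) (desc j (Suc n) @ [i]) (js @ desc j' (Suc n))"
proof -
  have desc_ok: "set (desc a b) \<subseteq> {1..<Suc n}" if "1 \<le> a" "b \<le> Suc n" for a b
    using that by auto
  consider "Suc i = j" | "i = j" | "Suc i < j" | "j < i" by linarith
  then show ?thesis
  proof cases
    case 1
    then have "desc j (Suc n) @ [i] = desc i (Suc n)" using assms desc_snoc[of i "Suc n"] by simp
    then have "cox (Suc n) (desc j (Suc n) @ [i]) ([] @ desc i (Suc n))"
      using assms desc_ok by (auto intro: cox_refl)
    then show ?thesis using assms by (intro exI[of _ "[]"] exI[of _ i]) auto
  next
    case 2
    then have "desc j (Suc n) @ [i] = desc (Suc j) (Suc n) @ [j, j] @ []"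
      using assms desc_snoc[of j "Suc n"] by simp
    moreover have "cox (Suc n) (desc (Suc j) (Suc n) @ [j, j] @ []) (desc (Suc j) (Suc n) @ [] @ [])"
      using assms 2 desc_ok by (intro cox_context cox_square) auto
    ultimately show ?thesis using assms 2 by (intro exI[of _ "[]"] exI[of _ "Suc j"]) auto
  next
    case 3
    then have "cox (Suc n) (desc j (Suc n) @ [i]) (i # desc j (Suc n))"
      using assms by (intro cox_commute_list) auto
    then show ?thesis using assms 3 by (intro exI[of _ "[i]"] exI[of _ j]) auto
  next
    case 4
    then obtain k where k: "i = Suc k" "j \<le> k" by (cases i) auto
    let ?A = "desc (Suc (Suc k)) (Suc n)" and ?B = "desc j k"
    have D: "desc j (Suc n) = ?A @ [Suc k, k] @ ?B"
      using desc_split[of j k "Suc n"] desc_snoc[of k "Suc n"] desc_snoc[of "Suc k" "Suc n"] k assms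
      by simp
    have "cox (Suc n) ((?A @ [Suc k, k]) @ (?B @ [Suc k])) ((?A @ [Suc k, k]) @ (Suc k # ?B))"
      using assms k by (intro cox_append cox_refl cox_commute_list) auto
    also have "cox (Suc n) (?A @ [Suc k, k, Suc k] @ ?B) (?A @ [k, Suc k, k] @ ?B)"
      using assms k cox_sym[OF cox_braid[of k "Suc n"]] by (intro cox_context) auto
    then have "cox (Suc n) ((?A @ [Suc k, k]) @ (Suc k # ?B)) ((?A @ [k]) @ ([Suc k, k] @ ?B))" by simp
    also have "cox (Suc n) ((?A @ [k]) @ ([Suc k, k] @ ?B)) ((k # ?A) @ ([Suc k, k] @ ?B))"
      using assms k by (intro cox_append cox_refl cox_commute_list) auto
    finally have "cox (Suc n) (desc j (Suc n) @ [i]) ([k] @ desc j (Suc n))"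
      using D k by simp
    then show ?thesis using assms k by (intro exI[of _ "[k]"] exI[of _ j]) auto
  qed
qed

lemma cox_coset_form:
  assumes "set is \<subseteq> {1..<Suc n}"
  shows "\<exists>js j. set js \<subseteq> {1..<n} \<and> 1 \<le> j \<and> j \<le> Suc n \<and> cox (Suc n) is (js @ desc j (Suc n))"
  using assms
proof (induction "is" rule: rev_induct)
  case Nil
  then show ?case by (intro exI[of _ "[]"] exI[of _ "Suc n"]) (auto intro: cox_refl)
next
  case (snoc i "is")
  then obtain js j where j: "set js \<subseteq> {1..<n}" "1 \<le> j" "j \<le> Suc n" "cox (Suc n) is (js @ desc j (Suc n))"
    by auto
  have i: "1 \<le> i" "i \<le> n" using snoc.prems by auto
  obtain ks j' where k: "set ks \<subseteq> {1..<n}" "1 \<le> j'" "j' \<le> Suc n"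
    "cox (Suc n) (desc j (Suc n) @ [i]) (ks @ desc j' (Suc n))"
    using cox_desc_snoc[OF j(2,3) i] by blast
  have "cox (Suc n) (is @ [i]) ((js @ desc j (Suc n)) @ [i])"
    using j i by (intro cox_append cox_refl) auto
  also have "cox (Suc n) (js @ (desc j (Suc n) @ [i])) (js @ (ks @ desc j' (Suc n)))"
    by (rule cox_append[OF cox_refl k(4)]) (use j in auto)
  then have "cox (Suc n) ((js @ desc j (Suc n)) @ [i]) ((js @ ks) @ desc j' (Suc n))" by simp
  finally show ?case using j k by (intro exI[of _ "js @ ks"] exI[of _ j']) auto
qed

lemma word_perm_desc: "j \<le> n \<Longrightarrow> word_perm (map t_letter (desc j n)) j = n"
proof (induction "n - j" arbitrary: j)
  case 0
  then show ?case by simp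
next
  case (Suc d)
  then have "word_perm (map t_letter (desc (Suc j) n)) (Suc j) = n" by auto
  then show ?case using Suc by (simp add: desc_snoc word_perm_append word_perm_Cons)
qed

lemma zrel_mono: "zrel n u v \<Longrightarrow> n \<le> m \<Longrightarrow> zrel m u v"
  unfolding zrel_def using spin_rel_mono by blast

text \<open>In the form \<open>js @ desc j (Suc n)\<close> the factor \<open>js\<close> fixes
  \<open>Suc n\<close>, so the permutation sends \<open>j\<close> to \<open>Suc n\<close>. If it is
  the identity, then \<open>j = Suc n\<close>, the descending word is empty, and the induction
  continues with \<open>js\<close>.\<close>

lemma cox_trivial:
  assumes "set is \<subseteq> {1..<n}" "word_perm (map t_letter is) = id"
  shows "cox n is []"
  using assms
proof (induction n arbitrary: "is")
  case 0
  then show ?case by (simp add: cox_refl)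
next
  case (Suc n)
  obtain js j where j: "set js \<subseteq> {1..<n}" "1 \<le> j" "j \<le> Suc n" "cox (Suc n) is (js @ desc j (Suc n))"
    using cox_coset_form[OF Suc.prems(1)] by blast
  have perm: "word_perm (map t_letter (js @ desc j (Suc n))) = id"
    using j(4) Suc.prems(2) word_perm_zrel unfolding cox_def by metis
  have js: "word_perm (map t_letter js) permutes {1..n}"
    using j(1) by (intro word_perm_permutes) auto
  have "j = Suc n"
  proof -
    have "word_perm (map t_letter (js @ desc j (Suc n))) j = word_perm (map t_letter js) (Suc n)"
      using word_perm_desc[OF j(3)] by (simp add: word_perm_append)
    then show ?thesis using perm permutes_not_in[OF js, of "Suc n"] by simp
  qed
  then have "cox n js []" using Suc.IH[OF j(1)] perm by simp
  then have "cox (Suc n) js []" using zrel_mono by (auto simp: cox_def)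
  then show ?case using j(4) \<open>j = Suc n\<close> cox_trans by auto
qed

text \<open>Modulo \<open>z\<close> each generator is its own inverse, because its square is
  \<open>z\<close>. Hence every word is equivalent to a positive one, to which the normal form
  applies.\<close>

lemma zrel_letter:
  assumes "x \<in> spin_gens n"
  shows "zrel n [(x, b)] (case x of GenT i \<Rightarrow> [t_letter i] | GenZ \<Rightarrow> [])"
proof (cases x)
  case (GenT i)
  show ?thesis
  proof (cases b)
    case True
    then show ?thesis using GenT assms by (auto intro!: zrel_refl)
  next
    case False
    have tt: "([t_letter i, t_letter i], [z_letter]) \<in> spin_rel n"
      using GenT assms by (intro spin_rel_relation) (auto simp: spin_relations_def)
    have "([(x, False), (x, True)] @ [(x, True)], [] @ [(x, True)]) \<in> spin_rel n"
      using spin_rel_append[OF spin_rel_cancel[OF assms, of False] spin_rel_refl] assms by simp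
    moreover have "([(x, False)] @ [t_letter i, t_letter i], [(x, False)] @ [z_letter]) \<in> spin_rel n"
      using spin_rel_append[OF spin_rel_refl[of "[(x, False)]" n] tt] assms by simp
    moreover have "([(x, False)] @ [z_letter], z_letter # [(x, False)]) \<in> spin_rel n"
      using assms by (intro spin_rel_z_commute) simp
    ultimately have "zrel n [(x, True)] [(x, False)]"
      unfolding zrel_def using GenT by (auto intro: spin_rel_sym spin_rel_trans)
    then show ?thesis using GenT False zrel_sym by simp
  qed
next
  case GenZ

  show ?thesis
  proof (cases b)
    case True
    then show ?thesis using GenZ by (auto simp: zrel_def intro!: spin_rel_refl)
  next
    case False
    have "([(GenZ, False), z_letter] @ [z_letter], [] @ [z_letter]) \<in> spin_rel n"
      using spin_rel_append[OF spin_rel_cancel[of GenZ n False] spin_rel_refl[of "[z_letter]" n]] by simp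
    moreover have "([(GenZ, False)] @ [z_letter, z_letter], [(GenZ, False)] @ []) \<in> spin_rel n"
      using spin_rel_append[OF spin_rel_refl[of "[(GenZ, False)]" n] spin_rel_zz] by simp
    ultimately show ?thesis
      unfolding zrel_def using GenZ False by (auto intro: spin_rel_sym spin_rel_trans)
  qed
qed

lemma zrel_positive:
  assumes "w \<in> spin_words n"
  shows "\<exists>is. set is \<subseteq> {1..<n} \<and> zrel n w (map t_letter is)"
  using assms
proof (induction w)
  case Nil
  then show ?case by (intro exI[of _ "[]"]) (simp add: zrel_refl)
next
  case (Cons l w)
  obtain x b where l: "l = (x, b)" by fastforce
  have w: "w \<in> spin_words n" and x: "x \<in> spin_gens n" using Cons.prems unfolding l by simp_all
  obtain "is" where "is": "set is \<subseteq> {1..<n}" "zrel n w (map t_letter is)" using Cons.IH[OF w] by blast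
  have *: "zrel n ([(x, b)] @ w) ((case x of GenT i \<Rightarrow> [t_letter i] | GenZ \<Rightarrow> []) @ map t_letter is)"
    by (intro zrel_append zrel_letter x "is")
  then show ?case
  proof (cases x)
    case (GenT i)
    then have "zrel n (l # w) (map t_letter (i # is))" using * l by simp
    then show ?thesis using GenT x "is"(1) by (intro exI[of _ "i # is"]) auto
  next
    case GenZ
    then show ?thesis using * l "is"(1) by auto
  qed
qed

lemma word_perm_trivial:
  assumes "w \<in> spin_words n" "word_perm w = id"
  shows "(w, []) \<in> spin_rel n \<or> (w, [z_letter]) \<in> spin_rel n"
proof -
  obtain "is" where "is": "set is \<subseteq> {1..<n}" "zrel n w (map t_letter is)"
    using zrel_positive[OF assms(1)] by blast
  then have "cox n is []" using cox_trivial word_perm_zrel assms(2) by metis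
  then have "zrel n w []" using "is" zrel_trans by (auto simp: cox_def)
  then show ?thesis by (simp add: zrel_def)
qed

lemma word_perm_surj:
  assumes "p permutes {1..n}"
  shows "\<exists>w\<in>spin_words n. word_perm w = p"
proof -
  have "\<exists>is. set is \<subseteq> {1..<n} \<and> word_perm (map t_letter is) = p"
    using assms
  proof (induction n arbitrary: p)
    case 0
    then show ?case by (auto intro: exI[of _ "[]"])
  next
    case (Suc n)
    let ?inv = "inv_into UNIV"
    define j where "j = ?inv p (Suc n)"
    have pj: "p j = Suc n" using Suc.prems permutes_inverses(1) unfolding j_def by metis
    have j: "j \<in> {1..Suc n}" using permutes_in_image[OF Suc.prems, of j] pj by auto
    define r where "r = word_perm (map t_letter (desc j (Suc n)))"
    have r: "r permutes {1..Suc n}" unfolding r_def by (rule word_perm_permutes) (use j in auto)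
    have rj: "r j = Suc n" unfolding r_def using word_perm_desc j by simp
    have pr: "p \<circ> ?inv r permutes {1..Suc n}" using permutes_compose[OF permutes_inv[OF r] Suc.prems] .
    \<comment> \<open>Both \<open>p\<close> and \<open>r\<close> send \<open>j\<close> to
      \<open>Suc n\<close>, so \<open>p\<close> composed with the inverse of \<open>r\<close> fixes
      \<open>Suc n\<close> and the induction hypothesis applies to it.\<close>
    have "?inv r (Suc n) = j" using rj permutes_inverses(2)[OF r] by metis
    then have "(p \<circ> ?inv r) (Suc n) = Suc n" using pj by simp
    then have "p \<circ> ?inv r permutes {1..n}"
      by (intro permutes_superset[OF pr]) (auto simp: le_Suc_eq)
    then obtain "is" where "is": "set is \<subseteq> {1..<n}" "word_perm (map t_letter is) = p \<circ> ?inv r"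
      using Suc.IH by blast
    have "word_perm (map t_letter (is @ desc j (Suc n))) = p"
      using "is"(2) r_def permutes_inv_o(2)[OF r] by (simp add: word_perm_append o_assoc flip: comp_assoc) (simp add: comp_assoc)
    then show ?case using "is"(1) j by (intro exI[of _ "is @ desc j (Suc n)"]) auto
  qed
  then show ?thesis by (metis map_t_letter_spin_words)
qed

section \<open>The infinite double cover as a type\<close>

lemma spin_rel_inf_iff: "(u, v) \<in> spin_rel_inf \<longleftrightarrow> (\<exists>n. (u, v) \<in> spin_rel n)"
  by (simp add: spin_rel_inf_def)

lemma spin_rel_inf_append:
  assumes "(u, u') \<in> spin_rel_inf" "(v, v') \<in> spin_rel_inf"
  shows "(u @ v, u' @ v') \<in> spin_rel_inf"
proof -
  obtain m n where "(u, u') \<in> spin_rel m" "(v, v') \<in> spin_rel n"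
    using assms by (auto simp: spin_rel_inf_iff)
  then have "(u, u') \<in> spin_rel (max m n)" "(v, v') \<in> spin_rel (max m n)"
    using spin_rel_mono[of m "max m n"] spin_rel_mono[of n "max m n"] by auto
  then show ?thesis using spin_rel_append spin_rel_inf_iff by blast
qed

lemma spin_rel_inf_trans:
  assumes "(u, v) \<in> spin_rel_inf" "(v, w) \<in> spin_rel_inf"
  shows "(u, w) \<in> spin_rel_inf"
proof -
  obtain m n where "(u, v) \<in> spin_rel m" "(v, w) \<in> spin_rel n"
    using assms by (auto simp: spin_rel_inf_iff)
  then have "(u, v) \<in> spin_rel (max m n)" "(v, w) \<in> spin_rel (max m n)"
    using spin_rel_mono[of m "max m n"] spin_rel_mono[of n "max m n"] by auto
  then show ?thesis using spin_rel_trans spin_rel_inf_iff by blast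
qed

lemma spin_rel_inf_sym: "(u, v) \<in> spin_rel_inf \<Longrightarrow> (v, u) \<in> spin_rel_inf"
  using spin_rel_sym by (auto simp: spin_rel_inf_iff)

text \<open>The letters for \<open>t\<^sub>0\<close>, which is not a generator, are ignored, so that every word denotes an
  element.\<close>

definition clean_word :: "spin_gen word \<Rightarrow> spin_gen word" where
  "clean_word = filter (\<lambda>l. fst l \<noteq> GenT 0)"

lemma clean_word_append: "clean_word (u @ v) = clean_word u @ clean_word v"
  by (simp add: clean_word_def)

lemma clean_word_Nil: "clean_word [] = []"
  by (simp add: clean_word_def)

lemma clean_word_words: "\<exists>n. clean_word w \<in> spin_words n"
proof (induction w)
  case Nil
  then show ?case by (simp add: clean_word_def)
next
  case (Cons l w)
  obtain x b where l: "l = (x, b)" by fastforce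
  obtain n where n: "clean_word w \<in> spin_words n" using Cons by blast
  show ?case
  proof (cases x)
    case (GenT i)
    have "clean_word w \<in> spin_words (max n (Suc i))" using n spin_words_mono[of n "max n (Suc i)"] by auto
    then show ?thesis using GenT l
      by (intro exI[of _ "max n (Suc i)"]) (auto simp: clean_word_def)
  next
    case GenZ
    then show ?thesis using n l by (intro exI[of _ n]) (auto simp: clean_word_def)
  qed
qed

lemma clean_word_id: "w \<in> spin_words n \<Longrightarrow> clean_word w = w"
  by (induction w) (auto simp: clean_word_def)

lemma clean_word_inverse: "clean_word (inverse_word w) = inverse_word (clean_word w)"
  by (induction w) (auto simp: clean_word_def inverse_word_def)

definition spin_equiv :: "spin_gen word \<Rightarrow> spin_gen word \<Rightarrow> bool" where
  "spin_equiv u v \<longleftrightarrow> (clean_word u, clean_word v) \<in> spin_rel_inf"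

quotient_type spin = "spin_gen word" / spin_equiv
  morphisms spin_word elt
proof (rule equivpI)
  show "reflp spin_equiv"
    using clean_word_words spin_rel_refl unfolding reflp_def spin_equiv_def spin_rel_inf_iff by blast
  show "symp spin_equiv"
    unfolding symp_def spin_equiv_def using spin_rel_inf_sym by blast
  show "transp spin_equiv"
    unfolding transp_def spin_equiv_def using spin_rel_inf_trans by blast
qed

lemma inverse_word_left_inf: "(inverse_word (clean_word w) @ clean_word w, []) \<in> spin_rel_inf"
  using clean_word_words[of w] spin_rel_inverse_left unfolding spin_rel_inf_iff by blast

text \<open>Uniqueness of inverses: \<open>u^-1 v v^-1\<close> reduces to \<open>u^-1\<close> and,
  as \<open>u\<close> and \<open>v\<close> are equivalent, also to \<open>v^-1\<close>.\<close>

lemma spin_rel_inf_inverse: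
  assumes "(clean_word u, clean_word v) \<in> spin_rel_inf"
  shows "(inverse_word (clean_word u), inverse_word (clean_word v)) \<in> spin_rel_inf"
proof -
  let ?u = "clean_word u" and ?v = "clean_word v"
  have r: "(inverse_word (clean_word w), inverse_word (clean_word w)) \<in> spin_rel_inf" for w
    using clean_word_words[of "inverse_word w"] spin_rel_refl
    unfolding clean_word_inverse spin_rel_inf_iff by blast
  have "(inverse_word ?u @ ?v @ inverse_word ?v, inverse_word ?u) \<in> spin_rel_inf"
    using spin_rel_inf_append[OF r[of u] inverse_word_left_inf[of "inverse_word v"]]
    by (simp add: clean_word_inverse)
  moreover have "(inverse_word ?u @ ?v @ inverse_word ?v, inverse_word ?v) \<in> spin_rel_inf"
  proof -
    have "(inverse_word ?u @ ?v, inverse_word ?u @ ?u) \<in> spin_rel_inf"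
      using spin_rel_inf_append[OF r spin_rel_inf_sym[OF assms]] .
    then have "(inverse_word ?u @ ?v, []) \<in> spin_rel_inf"
      using inverse_word_left_inf spin_rel_inf_trans by blast
    from spin_rel_inf_append[OF this r[of v]] show ?thesis by simp
  qed
  ultimately show ?thesis using spin_rel_inf_sym spin_rel_inf_trans by blast
qed

instantiation spin :: group_add
begin

lift_definition zero_spin :: spin is "[]" .

lift_definition plus_spin :: "spin \<Rightarrow> spin \<Rightarrow> spin" is "(@)"
  by (simp add: spin_equiv_def clean_word_append spin_rel_inf_append)

lift_definition uminus_spin :: "spin \<Rightarrow> spin" is inverse_word
  by (simp add: spin_equiv_def clean_word_inverse spin_rel_inf_inverse)

definition minus_spin :: "spin \<Rightarrow> spin \<Rightarrow> spin" where
  "minus_spin g h = g + - h"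

instance
proof
  have refl: "spin_equiv w w" for w
    using spin_equivp by (simp add: equivp_reflp)
  fix a b c :: spin
  show "a + b + c = a + (b + c)" by transfer (simp add: refl)
  show "0 + a = a" by transfer (simp add: refl)
  show "a + 0 = a" by transfer (simp add: refl)
  show "- a + a = 0"
    by transfer (use inverse_word_left_inf in
        \<open>simp add: spin_equiv_def clean_word_append clean_word_inverse clean_word_Nil\<close>)
  show "a + - b = a - b" by (simp add: minus_spin_def)
qed

end

lemma elt_append: "elt (u @ v) = elt u + elt v"
  by (simp add: plus_spin.abs_eq)

lemma elt_Nil [simp]: "elt [] = 0"
  by (simp add: zero_spin_def)

lemma elt_Cons: "elt (l # w) = elt [l] + elt w"
  using elt_append[of "[l]" w] by simp

lemma elt_inverse_word: "elt (inverse_word w) = - elt w"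
  by (simp add: uminus_spin.abs_eq)

lemma elt_concat: "elt (concat ws) = sum_list (map elt ws)"
  by (induction ws) (simp_all add: elt_append)

lift_definition sperm :: "spin \<Rightarrow> nat \<Rightarrow> nat" is "\<lambda>w. word_perm (clean_word w)"
  using word_perm_spin_rel by (auto simp: spin_equiv_def spin_rel_inf_iff)

lemma even_word_spin_rel:
  assumes "(u, v) \<in> spin_rel n"
  shows "even_word u = even_word v"
proof (rule presentation_rel_invariant[OF assms[unfolded spin_rel_def], where m = "(=)"])
  fix u v assume "(u, v) \<in> spin_relations n"
  then show "even_word u = even_word v"
    unfolding spin_relations_def by (auto simp: even_word_def)
qed (auto simp: even_word_def)

lift_definition sodd :: "spin \<Rightarrow> bool" is "\<lambda>w. \<not> even_word (clean_word w)"
  using even_word_spin_rel by (auto simp: spin_equiv_def spin_rel_inf_iff)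

text \<open>The subgroup \<open>sub n\<close> is the image of \<open>spin_group n\<close>.\<close>

definition sub :: "nat \<Rightarrow> spin set" where
  "sub n = elt ` spin_words n"

definition zz :: spin where "zz = elt [z_letter]"

definition tt :: "nat \<Rightarrow> spin" where "tt i = elt [t_letter i]"

definition zpow :: "bool \<Rightarrow> spin" where "zpow b = (if b then zz else 0)"

lemma sperm_elt: "w \<in> spin_words n \<Longrightarrow> sperm (elt w) = word_perm w"
  by (simp add: sperm.abs_eq clean_word_id)

lemma sodd_elt: "w \<in> spin_words n \<Longrightarrow> sodd (elt w) \<longleftrightarrow> \<not> even_word w"
  by (simp add: sodd.abs_eq clean_word_id)

lemma sperm_plus: "sperm (g + h) = sperm g \<circ> sperm h"
  by transfer (simp add: clean_word_append word_perm_append)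

lemma sodd_plus: "sodd (g + h) \<longleftrightarrow> sodd g \<noteq> sodd h"
  by transfer (simp add: clean_word_append even_word_def)

lemma sperm_zero [simp]: "sperm 0 = id"
  by transfer (simp add: clean_word_def)

lemma sodd_zero [simp]: "\<not> sodd 0"
  by transfer (simp add: clean_word_def even_word_def)

lemma elt_eq_iff_inf:
  assumes "u \<in> spin_words n" "v \<in> spin_words n"
  shows "elt u = elt v \<longleftrightarrow> (u, v) \<in> spin_rel_inf"
  using assms by (simp add: spin.abs_eq_iff spin_equiv_def clean_word_id)

lemma zz_nonzero: "zz \<noteq> 0"
proof -
  have "elt [z_letter] \<noteq> elt []"
    using elt_eq_iff_inf[of "[z_letter]" 0 "[]"] z_letter_not_trivial by (auto simp: spin_rel_inf_iff)
  then show ?thesis by (simp add: zz_def)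
qed

lemma elt_eqI: "(u, v) \<in> spin_rel n \<Longrightarrow> elt u = elt v"
  using elt_eq_iff_inf spin_rel_words spin_rel_inf_iff by blast

lemma spin_cases:
  obtains n w where "g = elt w" "w \<in> spin_words n"
proof -
  obtain w where w: "g = elt w" by (metis Quotient_abs_rep Quotient_spin)
  obtain n where n: "clean_word w \<in> spin_words n" using clean_word_words by blast
  have "elt w = elt (clean_word w)"
    using n spin_rel_refl
    by (auto simp: spin.abs_eq_iff spin_equiv_def clean_word_id[OF n] spin_rel_inf_iff)
  then show thesis using that n w by blast
qed

lemma spin_in_sub: "\<exists>n. g \<in> sub n"
  by (rule spin_cases[of g]) (auto simp: sub_def)

lemma zz_zz [simp]: "zz + zz = 0"
  unfolding zz_def elt_append[symmetric] using elt_eqI[OF spin_rel_zz] by simp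

lemma zz_zz_left [simp]: "zz + (zz + g) = g"
  by (simp flip: add.assoc)

lemma zz_commute: "g + zz = zz + g"
proof (rule spin_cases[of g])
  fix n w assume "g = elt w" "w \<in> spin_words n"
  then show ?thesis
    using elt_eqI[OF spin_rel_z_commute] by (simp add: zz_def flip: elt_append)
qed

lemma zz_pull:
  "NO_MATCH zz g \<Longrightarrow> g + zz = zz + g"
  "NO_MATCH zz g \<Longrightarrow> g + (zz + h) = zz + (g + h)"
  by (simp_all add: zz_commute flip: add.assoc)

lemma minus_zz [simp]: "- zz = zz"
  by (rule minus_unique) simp

lemma sperm_zz [simp]: "sperm zz = id"
  using sperm_elt[of "[z_letter]" 0] by (simp add: zz_def word_perm_Cons)

lemma sodd_zz [simp]: "\<not> sodd zz"
  using sodd_elt[of "[z_letter]" 0] by (simp add: zz_def even_word_def)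

lemma zz_plus_neq: "zz + g \<noteq> g"
proof
  assume "zz + g = g"
  then have "zz + g = 0 + g" by simp
  then show False using zz_nonzero by (simp only: add_right_cancel)
qed

text \<open>The natural maps into the union are injective. An element of the kernel lies over the
  identity permutation, hence is 1 or \<open>z\<close> already in the group for \<open>n\<close>,
  and \<open>z\<close> survives in the union by the Clifford action.\<close>

lemma elt_eq_iff:
  assumes "u \<in> spin_words n" "v \<in> spin_words n"
  shows "elt u = elt v \<longleftrightarrow> (u, v) \<in> spin_rel n"
proof
  assume eq: "elt u = elt v"
  then have "word_perm u = word_perm v" using sperm_elt assms by metis
  then have "word_perm (inverse_word v @ u) = word_perm (inverse_word v @ v)"
    by (simp add: word_perm_append)
  also have "\<dots> = id"
    using word_perm_spin_rel[OF spin_rel_inverse_left[OF assms(2)]] by simp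
  finally have "(inverse_word v @ u, []) \<in> spin_rel n \<or> (inverse_word v @ u, [z_letter]) \<in> spin_rel n"
    using word_perm_trivial[of "inverse_word v @ u" n] assms by simp
  moreover have "(inverse_word v @ u, [z_letter]) \<notin> spin_rel n"
    using elt_eqI[of "inverse_word v @ u" "[z_letter]" n] eq zz_nonzero
    by (auto simp: elt_append elt_inverse_word zz_def)
  ultimately have "(v @ (inverse_word v @ u), v @ []) \<in> spin_rel n"
    using assms by (intro spin_rel_append spin_rel_refl) auto
  moreover have "((v @ inverse_word v) @ u, [] @ u) \<in> spin_rel n"
    using assms spin_rel_inverse_left[of "inverse_word v" n]
    by (intro spin_rel_append spin_rel_refl) auto
  ultimately show "(u, v) \<in> spin_rel n"
    by (auto intro: spin_rel_sym spin_rel_trans)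
qed (rule elt_eqI)

lemma sperm_kernel:
  assumes "sperm g = id"
  shows "g = 0 \<or> g = zz"
proof (rule spin_cases[of g])
  fix n w assume "g = elt w" "w \<in> spin_words n"
  then show ?thesis
    using assms word_perm_trivial[of w n] sperm_elt[of w n] elt_eqI by (fastforce simp: zz_def)
qed

lemma sperm_left: "sperm (- g) (sperm g x) = x"
  using sperm_plus[of "- g" g] by (simp add: fun_eq_iff)

lemma sperm_right: "sperm g (sperm (- g) x) = x"
  using sperm_plus[of g "- g"] by (simp add: fun_eq_iff)

lemma sperm_eq:
  assumes "sperm g = sperm h"
  shows "g = h \<or> g = zz + h"
proof -
  have "sperm (g + - h) = id"
    using assms sperm_right[of h] by (auto simp: sperm_plus fun_eq_iff simp del: add_uminus_conv_diff)
  then have "g - h = 0 \<or> g - h = zz" by (intro sperm_kernel) simp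
  then have "(g - h) + h = 0 + h \<or> (g - h) + h = zz + h" by metis
  then show ?thesis by (simp only: diff_add_cancel add_0_left)
qed

lemma sub_iff: "g \<in> sub n \<longleftrightarrow> sperm g permutes {1..n}"
proof
  show "sperm g permutes {1..n}" if "g \<in> sub n"
    using that word_perm_permutes by (auto simp: sub_def sperm_elt)
next
  assume "sperm g permutes {1..n}"
  then obtain w where w: "w \<in> spin_words n" "word_perm w = sperm g" using word_perm_surj by blast
  then have "sperm g = sperm (elt w)" by (simp add: sperm_elt)
  then consider "g = elt w" | "g = elt ([z_letter] @ w)"
    using sperm_eq by (auto simp: zz_def elt_append simp del: append_Cons append_Nil)
  then show "g \<in> sub n" unfolding sub_def using w(1) by cases auto
qed

lemma sub_surj:
  assumes "p permutes {1..n}"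
  shows "\<exists>g\<in>sub n. sperm g = p"
  using word_perm_surj[OF assms] sperm_elt unfolding sub_def by blast

lemma sub_mono: "n \<le> m \<Longrightarrow> sub n \<subseteq> sub m"
  using spin_words_mono by (auto simp: sub_def)

lemma sub_plus: "g \<in> sub n \<Longrightarrow> h \<in> sub n \<Longrightarrow> g + h \<in> sub n"
  by (simp add: sub_iff sperm_plus permutes_compose)

lemma sub_zero [simp]: "0 \<in> sub n"
  by (simp add: sub_iff permutes_id)

lemma sub_zz [simp]: "zz \<in> sub n"
  by (simp add: sub_iff permutes_id)

lemma sub_uminus:
  assumes "g \<in> sub n"
  shows "- g \<in> sub n"
proof -
  obtain w where "w \<in> spin_words n" "g = elt w" using assms by (auto simp: sub_def)
  then have "- g = elt (inverse_word w)" "inverse_word w \<in> spin_words n"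
    by (simp_all add: elt_inverse_word)
  then show ?thesis by (auto simp: sub_def)
qed

lemma sub_minus: "g \<in> sub n \<Longrightarrow> h \<in> sub n \<Longrightarrow> g - h \<in> sub n"
  using sub_plus[of g n "- h"] sub_uminus[of h n] by simp

lemma finite_sub: "finite (sub n)"
proof (rule finite_subset)
  define r where "r p = (SOME g. sperm g = p)" for p
  show "sub n \<subseteq> r ` {p. p permutes {1..n}} \<union> (\<lambda>g. zz + g) ` r ` {p. p permutes {1..n}}"
  proof
    fix g assume g: "g \<in> sub n"
    have "sperm (r (sperm g)) = sperm g" unfolding r_def by (rule someI[of _ g]) simp
    then have "g = r (sperm g) \<or> g = zz + r (sperm g)" using sperm_eq by metis
    then show "g \<in> r ` {p. p permutes {1..n}} \<union> (\<lambda>g. zz + g) ` r ` {p. p permutes {1..n}}"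
      using g by (auto simp: sub_iff)
  qed
qed (auto intro: finite_permutations)

lemma tt_square: "1 \<le> i \<Longrightarrow> tt i + tt i = zz"
  unfolding tt_def zz_def elt_append[symmetric]
  by (rule elt_eqI[of _ _ "Suc i"], rule spin_rel_relation) (auto simp: spin_relations_def)

lemma tt_braid: "1 \<le> i \<Longrightarrow> tt i + (tt (Suc i) + tt i) = tt (Suc i) + (tt i + tt (Suc i))"
  unfolding tt_def zz_def elt_append[symmetric]
  by (rule elt_eqI[of _ _ "i + 2"], rule spin_rel_relation) (auto simp: spin_relations_def)

lemma tt_anticommute:
  "1 \<le> i \<Longrightarrow> 1 \<le> j \<Longrightarrow> Suc i < j \<or> Suc j < i \<Longrightarrow> tt j + tt i = zz + (tt i + tt j)"
  unfolding tt_def zz_def elt_append[symmetric]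
  by (rule elt_eqI[of _ _ "max (Suc i) (Suc j)"], rule spin_rel_relation)
    (auto simp: spin_relations_def)

lemma sperm_tt: "1 \<le> i \<Longrightarrow> sperm (tt i) = transpose i (Suc i)"
  using sperm_elt[of "[t_letter i]" "Suc i"] by (simp add: tt_def word_perm_Cons)

lemma sodd_tt: "1 \<le> i \<Longrightarrow> sodd (tt i)"
  using sodd_elt[of "[t_letter i]" "Suc i"] by (simp add: tt_def even_word_def)

text \<open>Induction over words without inverse letters: \<open>- tt i\<close> equals
  \<open>zz + tt i\<close>, so the step for \<open>zz\<close> takes care of the inverses.\<close>

lemma sub_induct [consumes 1, case_names zero zz tt]:
  assumes "g \<in> sub n" "P 0" "\<And>g. P g \<Longrightarrow> P (zz + g)"
    "\<And>i g. g \<in> sub n \<Longrightarrow> 1 \<le> i \<Longrightarrow> i < n \<Longrightarrow> P g \<Longrightarrow> P (tt i + g)"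
  shows "P g"
proof -
  obtain w where w: "w \<in> spin_words n" "g = elt w" using assms(1) by (auto simp: sub_def)
  have "P (elt w)" using w(1)
  proof (induction w)
    case Nil
    then show ?case using assms(2) by simp
  next
    case (Cons l w)
    obtain x b where l: "l = (x, b)" by fastforce
    have w: "w \<in> spin_words n" and x: "x \<in> spin_gens n" using Cons.prems unfolding l by simp_all
    have P: "P (elt w)" using Cons.IH w by blast
    have inv: "elt [(x, False)] = - elt [(x, True)]" for x
      using elt_inverse_word[of "[(x, True)]"] by (simp add: inverse_word_def)
    show ?case
    proof (cases x)
      case (GenT i)
      have i: "1 \<le> i" "i < n" using x GenT by auto
      have "- tt i = zz + tt i"
        by (rule minus_unique) (simp add: zz_pull tt_square[OF i(1)])
      moreover have "P (tt i + elt w)" "P (zz + (tt i + elt w))"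
        using assms(3,4) i P w by (auto simp: sub_def)
      ultimately show ?thesis
        using GenT l inv[of x] elt_Cons[of l w] by (cases b) (simp_all add: tt_def add.assoc)
    next
      case GenZ
      then have "elt [l] = zz" using l inv[of GenZ] minus_zz by (cases b) (simp_all add: zz_def)
      then show ?thesis using assms(3)[OF P] elt_Cons[of l w] by simp
    qed
  qed
  then show ?thesis using w by simp
qed

section \<open>Lifts of transpositions and cycles\<close>

text \<open>The elements \<open>xx n i\<close> and \<open>cyc n c\<close> are the paper's \<open>x\<^sub>i\<close> and \<open>[i\<^sub>1, \<dots>, i\<^sub>m]\<close>,
  both computed in the double cover for \<open>n + 1\<close> points.\<close>

definition xx :: "nat \<Rightarrow> nat \<Rightarrow> spin" where "xx n i = elt (x_word n i)"

lemma xx_self: "xx n n = tt n"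
  by (simp add: xx_def x_word_def tt_def)

lemma xx_rec: "i < n \<Longrightarrow> xx n i = tt i + (xx n (Suc i) + tt i)"
  by (simp add: xx_def x_word_def tt_def upt_conv_Cons flip: elt_append)

lemma sperm_xx:
  assumes "1 \<le> i" "i \<le> n"
  shows "sperm (xx n i) = transpose i (Suc n)"
  using assms
proof (induction "n - i" arbitrary: i)
  case 0
  then show ?case by (simp add: xx_self sperm_tt)
next
  case (Suc d)
  then have "sperm (xx n (Suc i)) = transpose (Suc i) (Suc n)" by auto
  then show ?case
    using Suc(2,3) transpose_comp_triple[of i "Suc n" "Suc i"]
    by (simp add: xx_rec sperm_plus sperm_tt o_assoc)
qed

lemma sodd_xx: "1 \<le> i \<Longrightarrow> i \<le> n \<Longrightarrow> sodd (xx n i)"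
proof (induction "n - i" arbitrary: i)
  case (Suc d)
  then have "sodd (xx n (Suc i))" by auto
  then show ?case
    using Suc(2,3) by (auto simp: xx_rec sodd_plus sodd_tt)
qed (simp add: xx_self sodd_tt)

lemma tt_tt_left: "1 \<le> i \<Longrightarrow> tt i + (tt i + g) = zz + g"
  using tt_square by (simp flip: add.assoc)

lemma tt_braid_left:
  "1 \<le> i \<Longrightarrow> tt (Suc i) + (tt i + (tt (Suc i) + g)) = tt i + (tt (Suc i) + (tt i + g))"
  using tt_braid[of i] by (simp flip: add.assoc)

lemma tt_anticommute_left:
  assumes "1 \<le> i" "1 \<le> j" "Suc i < j \<or> Suc j < i"
  shows "tt j + (tt i + g) = zz + (tt i + (tt j + g))"
  using tt_anticommute[OF assms] by (simp flip: add.assoc)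

text \<open>The rule \<open>t_j x_i = z x_k t_j\<close>, where \<open>k\<close> is the image of
  \<open>i\<close> under the transposition of \<open>j\<close> and \<open>j + 1\<close>. The
  induction unfolds \<open>x_i\<close> to \<open>t_i x_(i+1) t_i\<close>. If \<open>t_j\<close> and
  \<open>t_i\<close> are far apart, passing both copies of \<open>t_i\<close> costs two signs, which
  cancel, and the sign in the claim is the one from \<open>x_(i+1)\<close>.\<close>

lemma tt_xx:
  assumes "1 \<le> j" "j < n" "1 \<le> i" "i \<le> n"
  shows "tt j + xx n i = zz + (xx n (transpose j (Suc j) i) + tt j)"
  using assms
proof (induction "n - i" arbitrary: i j rule: less_induct)
  case less
  note assms = less.prems
  consider "i = Suc j" | "i = j" | "Suc j < i" "i = n" | "Suc j < i" "i < n" | "j = Suc i" | "Suc i < j"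
    using less.prems by linarith
  then show ?case
  proof cases
    case 1
    then show ?thesis
      using assms xx_rec[of j n] by (simp add: tt_square zz_pull add.assoc)
  next
    case 2
    then show ?thesis
      using assms by (simp add: xx_rec tt_tt_left add.assoc)
  next
    case 3
    then show ?thesis
      using assms less.prems by (simp add: xx_self tt_anticommute[of n j])
  next
    case 4
    let ?X = "xx n (Suc i)"
    have IH: "tt j + (?X + g) = zz + (?X + (tt j + g))" for g
      using less.hyps[of "Suc i" j] 4 assms by (simp flip: add.assoc)
    have "tt j + xx n i = tt j + (tt i + (?X + tt i))" using 4 by (simp add: xx_rec)
    also have "\<dots> = zz + (tt i + (tt j + (?X + tt i)))"
      using 4 assms less.prems by (simp add: tt_anticommute_left[of i j])
    also have "\<dots> = tt i + (?X + (tt j + tt i))" by (simp add: IH zz_pull)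
    also have "\<dots> = zz + (tt i + (?X + (tt i + tt j)))"
      using 4 assms less.prems by (simp add: tt_anticommute[of i j] zz_pull)
    finally show ?thesis using 4 by (simp add: xx_rec add.assoc)
  next
    \<comment> \<open>Here \<open>tt j\<close> is adjacent to \<open>tt i\<close>. After unfolding
      \<open>xx n i\<close> twice, the braid relation brings \<open>tt i\<close> next to
      \<open>?Y\<close>, the induction hypothesis takes it through with one sign, and a second braid
      restores the shape.\<close>
    case 5
    let ?Y = "xx n (Suc j)"
    have IH: "tt i + (?Y + g) = zz + (?Y + (tt i + g))" for g
      using less.hyps[of "Suc j" i] 5 assms by (simp flip: add.assoc)
    have "tt j + xx n i = tt j + (tt i + (tt j + (?Y + (tt j + tt i))))"
      using 5 assms by (simp add: xx_rec add.assoc)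
    also have "\<dots> = tt i + (tt j + (tt i + (?Y + (tt j + tt i))))"
      using 5 less.prems by (simp add: tt_braid_left)
    also have "\<dots> = zz + (tt i + (tt j + (?Y + (tt i + (tt j + tt i)))))" by (simp add: IH zz_pull)
    also have "\<dots> = zz + (tt i + (tt j + (?Y + (tt j + (tt i + tt j)))))"
      using 5 less.prems by (simp add: tt_braid)
    finally show ?thesis using 5 assms by (simp add: xx_rec add.assoc)
  next
    case 6
    let ?X = "xx n (Suc i)"
    have IH: "tt j + (?X + g) = zz + (?X + (tt j + g))" for g
      using less.hyps[of "Suc i" j] 6 assms by (simp flip: add.assoc)
    have "tt j + xx n i = tt j + (tt i + (?X + tt i))" using 6 assms by (simp add: xx_rec)
    also have "\<dots> = zz + (tt i + (tt j + (?X + tt i)))"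
      using 6 assms less.prems by (simp add: tt_anticommute_left[of i j])
    also have "\<dots> = tt i + (?X + (tt j + tt i))" by (simp add: IH zz_pull)
    also have "\<dots> = zz + (tt i + (?X + (tt i + tt j)))"
      using 6 assms less.prems by (simp add: tt_anticommute[of i j] zz_pull)
    finally show ?thesis using 6 assms by (simp add: xx_rec add.assoc)
  qed
qed

lemma zpow_simps [simp]: "zpow True = zz" "zpow False = 0"
  by (simp_all add: zpow_def)

lemma zpow_commute: "g + (zpow b + h) = zpow b + (g + h)"
  by (cases b) (simp_all add: zz_commute flip: add.assoc)

lemma zpow_pull: "NO_MATCH (zpow a) g \<Longrightarrow> g + (zpow b + h) = zpow b + (g + h)"
  by (rule zpow_commute)

lemma zpow_add: "zpow a + zpow b = zpow (a \<noteq> b)" "zpow a + (zpow b + g) = zpow (a \<noteq> b) + g"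
  by (cases a; cases b; simp)+

lemma conj_xx:
  assumes "g \<in> sub n" "i \<in> {1..n}"
  shows "g + xx n i = zpow (sodd g) + (xx n (sperm g i) + g)"
  using assms(1)
proof (induction rule: sub_induct)
  case (zz g)
  then show ?case by (cases "sodd g") (simp_all add: sodd_plus sperm_plus add.assoc zz_pull)
next
  case (tt j g)
  have j: "sperm g i \<in> {1..n}"
    using tt(1) assms(2) by (simp add: sub_iff permutes_in_image del: atLeastAtMost_iff)
  have "tt j + g + xx n i = zpow (sodd g) + ((tt j + xx n (sperm g i)) + g)"
    by (simp add: add.assoc tt zpow_pull)
  also have "\<dots> = zpow (sodd g) + (zpow True + (xx n (transpose j (Suc j) (sperm g i)) + (tt j + g)))"
    using tt_xx[of j n "sperm g i"] tt(2,3) j by (simp add: add.assoc)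
  finally show ?case
    using tt(2) by (simp add: zpow_add sodd_plus sodd_tt sperm_plus sperm_tt del: zpow_simps)
qed simp

definition cyc :: "nat \<Rightarrow> nat list \<Rightarrow> spin" where "cyc n c = elt (cycle_word n c)"

lemma cyc_eq: "cyc n c = xx n (hd c) + sum_list (map (xx n) (rev c))"
  unfolding cyc_def cycle_word_def elt_append elt_concat by (simp add: xx_def[abs_def] o_def)

lemma conj_sum_xx:
  assumes "g \<in> sub n" "set is \<subseteq> {1..n}"
  shows "g + sum_list (map (xx n) is) =
    zpow (sodd g \<and> odd (length is)) + (sum_list (map (xx n) (map (sperm g) is)) + g)"
  using assms(2)
proof (induction "is")
  case (Cons i "is")
  have "g + sum_list (map (xx n) (i # is)) = (g + xx n i) + sum_list (map (xx n) is)"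
    by (simp add: add.assoc)
  also have "\<dots> = zpow (sodd g) + (xx n (sperm g i) + (g + sum_list (map (xx n) is)))"
    using conj_xx[OF assms(1)] Cons.prems by (simp add: add.assoc)
  also have "g + sum_list (map (xx n) is) =
      zpow (sodd g \<and> odd (length is)) + (sum_list (map (xx n) (map (sperm g) is)) + g)"
    using Cons by simp
  finally show ?case
    by (cases "sodd g"; cases "even (length is)") (simp_all add: zz_pull add.assoc)
qed simp

text \<open>A cycle of length \<open>m\<close> is a product of \<open>m + 1\<close> elements
  \<open>xx\<close>, each of which contributes the sign of \<open>g\<close>. Thus cycles of odd
  length are permuted without any sign.\<close>

lemma conj_cyc:
  assumes "g \<in> sub n" "set c \<subseteq> {1..n}" "c \<noteq> []"
  shows "g + cyc n c = zpow (sodd g \<and> even (length c)) + (cyc n (map (sperm g) c) + g)"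
proof -
  have hd: "hd c \<in> {1..n}" using assms(2,3) hd_in_set by blast
  have "g + cyc n c = (g + xx n (hd c)) + sum_list (map (xx n) (rev c))"
    by (simp add: cyc_eq add.assoc)
  also have "\<dots> = zpow (sodd g) + (xx n (sperm g (hd c)) + (g + sum_list (map (xx n) (rev c))))"
    using conj_xx[OF assms(1) hd] by (simp add: add.assoc)
  also have "g + sum_list (map (xx n) (rev c)) =
      zpow (sodd g \<and> odd (length c)) + (sum_list (map (xx n) (map (sperm g) (rev c))) + g)"
    using conj_sum_xx[OF assms(1), of "rev c"] assms(2) by simp
  finally show ?thesis
    using assms(3) by (cases "sodd g"; cases "even (length c)")
      (simp_all add: cyc_eq rev_map hd_map zz_pull add.assoc)
qed

lemma sodd_sum_xx:
  "set is \<subseteq> {1..n} \<Longrightarrow> sodd (sum_list (map (xx n) is)) \<longleftrightarrow> odd (length is)"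
  by (induction "is") (auto simp: sodd_plus sodd_xx)

lemma sodd_cyc: "set c \<subseteq> {1..n} \<Longrightarrow> c \<noteq> [] \<Longrightarrow> sodd (cyc n c) \<longleftrightarrow> even (length c)"
  using sodd_sum_xx[of "rev c" n] sodd_xx[of "hd c" n] subsetD[OF _ hd_in_set, of c "{1..n}"]
  by (simp add: cyc_eq sodd_plus)

lemma sperm_sum_xx:
  assumes "set c \<subseteq> {1..n}" "distinct c"
  shows "sperm (sum_list (map (xx n) (rev c))) = cycle_of_list (Suc n # c)"
  using assms
proof (induction c rule: rev_induct)
  case (snoc b c)
  \<comment> \<open>Rotation puts \<open>b\<close> in front, after which
    \<open>cycle_of_list\<close> splits off the transposition of \<open>b\<close> and
    \<open>Suc n\<close>, which is the permutation of the new factor.\<close>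
  have "cycle_of_list ((Suc n # c) @ [b]) = cycle_of_list (rotate (length (Suc n # c)) ((Suc n # c) @ [b]))"
    by (rule cycle_of_list_rotate_independent) (use snoc.prems in auto)
  also have "rotate (length (Suc n # c)) ((Suc n # c) @ [b]) = [b] @ Suc n # c"
    by (rule rotate_append)
  finally have "cycle_of_list (Suc n # c @ [b]) = transpose b (Suc n) \<circ> cycle_of_list (Suc n # c)"
    by (simp add: comp_def)
  then show ?case
    using snoc by (simp add: sperm_plus sperm_xx comp_def)
qed simp

lemma sperm_cyc:
  assumes "set c \<subseteq> {1..n}" "distinct c" "c \<noteq> []"
  shows "sperm (cyc n c) = cycle_of_list c"
proof -
  obtain i d where c: "c = i # d" using assms(3) by (cases c) auto
  \<comment> \<open>The product of the remaining factors is the cycle through \<open>Suc n\<close>;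
    the leading factor cancels its outermost transposition and thereby removes \<open>Suc n\<close>
    from it.\<close>
  have "sperm (cyc n c) = transpose i (Suc n) \<circ> (transpose (Suc n) i \<circ> cycle_of_list c)"
    unfolding cyc_eq sperm_plus sperm_sum_xx[OF assms(1,2)] using assms c by (simp add: sperm_xx)
  then show ?thesis by (simp add: fun_eq_iff transpose_commute)
qed

definition cycs :: "nat \<Rightarrow> nat list list \<Rightarrow> spin" where
  "cycs n cs = sum_list (map (cyc n) cs)"

lemma cycs_elt: "elt (concat (map (cycle_word n) cs)) = cycs n cs"
  by (simp add: cycs_def elt_concat cyc_def[abs_def] o_def)

lemma cycs_simps [simp]: "cycs n [] = 0" "cycs n (c # cs) = cyc n c + cycs n cs"
  by (simp_all add: cycs_def)

definition cperm :: "'a list list \<Rightarrow> 'a \<Rightarrow> 'a" where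
  "cperm cs = foldr (\<lambda>c p. cycle_of_list c \<circ> p) cs id"

lemma cperm_simps [simp]: "cperm [] = id" "cperm (c # cs) = cycle_of_list c \<circ> cperm cs"
  by (simp_all add: cperm_def)

lemma sperm_cycs:
  assumes "set (concat cs) \<subseteq> {1..n}" "distinct (concat cs)" "[] \<notin> set cs"
  shows "sperm (cycs n cs) = cperm cs"
  using assms
proof (induction cs)
  case (Cons c cs)
  then have "sperm (cyc n c) = cycle_of_list c" by (intro sperm_cyc) auto
  then show ?case using Cons by (simp add: sperm_plus)
qed simp

lemma sodd_cycs:
  assumes "set (concat cs) \<subseteq> {1..n}" "\<forall>c\<in>set cs. odd (length c)"
  shows "\<not> sodd (cycs n cs)"
  using assms
proof (induction cs)
  case (Cons c cs)
  then have "\<not> sodd (cyc n c)" by (subst sodd_cyc) auto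
  then show ?case using Cons by (simp add: sodd_plus)
qed simp

lemma conj_cycs:
  assumes "g \<in> sub n" "set (concat cs) \<subseteq> {1..n}" "\<forall>c\<in>set cs. odd (length c)"
  shows "g + cycs n cs = cycs n (map (map (sperm g)) cs) + g"
  using assms(2,3)
proof (induction cs)
  case (Cons c cs)
  then have "g + cyc n c = cyc n (map (sperm g) c) + g"
    using conj_cyc[OF assms(1), of c] by fastforce
  then have "g + cycs n (c # cs) = cyc n (map (sperm g) c) + (g + cycs n cs)"
    by (simp flip: add.assoc)
  then show ?case using Cons by (simp add: add.assoc)
qed simp

lemma cycle_of_list_mem_iff: "distinct c \<Longrightarrow> cycle_of_list c x \<in> set c \<longleftrightarrow> x \<in> set c"
  using permutes_in_image[OF cycle_permutes] by fast

lemma cperm_apply: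
  assumes "distinct (concat cs)"
  shows "c \<in> set cs \<Longrightarrow> x \<in> set c \<Longrightarrow> cperm cs x = cycle_of_list c x"
    and "x \<notin> set (concat cs) \<Longrightarrow> cperm cs x = x"
proof -
  have "(\<forall>c\<in>set cs. \<forall>x\<in>set c. cperm cs x = cycle_of_list c x) \<and>
    (\<forall>x. x \<notin> set (concat cs) \<longrightarrow> cperm cs x = x)"
    using assms
  proof (induction cs)
    case (Cons d cs)
    have d: "distinct d" "set d \<inter> set (concat cs) = {}" using Cons.prems by auto
    have IH: "\<And>c x. c \<in> set cs \<Longrightarrow> x \<in> set c \<Longrightarrow> cperm cs x = cycle_of_list c x"
      "\<And>x. x \<notin> set (concat cs) \<Longrightarrow> cperm cs x = x"
      using Cons by auto
    have "cperm (d # cs) x = cycle_of_list c x" if "c \<in> set (d # cs)" "x \<in> set c" for c x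
    proof (cases "c \<in> set cs")
      case True
      have "distinct c" using True Cons.prems by (simp add: distinct_concat_iff)
      from cycle_of_list_mem_iff[OF this] have "cycle_of_list c x \<in> set c" using that(2) by simp
      then have "cycle_of_list c x \<in> set (concat cs)" using True by auto
      then have "cycle_of_list c x \<notin> set d" using d(2) by blast
      then show ?thesis using IH(1)[OF True that(2)] by (simp add: id_outside_supp)
    next
      case False
      then have "c = d" using that by simp
      then have "x \<notin> set (concat cs)" using d(2) that(2) by blast
      then show ?thesis using IH(2) \<open>c = d\<close> by simp
    qed
    moreover have "cperm (d # cs) x = x" if "x \<notin> set (concat (d # cs))" for x
      using that IH(2)[of x] by (simp add: id_outside_supp)
    ultimately show ?case by blast
  qed simp
  then show "c \<in> set cs \<Longrightarrow> x \<in> set c \<Longrightarrow> cperm cs x = cycle_of_list c x"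
    "x \<notin> set (concat cs) \<Longrightarrow> cperm cs x = x" by auto
qed

lemma cycle_of_list_moves:
  assumes "distinct c" "2 \<le> length c" "x \<in> set c"
  shows "cycle_of_list c x \<noteq> x"
proof -
  have "map (cycle_of_list c) c = rotate1 c"
    using cyclic_rotation[OF assms(1), of 1] by simp
  moreover obtain k where k: "k < length c" "c ! k = x" using assms(3) by (auto simp: in_set_conv_nth)
  ultimately have "cycle_of_list c x = rotate1 c ! k" by (metis nth_map)
  also have "\<dots> = c ! (Suc k mod length c)" using k by (simp add: nth_rotate1)
  also have "\<dots> \<noteq> c ! k"
  proof -
    have "Suc k mod length c \<noteq> k" using k assms(2) by (cases "Suc k = length c") auto
    moreover have "Suc k mod length c < length c" using k by (intro mod_less_divisor) auto
    ultimately show ?thesis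
      using nth_eq_iff_index_eq[OF assms(1), of "Suc k mod length c" k] k(1) by blast
  qed
  finally show ?thesis using k by simp
qed

lemma cperm_moved:
  assumes "distinct (concat cs)" "\<forall>c\<in>set cs. 2 \<le> length c"
  shows "{x. cperm cs x \<noteq> x} = set (concat cs)"
proof -
  have "cperm cs x \<noteq> x" if "c \<in> set cs" "x \<in> set c" for c x
    using cperm_apply(1)[OF assms(1) that] cycle_of_list_moves[of c x] assms that
    by (auto simp: distinct_concat_iff)
  then have "cperm cs x \<noteq> x \<longleftrightarrow> x \<in> set (concat cs)" for x
    using cperm_apply(2)[OF assms(1), of x] by auto
  then show ?thesis by blast
qed

lemma cperm_permutes: "distinct (concat cs) \<Longrightarrow> cperm cs permutes set (concat cs)"
proof (induction cs)
  case (Cons c cs)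
  have "cycle_of_list c permutes set (concat (c # cs))" "cperm cs permutes set (concat (c # cs))"
    using Cons by (auto intro: permutes_subset[OF cycle_permutes] permutes_subset)
  then show ?case by (simp only: cperm_simps) (rule permutes_compose)
qed (simp add: permutes_id)

text \<open>The product of the lengths is a convenient multiple of the order: it is odd when all
  lengths are odd, as \<open>conjugate_eqI\<close> demands.\<close>

lemma cperm_funpow_id:
  assumes "distinct (concat cs)"
  shows "(cperm cs ^^ (prod_list (map length cs))) = id"
proof
  fix x
  show "(cperm cs ^^ (prod_list (map length cs))) x = id x"
  proof (cases "x \<in> set (concat cs)")
    case True
    then obtain c where c: "c \<in> set cs" "x \<in> set c" by auto
    have dc: "distinct c" using c assms by (auto simp: distinct_concat_iff)
    have iter: "(cperm cs ^^ k) x = (cycle_of_list c ^^ k) x \<and> (cycle_of_list c ^^ k) x \<in> set c" for k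
      using cperm_apply(1)[OF assms c(1)] c(2) cycle_of_list_mem_iff[OF dc] by (induction k) auto
    have "length c dvd prod_list (map length cs)"
      using c(1) by (induction cs) auto
    then obtain m where m: "prod_list (map length cs) = length c * m" by auto
    have "cycle_of_list c ^^ (length c * m) = id"
      using cycle_is_id_root[OF dc] by (simp flip: funpow_mult add: id_funpow)
    then show ?thesis using iter m by simp
  next
    case False
    have "(cperm cs ^^ k) x = x" for k
      using cperm_apply(2)[OF assms False] by (induction k) auto
    then show ?thesis by simp
  qed
qed

section \<open>The classes of even partitions\<close>

lemma xx_Suc:
  assumes "1 \<le> i" "i \<le> n"
  shows "xx (Suc n) i = tt (Suc n) + (xx n i + tt (Suc n))"
  using assms
proof (induction "n - i" arbitrary: i)
  case 0
  then show ?case using xx_rec[of n "Suc n"] by (simp add: xx_self tt_braid)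
next
  case (Suc d)
  then have IH: "xx (Suc n) (Suc i) = tt (Suc n) + (xx n (Suc i) + tt (Suc n))" by auto
  have "i < n" using Suc(2) by simp
  have "xx (Suc n) i = tt i + (tt (Suc n) + (xx n (Suc i) + (tt (Suc n) + tt i)))"
    using Suc(2,3) by (simp add: xx_rec IH add.assoc)
  \<comment> \<open>Both copies of \<open>tt i\<close> anticommute with \<open>tt (Suc n)\<close>,
    and the two signs cancel. For \<open>i = n\<close> the claim was the braid relation.\<close>
  also have "\<dots> = tt (Suc n) + (tt i + (xx n (Suc i) + (tt i + tt (Suc n))))"
    using \<open>i < n\<close> Suc(3) tt_anticommute[of i "Suc n"]
    by (simp add: tt_anticommute_left[of "Suc n" i] zz_pull)
  also have "\<dots> = tt (Suc n) + (xx n i + tt (Suc n))"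
    using Suc(2,3) by (simp add: xx_rec[of i n] add.assoc)
  finally show ?case .
qed

lemma tt_Suc_xx:
  assumes "1 \<le> i" "i \<le> n"
  shows "tt (Suc n) + xx n i = zz + (xx (Suc n) i + tt (Suc n))"
  using assms by (simp add: xx_Suc tt_square zz_pull add.assoc)

lemma tt_Suc_sum_xx:
  assumes "set is \<subseteq> {1..n}"
  shows "tt (Suc n) + sum_list (map (xx n) is) =
    zpow (odd (length is)) + (sum_list (map (xx (Suc n)) is) + tt (Suc n))"
  using assms
proof (induction "is")
  case (Cons i "is")
  have "tt (Suc n) + sum_list (map (xx n) (i # is)) = (tt (Suc n) + xx n i) + sum_list (map (xx n) is)"
    by (simp add: add.assoc)
  also have "\<dots> = zz + (xx (Suc n) i + (tt (Suc n) + sum_list (map (xx n) is)))"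
    using tt_Suc_xx Cons.prems by (simp add: add.assoc)
  also have "tt (Suc n) + sum_list (map (xx n) is) =
      zpow (odd (length is)) + (sum_list (map (xx (Suc n)) is) + tt (Suc n))"
    using Cons by simp
  finally show ?case
    by (cases "even (length is)") (simp_all add: zz_pull add.assoc)
qed simp

lemma tt_Suc_cyc:
  assumes "set c \<subseteq> {1..n}" "odd (length c)"
  shows "tt (Suc n) + cyc n c = cyc (Suc n) c + tt (Suc n)"
proof -
  have "c \<noteq> []" using assms(2) by auto
  then have hd: "hd c \<in> {1..n}" using assms(1) hd_in_set by blast
  have "tt (Suc n) + cyc n c = (tt (Suc n) + xx n (hd c)) + sum_list (map (xx n) (rev c))"
    by (simp add: cyc_eq add.assoc)
  also have "\<dots> = zz + (xx (Suc n) (hd c) + (tt (Suc n) + sum_list (map (xx n) (rev c))))"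
    using tt_Suc_xx hd by (simp add: add.assoc)
  also have "tt (Suc n) + sum_list (map (xx n) (rev c)) =
      zz + (sum_list (map (xx (Suc n)) (rev c)) + tt (Suc n))"
    using tt_Suc_sum_xx[of "rev c" n] assms by simp
  finally show ?thesis by (simp add: cyc_eq zz_pull add.assoc)
qed

text \<open>If \<open>h = z g\<close> were conjugate to \<open>g\<close>, then so would be their odd powers \<open>z g\<^sup>M\<close> and \<open>g\<^sup>M\<close>, which
  are different central elements.\<close>

lemma conjugate_eqI:
  assumes conj: "w + g = h + w" and perm: "sperm h = sperm g" and odd: "odd M" and id: "sperm g ^^ M = id"
  shows "h = g"
proof (rule ccontr)
  define pw where "pw g k = ((+) g ^^ k) 0" for g :: spin and k
  have pw: "pw g 0 = 0" "pw g (Suc k) = g + pw g k" for g k by (simp_all add: pw_def)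
  have "w + pw g k = pw h k + w" for k
  proof (induction k)
    case (Suc k)
    have "w + (g + pw g k) = h + (w + pw g k)" using conj by (simp flip: add.assoc)
    then show ?case using Suc by (simp add: pw add.assoc)
  qed (simp add: pw)
  then have c: "w + pw g M = pw h M + w" by blast
  have "sperm (pw g k) = sperm g ^^ k" for k
    by (induction k) (simp_all add: pw sperm_plus)
  then have "pw g M = 0 \<or> pw g M = zz" using id sperm_kernel by simp
  then have "w + pw g M = pw g M + w" using zz_commute by auto
  then have "pw h M = pw g M" using c by simp
  moreover assume "h \<noteq> g"
  then have "h = zz + g" using sperm_eq[OF perm] by blast
  have "pw h k = zpow (odd k) + pw g k" for k
  proof (induction k)
    case (Suc k)
    then show ?case using \<open>h = zz + g\<close> by (cases "odd k") (simp_all add: pw zz_pull add.assoc)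
  qed (simp add: pw)
  then have "pw h M = zz + pw g M" using odd by simp
  ultimately show False using zz_plus_neq by metis
qed

text \<open>Conjugation by \<open>tt (Suc n)\<close> moves only the auxiliary point from
  \<open>n + 1\<close> to \<open>n + 2\<close>. So both sides are conjugate lifts of the same cycle,
  and its order is odd.\<close>

lemma cyc_Suc:
  assumes "set c \<subseteq> {1..n}" "distinct c" "odd (length c)"
  shows "cyc (Suc n) c = cyc n c"
proof (rule conjugate_eqI[OF tt_Suc_cyc])
  have "c \<noteq> []" using assms(3) by auto
  then show "sperm (cyc (Suc n) c) = sperm (cyc n c)" "sperm (cyc n c) ^^ length c = id"
    using assms cycle_is_id_root sperm_cyc[of c n] sperm_cyc[of c "Suc n"] by fastforce+
qed (use assms in auto)

lemma cyc_mono: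
  assumes "n \<le> m" "set c \<subseteq> {1..n}" "distinct c" "odd (length c)"
  shows "cyc m c = cyc n c"
  using assms(1)
proof (induction m rule: dec_induct)
  case (step m)
  have "set c \<subseteq> {1..m}" using assms(2) step(1) by fastforce
  then show ?case using step cyc_Suc assms by simp
qed simp

lemma cycs_mono:
  assumes "n \<le> m" "set (concat cs) \<subseteq> {1..n}" "distinct (concat cs)" "\<forall>c\<in>set cs. odd (length c)"
  shows "cycs m cs = cycs n cs"
  using assms(2-4)
proof (induction cs)
  case (Cons c cs)
  then show ?case using cyc_mono[OF assms(1), of c] by simp
qed simp

section \<open>Conjugacy and uniqueness of lifts\<close>

definition cycle_lists :: "nat \<Rightarrow> nat list \<Rightarrow> nat list list set" where
  "cycle_lists n lam = {cs. map length cs = map (\<lambda>p. p + 1) lam \<and> distinct (concat cs) \<and>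
     set (concat cs) \<subseteq> {1..n}}"

text \<open>\<open>DD n lam\<close> corresponds to \<open>D_class n lam\<close>, and \<open>DI lam\<close> below to \<open>D_class_inf lam\<close>.\<close>

definition DD :: "nat \<Rightarrow> nat list \<Rightarrow> spin set" where
  "DD n lam = cycs n ` cycle_lists n lam"

lemma cycle_lists_length:
  assumes "cs \<in> cycle_lists n lam" "lam \<in> even_partitions" "c \<in> set cs"
  shows "odd (length c)" "2 \<le> length c" "c \<noteq> []"
proof -
  have "length c \<in> set (map (\<lambda>p. p + 1) lam)"
    using assms(1,3) unfolding cycle_lists_def by (metis (mono_tags, lifting) image_eqI mem_Collect_eq set_map)
  then show "odd (length c)" "2 \<le> length c" using assms(2) by (auto simp: even_partitions_def)
  then show "c \<noteq> []" by auto
qed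

lemma cycle_lists_data:
  assumes "cs \<in> cycle_lists n lam"
  shows "set (concat cs) \<subseteq> {1..n}" "distinct (concat cs)"
    "length (concat cs) = sum_list lam + length lam"
proof -
  show "set (concat cs) \<subseteq> {1..n}" "distinct (concat cs)" using assms by (auto simp: cycle_lists_def)
  have "length (concat cs) = sum_list (map (\<lambda>p. p + 1) lam)"
    using assms by (simp add: length_concat cycle_lists_def)
  also have "\<dots> = sum_list lam + length lam" by (induction lam) auto
  finally show "length (concat cs) = sum_list lam + length lam" .
qed

lemma sperm_DD:
  assumes "cs \<in> cycle_lists n lam" "lam \<in> even_partitions"
  shows "sperm (cycs n cs) = cperm cs"
  using cycle_lists_data[OF assms(1)] cycle_lists_length(3)[OF assms] by (intro sperm_cycs) blast+

lemma DD_sub: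
  assumes "lam \<in> even_partitions" "g \<in> DD n lam"
  shows "g \<in> sub n"
proof -
  obtain cs where cs: "cs \<in> cycle_lists n lam" "g = cycs n cs" using assms(2) by (auto simp: DD_def)
  then show ?thesis
    using sperm_DD[OF cs(1) assms(1)] permutes_subset[OF cperm_permutes] cycle_lists_data[OF cs(1)]
    by (simp add: sub_iff)
qed

lemma DD_even:
  assumes "lam \<in> even_partitions" "g \<in> DD n lam"
  shows "\<not> sodd g"
proof -
  obtain cs where cs: "cs \<in> cycle_lists n lam" "g = cycs n cs" using assms(2) by (auto simp: DD_def)
  then show ?thesis
    using sodd_cycs[OF cycle_lists_data(1)[OF cs(1)]] cycle_lists_length(1)[OF cs(1) assms(1)] by blast
qed

lemma DD_conj:
  assumes "lam \<in> even_partitions" "g \<in> DD n lam" "w \<in> sub n"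
  shows "w + g - w \<in> DD n lam"
proof -
  obtain cs where cs: "cs \<in> cycle_lists n lam" "g = cycs n cs" using assms(2) by (auto simp: DD_def)
  let ?ds = "map (map (sperm w)) cs"
  have w: "sperm w permutes {1..n}" using assms(3) by (simp add: sub_iff)
  have "concat ?ds = map (sperm w) (concat cs)" by (simp add: map_concat)
  moreover have "map length ?ds = map length cs" by simp
  ultimately have "?ds \<in> cycle_lists n lam"
    using cs(1) permutes_inj_on[OF w] permutes_image[OF w]
    by (auto simp: cycle_lists_def distinct_map simp del: map_map set_concat)
  moreover have "w + g = cycs n ?ds + w"
    using conj_cycs[OF assms(3)] cs cycle_lists_data cycle_lists_length[OF _ assms(1)] by blast
  then have "w + g - w = cycs n ?ds" by (metis add_diff_cancel)
  ultimately show ?thesis by (auto simp: DD_def)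
qed

lemma permutes_extend:
  assumes "finite S" "set as \<subseteq> S" "set bs \<subseteq> S" "distinct as" "distinct bs" "length as = length bs"
  shows "\<exists>p. p permutes S \<and> map p as = bs"
proof -
  define f where "f x = bs ! (THE k. k < length as \<and> as ! k = x)" for x
  have f: "f (as ! k) = bs ! k" if "k < length as" for k
  proof -
    have "(THE j. j < length as \<and> as ! j = as ! k) = k"
      using that assms(4) by (intro the_equality) (auto simp: nth_eq_iff_index_eq)
    then show ?thesis by (simp add: f_def)
  qed
  have map_f: "map f as = bs" using f assms(6) by (intro nth_equalityI) auto
  have bij_f: "bij_betw f (set as) (set bs)"
    unfolding bij_betw_def using map_f assms(4,5) by (metis distinct_map list.set_map)
  have "card (set as) = card (set bs)" using assms by (simp add: distinct_card)
  then have "card (S - set as) = card (S - set bs)" using assms by (simp add: card_Diff_subset)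
  then obtain h where h: "bij_betw h (S - set as) (S - set bs)"
    using assms(1) finite_same_card_bij[of "S - set as" "S - set bs"] by auto
  define p where "p x = (if x \<in> set as then f x else if x \<in> S then h x else x)" for x
  have "bij_betw p (set as) (set bs)"
    using bij_f by (rule bij_betw_cong[THEN iffD1, rotated]) (simp add: p_def)
  moreover have "bij_betw p (S - set as) (S - set bs)"
    using h by (rule bij_betw_cong[THEN iffD1, rotated]) (simp add: p_def)
  ultimately have "bij_betw p (set as \<union> (S - set as)) (set bs \<union> (S - set bs))"
    by (intro bij_betw_combine) auto
  then have "bij_betw p S S" using assms by (simp add: Un_absorb1 Un_Diff_cancel)
  then have "p permutes S" by (rule bij_imp_permutes) (use assms(2) in \<open>auto simp: p_def\<close>)
  moreover have "map p as = bs" using map_f by (auto simp: p_def cong: map_cong)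
  ultimately show ?thesis by blast
qed

text \<open>The lists of cycles have the same shape, so a permutation matching their entries in
  order carries one to the other. Any lift of it conjugates the elements, since odd cycles produce
  no sign.\<close>

lemma DD_transitive:
  assumes "lam \<in> even_partitions" "g \<in> DD n lam" "h \<in> DD n lam"
  shows "\<exists>w\<in>sub n. w + g = h + w"
proof -
  obtain cs ds where cs: "cs \<in> cycle_lists n lam" "g = cycs n cs"
    and ds: "ds \<in> cycle_lists n lam" "h = cycs n ds" using assms(2,3) by (auto simp: DD_def)
  note c = cycle_lists_data[OF cs(1)] cycle_lists_length[OF cs(1) assms(1)]
  note d = cycle_lists_data[OF ds(1)]
  obtain p where p: "p permutes {1..n}" "map p (concat cs) = concat ds"
    using permutes_extend[of "{1..n}" "concat cs" "concat ds"] c d by auto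
  obtain w where w: "w \<in> sub n" "sperm w = p" using sub_surj[OF p(1)] by blast
  have len: "map length cs = map length ds" using cs(1) ds(1) by (simp add: cycle_lists_def)
  have "map (map p) cs = ds"
  proof (rule concat_injective)
    show "concat (map (map p) cs) = concat ds" using p(2) by (simp add: map_concat)
    show "length (map (map p) cs) = length ds" using len by (metis length_map)
    show "\<forall>(x, y)\<in>set (zip (map (map p) cs) ds). length x = length y"
    proof clarify
      fix x y assume "(x, y) \<in> set (zip (map (map p) cs) ds)"
      then obtain k where "k < length cs" "k < length ds" "x = map p (cs ! k)" "y = ds ! k"
        by (auto simp: set_zip)
      then show "length x = length y" using len by (metis length_map nth_map)
    qed
  qed
  then have "w + g = h + w" using conj_cycs[OF w(1), of cs] c cs ds w(2) by auto
  then show ?thesis using w(1) by blast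
qed

text \<open>A class contains at most one of the two lifts of a permutation: two members are
  conjugate, and their permutations have odd order.\<close>

lemma DD_inj:
  assumes "lam \<in> even_partitions" "g \<in> DD n lam" "h \<in> DD n lam" "sperm g = sperm h"
  shows "g = h"
proof -
  obtain cs where cs: "cs \<in> cycle_lists n lam" "g = cycs n cs" using assms(2) by (auto simp: DD_def)
  note c = cycle_lists_data[OF cs(1)] cycle_lists_length[OF cs(1) assms(1)]
  obtain w where "w + g = h + w" using DD_transitive assms(1-3) by blast
  moreover have "odd (prod_list (map length cs))" using c(4) by (induction cs) auto
  moreover have "sperm g ^^ prod_list (map length cs) = id"
    using cperm_funpow_id[OF c(2)] sperm_DD[OF cs(1) assms(1)] cs(2) by simp
  ultimately show ?thesis using conjugate_eqI[of w g h] assms(4) by metis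
qed

lemma DD_not_zz:
  assumes "lam \<in> even_partitions" "g \<in> DD n lam"
  shows "zz + g \<notin> DD n lam"
  using DD_inj[OF assms(1) _ assms(2), of "zz + g"] zz_plus_neq by (auto simp: sperm_plus)

text \<open>The points moved are exactly the entries of the cycles, so an element fixing all points
  beyond \<open>n\<close> has its cycles inside \<open>{1..n}\<close>, where
  \<open>cycs_mono\<close> allows them to be recomputed with \<open>n\<close>.\<close>

lemma DD_Int_sub:
  assumes "lam \<in> even_partitions" "n \<le> m"
  shows "DD m lam \<inter> sub n = DD n lam"
proof (intro equalityI subsetI)
  fix g assume g: "g \<in> DD m lam \<inter> sub n"
  then obtain cs where cs: "cs \<in> cycle_lists m lam" "g = cycs m cs" by (auto simp: DD_def)
  note c = cycle_lists_data[OF cs(1)] cycle_lists_length[OF cs(1) assms(1)]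
  have "{x. sperm g x \<noteq> x} = set (concat cs)"
    using sperm_DD[OF cs(1) assms(1)] cs(2) cperm_moved[OF c(2)] c(5) by simp
  moreover have "{x. sperm g x \<noteq> x} \<subseteq> {1..n}"
    using g permutes_not_in by (fastforce simp: sub_iff)
  ultimately have "set (concat cs) \<subseteq> {1..n}" by simp
  then show "g \<in> DD n lam"
    using cycs_mono[OF assms(2), of cs] c cs by (auto simp: DD_def cycle_lists_def)
next
  fix g assume g: "g \<in> DD n lam"
  then obtain cs where cs: "cs \<in> cycle_lists n lam" "g = cycs n cs" by (auto simp: DD_def)
  note c = cycle_lists_data[OF cs(1)] cycle_lists_length[OF cs(1) assms(1)]
  have "cs \<in> cycle_lists m lam" using cs(1) assms(2) by (fastforce simp: cycle_lists_def)
  moreover have "cycs m cs = cycs n cs" using cycs_mono[OF assms(2)] c by auto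
  ultimately have "g \<in> DD m lam" unfolding DD_def cs(2) by (metis image_eqI)
  then show "g \<in> DD m lam \<inter> sub n" using DD_sub[OF assms(1) g] by simp
qed

section \<open>Orbits and cycle types\<close>

lemma cycle_of_list_transitive:
  assumes "distinct c" "x \<in> set c" "y \<in> set c"
  shows "\<exists>k. (cycle_of_list c ^^ k) x = y"
proof -
  obtain i j where ij: "i < length c" "x = c ! i" "j < length c" "y = c ! j"
    using assms by (auto simp: in_set_conv_nth)
  let ?k = "j + length c - i"
  have "(cycle_of_list c ^^ ?k) x = map (cycle_of_list c ^^ ?k) c ! i" using ij by simp
  also have "\<dots> = rotate ?k c ! i" using cyclic_rotation[OF assms(1)] by simp
  also have "\<dots> = c ! ((?k + i) mod length c)" using ij by (simp add: nth_rotate)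
  also have "\<dots> = y" using ij by simp
  finally show ?thesis by blast
qed

lemma cperm_funpow_apply:
  assumes "distinct (concat cs)" "c \<in> set cs" "x \<in> set c"
  shows "(cperm cs ^^ k) x = (cycle_of_list c ^^ k) x" "(cycle_of_list c ^^ k) x \<in> set c"
proof -
  have dc: "distinct c" using assms by (simp add: distinct_concat_iff)
  have "(cperm cs ^^ k) x = (cycle_of_list c ^^ k) x \<and> (cycle_of_list c ^^ k) x \<in> set c"
    using cperm_apply(1)[OF assms(1,2)] assms(3) cycle_of_list_mem_iff[OF dc] by (induction k) auto
  then show "(cperm cs ^^ k) x = (cycle_of_list c ^^ k) x" "(cycle_of_list c ^^ k) x \<in> set c"
    by blast+
qed

lemma cperm_orbit:
  assumes "distinct (concat cs)" "c \<in> set cs" "x \<in> set c"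
  shows "range (\<lambda>k. (cperm cs ^^ k) x) = set c"
proof -
  have dc: "distinct c" using assms by (simp add: distinct_concat_iff)
  have "range (\<lambda>k. (cycle_of_list c ^^ k) x) = set c"
    using cycle_of_list_transitive[OF dc assms(3)] cperm_funpow_apply(2)[OF assms] by fast
  then show ?thesis using cperm_funpow_apply(1)[OF assms] by simp
qed

text \<open>The right side depends on the permutation alone, through its nontrivial orbits, so the
  cycle lengths are determined by it. Disjoint nonempty cycles have different entry sets, hence each
  orbit is counted once.\<close>

lemma cperm_type:
  assumes "distinct (concat cs)" "\<forall>c\<in>set cs. 2 \<le> length c"
  shows "mset (map length cs) =
    image_mset card (mset_set ((\<lambda>x. range (\<lambda>k. (cperm cs ^^ k) x)) ` {x. cperm cs x \<noteq> x}))"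
proof -
  have ne: "[] \<notin> set cs" using assms(2) by auto
  have dcs: "distinct cs" using assms(1) ne by (simp add: distinct_concat_iff removeAll_id)
  have disj: "set c \<inter> set d = {}" if "c \<in> set cs" "d \<in> set cs" "c \<noteq> d" for c d
    using assms(1) that by (simp add: distinct_concat_iff)
  have inj: "inj_on set (set cs)"
  proof (rule inj_onI)
    fix c d assume "c \<in> set cs" "d \<in> set cs" "set c = set d"
    then show "c = d" using disj[of c d] ne by (metis inf.idem set_empty)
  qed
  have "(\<lambda>x. range (\<lambda>k. (cperm cs ^^ k) x)) ` {x. cperm cs x \<noteq> x} = set ` set cs"
  proof (intro equalityI subsetI)
    fix O' assume "O' \<in> (\<lambda>x. range (\<lambda>k. (cperm cs ^^ k) x)) ` {x. cperm cs x \<noteq> x}"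
    then obtain x where x: "x \<in> set (concat cs)" "O' = range (\<lambda>k. (cperm cs ^^ k) x)"
      unfolding cperm_moved[OF assms] by blast
    then obtain c where "c \<in> set cs" "x \<in> set c" by auto
    then show "O' \<in> set ` set cs" using cperm_orbit[OF assms(1)] x(2) by blast
  next
    fix O' assume "O' \<in> set ` set cs"
    then obtain c where c: "c \<in> set cs" "O' = set c" by blast
    then have "c \<noteq> []" using ne by metis
    then obtain x where x: "x \<in> set c" using hd_in_set by blast
    then have "x \<in> {x. cperm cs x \<noteq> x}" unfolding cperm_moved[OF assms] using c by auto
    then show "O' \<in> (\<lambda>x. range (\<lambda>k. (cperm cs ^^ k) x)) ` {x. cperm cs x \<noteq> x}"
      using cperm_orbit[OF assms(1) c(1) x] c(2) by blast
  qed
  moreover have "mset (map length cs) = image_mset card (mset_set (set ` set cs))"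
  proof -
    have "mset (map length cs) = image_mset length (mset_set (set cs))"
      using dcs by (simp add: mset_set_set)
    also have "\<dots> = image_mset (card \<circ> set) (mset_set (set cs))"
      using assms(1) by (intro image_mset_cong) (simp add: distinct_concat_iff distinct_card)
    also have "\<dots> = image_mset card (mset_set (set ` set cs))"
      using image_mset_mset_set[OF inj] by (metis multiset.map_comp)
    finally show ?thesis .
  qed
  ultimately show ?thesis by simp
qed

lemma DD_type_unique:
  assumes "lam \<in> even_partitions" "mu \<in> even_partitions" "g \<in> DD n lam" "h \<in> DD n mu"
    and eq: "sperm g = sperm h"
  shows "lam = mu"
proof -
  obtain cs ds where cs: "cs \<in> cycle_lists n lam" "g = cycs n cs"
    and ds: "ds \<in> cycle_lists n mu" "h = cycs n ds" using assms(3,4) by (auto simp: DD_def)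
  have eq': "cperm cs = cperm ds" using eq cs ds sperm_DD assms(1,2) by metis
  have "\<forall>c\<in>set cs. 2 \<le> length c" "\<forall>c\<in>set ds. 2 \<le> length c"
    using cycle_lists_length(2)[OF cs(1) assms(1)] cycle_lists_length(2)[OF ds(1) assms(2)] by blast+
  from cperm_type[OF cycle_lists_data(2)[OF cs(1)] this(1)]
    cperm_type[OF cycle_lists_data(2)[OF ds(1)] this(2)]
  have "mset (map length cs) = mset (map length ds)" by (simp only: eq')
  then have "mset (map (\<lambda>p. p + 1) lam) = mset (map (\<lambda>p. p + 1) mu)"
    using cs(1) ds(1) unfolding cycle_lists_def mem_Collect_eq by metis
  then have "image_mset (\<lambda>p. p - 1) (image_mset (\<lambda>p. p + 1) (mset lam)) =
      image_mset (\<lambda>p. p - 1) (image_mset (\<lambda>p. p + 1) (mset mu))" by simp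
  then have m: "mset lam = mset mu" by (simp add: multiset.map_comp o_def)
  have "sorted (rev lam)" "sorted (rev mu)"
    using assms(1,2) by (simp_all add: even_partitions_def sorted_wrt_rev)
  then have "rev lam = rev mu" using m by (metis mset_rev properties_for_sort)
  then show ?thesis by simp
qed

lemma cperm_cong:
  assumes "distinct (concat cs)" "distinct (concat ds)" "set ds \<subseteq> set cs"
    "\<forall>c\<in>set cs - set ds. length c < 2"
  shows "cperm cs = cperm ds"
proof
  fix x
  consider d where "d \<in> set ds" "x \<in> set d" | c where "x \<notin> set (concat ds)" "c \<in> set cs" "x \<in> set c"
    | "x \<notin> set (concat ds)" "x \<notin> set (concat cs)" by fastforce
  then show "cperm cs x = cperm ds x"
  proof cases
    case 1
    then show ?thesis using cperm_apply(1)[OF assms(1)] cperm_apply(1)[OF assms(2)] assms(3) by auto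
  next
    case 2
    then have "length c < 2" using assms(4) by auto
    then have "c = [x]" using 2(3) by (cases c) auto
    then show ?thesis using cperm_apply(1)[OF assms(1) 2(2,3)] cperm_apply(2)[OF assms(2) 2(1)] by simp
  next
    case 3
    then show ?thesis using cperm_apply(2)[OF assms(1)] cperm_apply(2)[OF assms(2)] by simp
  qed
qed

lemma cycle_decomp_cperm:
  assumes "cycle_decomp I p"
  shows "\<exists>cs. distinct (concat cs) \<and> set (concat cs) = I \<and> p = cperm cs"
  using assms
proof (induction rule: cycle_decomp.induct)
  case empty
  then show ?case by (intro exI[of _ "[]"]) simp
next
  case (comp I p c)
  then obtain cs where "distinct (concat cs)" "set (concat cs) = I" "p = cperm cs" by blast
  then show ?case using comp by (intro exI[of _ "c # cs"]) auto
qed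

lemma permutes_cycle_lists:
  assumes "p permutes {1..n::nat}"
  shows "\<exists>cs. distinct (concat cs) \<and> set (concat cs) \<subseteq> {1..n} \<and> p = cperm cs \<and>
    (\<forall>c\<in>set cs. 2 \<le> length c) \<and> sorted_wrt (\<ge>) (map length cs)"
proof -
  obtain cs where cs: "distinct (concat cs)" "set (concat cs) = {1..n}" "p = cperm cs"
    using cycle_decomp_cperm[OF cycle_decomposition[OF assms finite_atLeastAtMost]] by metis
  \<comment> \<open>The decomposition of the library includes fixed points as cycles of length one;
    sorting is what makes the lengths a partition.\<close>
  define ds where "ds = rev (sort_key length (filter (\<lambda>c. 2 \<le> length c) cs))"
  have set_ds: "set ds = {c \<in> set cs. 2 \<le> length c}" by (simp add: ds_def)
  \<comment> \<open>A list with distinct concatenation may still repeat the empty list, so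
    distinctness holds only once these entries are removed.\<close>
  have "distinct (removeAll [] cs)" using cs(1) by (simp add: distinct_concat_iff)
  then have "distinct (filter (\<lambda>c. 2 \<le> length c) (removeAll [] cs))" by simp
  moreover have "filter (\<lambda>c. 2 \<le> length c) (removeAll [] cs) = filter (\<lambda>c. 2 \<le> length c) cs"
    by (induction cs) auto
  ultimately have "distinct ds" by (simp add: ds_def)
  then have dds: "distinct (concat ds)"
    using cs(1) set_ds by (auto simp: distinct_concat_iff intro: distinct_removeAll)
  moreover have "p = cperm ds" unfolding cs(3) by (rule cperm_cong[OF cs(1) dds]) (auto simp: set_ds)
  moreover have "sorted_wrt (\<ge>) (map length ds)"
    unfolding ds_def sorted_wrt_rev rev_map[symmetric] by simp
  ultimately show ?thesis using set_ds cs(2) by (intro exI[of _ ds]) auto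
qed

text \<open>In the second case a cycle \<open>C\<close> of even length is split off as
  \<open>g = C + h\<close>. It is odd, hence so is \<open>h\<close>, as \<open>g\<close> is even.
  Since \<open>h\<close> fixes the entries of \<open>C\<close>, moving \<open>h\<close> past
  \<open>C\<close> costs exactly one \<open>zz\<close>, and \<open>C\<close> conjugates
  \<open>g\<close> to \<open>zz + g\<close>.\<close>

lemma even_element_cases:
  assumes "g \<in> sub n" "\<not> sodd g"
  obtains (DD) lam where "lam \<in> basis_index n" "g \<in> DD n lam \<or> zz + g \<in> DD n lam"
  | (conj) w where "w \<in> sub n" "w + g = zz + g + w"
proof -
  obtain cs where cs: "distinct (concat cs)" "set (concat cs) \<subseteq> {1..n}" "sperm g = cperm cs"
    "\<forall>c\<in>set cs. 2 \<le> length c" "sorted_wrt (\<ge>) (map length cs)"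
    using permutes_cycle_lists assms(1) sub_iff by blast
  show thesis
  proof (cases "\<forall>c\<in>set cs. odd (length c)")
    case True
    define lam where "lam = map (\<lambda>c. length c - 1) cs"
    have "map (\<lambda>p. p + 1) lam = map length cs"
      using cs(4) by (auto simp: lam_def o_def)
    then have cl: "cs \<in> cycle_lists n lam" using cs(1,2) by (simp add: cycle_lists_def)
    have "sorted_wrt (\<ge>) lam"
      using cs(5) unfolding lam_def sorted_wrt_map
      by (rule sorted_wrt_mono_rel[rotated]) (simp add: diff_le_mono)
    moreover have "\<forall>p\<in>set lam. 0 < p \<and> even p" using True cs(4) by (fastforce simp: lam_def)
    ultimately have lam: "lam \<in> even_partitions" by (simp add: even_partitions_def)
    have "length (concat cs) \<le> card {1..n}"
      using cs(1,2) by (metis card_mono distinct_card finite_atLeastAtMost)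
    then have "lam \<in> basis_index n" using lam cycle_lists_data(3)[OF cl] by (simp add: basis_index_def)
    moreover have "g = cycs n cs \<or> g = zz + cycs n cs"
      using sperm_DD[OF cl lam] cs(3) sperm_eq by simp
    then have "g \<in> DD n lam \<or> zz + g \<in> DD n lam" using cl by (auto simp: DD_def)
    ultimately show thesis by (rule DD)
  next
    case False
    then obtain c where c: "c \<in> set cs" "even (length c)" by blast
    have c': "set c \<subseteq> {1..n}" "distinct c" "c \<noteq> []"
      using c cs(1,2,4) by (auto simp: distinct_concat_iff)
    let ?C = "cyc n c"
    have pC: "sperm ?C = cycle_of_list c" by (rule sperm_cyc[OF c'])
    have C: "?C \<in> sub n" using permutes_subset[OF cycle_permutes c'(1)] by (simp add: sub_iff pC)
    define h where "h = - ?C + g"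
    have g: "g = ?C + h" by (simp add: h_def add.assoc[symmetric] del: add_uminus_conv_diff)
    have h: "h \<in> sub n" unfolding h_def using C assms(1) by (intro sub_plus sub_uminus)
    have "sperm h x = x" if "x \<in> set c" for x
    proof -
      have "sperm ?C (sperm h x) = sperm ?C x"
        using cperm_apply(1)[OF cs(1) c(1) that] cs(3) pC by (simp add: g sperm_plus fun_eq_iff)
      then show ?thesis using sperm_left[of ?C] by metis
    qed
    then have map_h: "map (sperm h) c = c" by (simp add: map_idI)
    have "sodd ?C" using sodd_cyc c' c(2) by simp
    moreover from this have "sodd h" using assms(2) by (simp add: g sodd_plus)
    ultimately have "h + ?C = zz + (?C + h)" using conj_cyc[OF h c'(1,3)] c(2) map_h by simp
    then have "?C + g = zz + g + ?C" by (simp add: g add.assoc zz_pull)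
    then show thesis using C by (rule conj[rotated])
  qed
qed

section \<open>Invariant subsets\<close>

definition invariant_subsets :: "('a \<Rightarrow> 'a) \<Rightarrow> 'a set \<Rightarrow> 'a set set" where
  "invariant_subsets p S = {A. A \<subseteq> S \<and> (\<forall>x. p x \<in> A \<longleftrightarrow> x \<in> A)}"

lemma finite_invariant_subsets: "finite S \<Longrightarrow> finite (invariant_subsets p S)"
  by (rule finite_subset[of _ "Pow S"]) (auto simp: invariant_subsets_def)

lemma invariant_subsets_cperm:
  assumes "distinct (concat cs)"
  shows "invariant_subsets (cperm cs) S = {A. A \<subseteq> S \<and> (\<forall>c\<in>set cs. set c \<subseteq> A \<or> set c \<inter> A = {})}"
proof (intro equalityI subsetI)
  fix A assume A: "A \<in> invariant_subsets (cperm cs) S"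
  have iter: "(cperm cs ^^ k) x \<in> A" if "x \<in> A" for k x
    using A that by (induction k) (auto simp: invariant_subsets_def)
  have "set c \<subseteq> A" if "c \<in> set cs" "x \<in> set c" "x \<in> A" for c x
  proof -
    have "range (\<lambda>k. (cperm cs ^^ k) x) \<subseteq> A" using iter[OF that(3)] by auto
    then show ?thesis using cperm_orbit[OF assms that(1,2)] by simp
  qed
  then show "A \<in> {A. A \<subseteq> S \<and> (\<forall>c\<in>set cs. set c \<subseteq> A \<or> set c \<inter> A = {})}"
    using A unfolding invariant_subsets_def by blast
next
  fix A assume A: "A \<in> {A. A \<subseteq> S \<and> (\<forall>c\<in>set cs. set c \<subseteq> A \<or> set c \<inter> A = {})}"
  have "cperm cs x \<in> A \<longleftrightarrow> x \<in> A" for x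
  proof (cases "x \<in> set (concat cs)")
    case True
    then obtain c where c: "c \<in> set cs" "x \<in> set c" by auto
    then have "cperm cs x \<in> set c" using cperm_funpow_apply[OF assms c, of 1] by simp
    then show ?thesis using A c by blast
  next
    case False
    then show ?thesis using cperm_apply(2)[OF assms] by simp
  qed
  then show "A \<in> invariant_subsets (cperm cs) S" using A by (simp add: invariant_subsets_def)
qed

text \<open>A block of \<open>l\<close> points may be taken or left out, which gives a factor 2
  where free subsets would give \<open>2^l\<close>; the loss is \<open>2^(l - 1)\<close>, which is
  the part of the partition belonging to that cycle. The product form avoids division.\<close>

lemma card_block_subsets:
  assumes "finite S" "distinct (concat cs)" "set (concat cs) \<subseteq> S" "\<forall>c\<in>set cs. c \<noteq> []"
  shows "card {A. A \<subseteq> S \<and> (\<forall>c\<in>set cs. set c \<subseteq> A \<or> set c \<inter> A = {})} *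
    2 ^ sum_list (map (\<lambda>c. length c - 1) cs) = 2 ^ card S"
  using assms
proof (induction cs arbitrary: S)
  case Nil
  then show ?case using card_Pow[of S] by (simp add: Pow_def)
next
  case (Cons c cs)
  let ?F = "\<lambda>S cs. {A. A \<subseteq> S \<and> (\<forall>c\<in>set cs. set c \<subseteq> A \<or> set c \<inter> A = {})}"
  let ?G = "?F (S - set c) cs"
  have disj: "set c \<inter> set d = {}" if "d \<in> set cs" for d using Cons.prems(2) that by auto
  have c: "c \<noteq> []" "set c \<subseteq> S" "distinct c" using Cons.prems by auto
  have IH: "card ?G * 2 ^ sum_list (map (\<lambda>c. length c - 1) cs) = 2 ^ card (S - set c)"
    using Cons by (intro Cons.IH) auto
  have "?F S (c # cs) = ?G \<union> (\<lambda>A. A \<union> set c) ` ?G"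
  proof (intro equalityI subsetI)
    fix A assume A: "A \<in> ?F S (c # cs)"
    then consider "set c \<subseteq> A" | "set c \<inter> A = {}" by auto
    then show "A \<in> ?G \<union> (\<lambda>A. A \<union> set c) ` ?G"
    proof cases
      case 1
      have "set d \<subseteq> A - set c \<or> set d \<inter> (A - set c) = {}" if "d \<in> set cs" for d
        using A that disj[OF that] by auto
      then have "A - set c \<in> ?G" using A by auto
      moreover have "A = (A - set c) \<union> set c" using 1 by auto
      ultimately show ?thesis by blast
    qed (use A in auto)
  next
    fix A assume "A \<in> ?G \<union> (\<lambda>A. A \<union> set c) ` ?G"
    then consider "A \<in> ?G" | B where "B \<in> ?G" "A = B \<union> set c" by blast
    then show "A \<in> ?F S (c # cs)"
    proof cases
      case 2
      have "set d \<subseteq> A \<or> set d \<inter> A = {}" if "d \<in> set cs" for d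
        using 2 that disj[OF that] by auto
      then show ?thesis using 2 c(2) by auto
    qed auto
  qed
  moreover have "?G \<inter> (\<lambda>A. A \<union> set c) ` ?G = {}" using c(1) by (cases c) auto
  moreover have "inj_on (\<lambda>A. A \<union> set c) ?G" by (rule inj_onI) blast
  moreover have fin: "finite ?G" using Cons.prems(1) by (rule_tac finite_subset[of _ "Pow S"]) auto
  ultimately have "card (?F S (c # cs)) = 2 * card ?G"
    by (simp add: card_Un_disjoint card_image)
  then have "card (?F S (c # cs)) * 2 ^ sum_list (map (\<lambda>c. length c - 1) (c # cs)) =
      (card ?G * 2 ^ sum_list (map (\<lambda>c. length c - 1) cs)) * 2 ^ Suc (length c - 1)"
    by (simp add: power_add)
  also have "\<dots> = 2 ^ (card (S - set c) + length c)"
    using IH c(1) by (simp add: power_add)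
  also have "card (S - set c) + length c = card S"
    using c Cons.prems(1) card_mono[of S "set c"] by (simp add: card_Diff_subset distinct_card)
  finally show ?case .
qed

lemma card_invariant_subsets_DD:
  assumes "lam \<in> even_partitions" "g \<in> DD n lam"
  shows "card (invariant_subsets (sperm g) {1..n}) * 2 ^ sum_list lam = 2 ^ n"
proof -
  obtain cs where cs: "cs \<in> cycle_lists n lam" "g = cycs n cs" using assms(2) by (auto simp: DD_def)
  note c = cycle_lists_data[OF cs(1)] cycle_lists_length[OF cs(1) assms(1)]
  have "map (\<lambda>c. length c - 1) cs = map (\<lambda>k. k - 1) (map length cs)" by simp
  also have "\<dots> = lam" using cs(1) by (simp add: cycle_lists_def o_def)
  finally have "map (\<lambda>c. length c - 1) cs = lam" .
  then show ?thesis
    using card_block_subsets[of "{1..n}" cs] c invariant_subsets_cperm[OF c(2)]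
      sperm_DD[OF cs(1) assms(1)] cs(2) by simp
qed

lemma moved_DD:
  assumes "lam \<in> even_partitions" "g \<in> DD n lam"
  shows "card {x. sperm g x \<noteq> x} = sum_list lam + length lam" "{x. sperm g x \<noteq> x} \<subseteq> {1..n}"
proof -
  obtain cs where cs: "cs \<in> cycle_lists n lam" "g = cycs n cs" using assms(2) by (auto simp: DD_def)
  note c = cycle_lists_data[OF cs(1)] cycle_lists_length[OF cs(1) assms(1)]
  have "{x. sperm g x \<noteq> x} = set (concat cs)"
    using sperm_DD[OF cs(1) assms(1)] cs(2) cperm_moved[OF c(2)] c(5) by simp
  then show "card {x. sperm g x \<noteq> x} = sum_list lam + length lam" "{x. sperm g x \<noteq> x} \<subseteq> {1..n}"
    using c(1,3) distinct_card[OF c(2)] by metis+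
qed

text \<open>The invariant subsets form a vector space over the field with two elements under symmetric
  difference; this is the dimension formula for an intersection.\<close>

lemma invariant_subsets_product:
  assumes "finite S"
  shows "card (invariant_subsets p S) * card (invariant_subsets q S) \<le>
    2 ^ card S * card (invariant_subsets p S \<inter> invariant_subsets q S)"
proof -
  let ?P = "invariant_subsets p S" and ?Q = "invariant_subsets q S"
  define d where "d = (\<lambda>(A :: 'a set, B). (A - B) \<union> (B - A))"
  have mem: "x \<in> d (A, B) \<longleftrightarrow> (x \<in> A) \<noteq> (x \<in> B)" for x A B by (auto simp: d_def)
  have cancel: "B = B'" if "d (A, B) = d (A, B')" for A B B'
  proof (intro equalityI subsetI)
    fix x
    have "x \<in> d (A, B) \<longleftrightarrow> x \<in> d (A, B')" using that by simp
    then show "x \<in> B \<Longrightarrow> x \<in> B'" "x \<in> B' \<Longrightarrow> x \<in> B" by (auto simp: mem)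
  qed
  have fin: "finite ?P" "finite ?Q" using assms finite_invariant_subsets by auto
  have fiber: "card {x \<in> ?P \<times> ?Q. d x = C} \<le> card (?P \<inter> ?Q)" for C
  proof (cases "{x \<in> ?P \<times> ?Q. d x = C} = {}")
    case False
    then obtain A B where AB: "A \<in> ?P" "B \<in> ?Q" "d (A, B) = C" by auto
    \<comment> \<open>Write \<open>+\<close> for symmetric difference. If
      \<open>A + B = A' + B'\<close>, then \<open>A + A' = B + B'\<close>, and this set is invariant
      under both maps. So translation by a fixed point of the fiber embeds the fiber into the
      intersection.\<close>
    define s where "s = (\<lambda>x :: 'a set \<times> 'a set. d (A, fst x))"
    have "inj_on s {x \<in> ?P \<times> ?Q. d x = C}"
    proof (rule inj_onI)
      fix x y assume x: "x \<in> {x \<in> ?P \<times> ?Q. d x = C}" and y: "y \<in> {x \<in> ?P \<times> ?Q. d x = C}" and "s x = s y"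
      then have 1: "d (A, fst x) = d (A, fst y)" by (simp add: s_def)
      have 2: "d (fst x, snd x) = d (fst y, snd y)" using x y by simp
      have "fst x = fst y" using cancel[OF 1] .
      moreover have "snd x = snd y" using cancel[of "fst x"] 2 \<open>fst x = fst y\<close> by simp
      ultimately show "x = y" by (rule prod_eqI)
    qed
    moreover have "s ` {x \<in> ?P \<times> ?Q. d x = C} \<subseteq> ?P \<inter> ?Q"
    proof
      fix E assume "E \<in> s ` {x \<in> ?P \<times> ?Q. d x = C}"
      then obtain A' B' where x: "A' \<in> ?P" "B' \<in> ?Q" "d (A', B') = C" "E = d (A, A')"
        by (auto simp: s_def)
      have "d (A, A') = d (B, B')"
      proof (intro equalityI subsetI)
        fix y
        have "y \<in> d (A', B') \<longleftrightarrow> y \<in> d (A, B)" using x(3) AB(3) by simp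
        then show "y \<in> d (A, A') \<Longrightarrow> y \<in> d (B, B')" "y \<in> d (B, B') \<Longrightarrow> y \<in> d (A, A')"
          by (auto simp: mem)
      qed
      moreover have "d (A, A') \<in> ?P" using AB(1) x(1) by (auto simp: mem invariant_subsets_def)
      moreover have "d (B, B') \<in> ?Q" using AB(2) x(2) by (auto simp: mem invariant_subsets_def)
      ultimately show "E \<in> ?P \<inter> ?Q" using x(4) by simp
    qed
    ultimately show ?thesis using fin by (intro card_inj_on_le[of s]) auto
  qed (metis card.empty le0)
  have "d ` (?P \<times> ?Q) \<subseteq> Pow S" by (auto simp: d_def invariant_subsets_def)
  then have "card (?P \<times> ?Q) = (\<Sum>C\<in>Pow S. card {x \<in> ?P \<times> ?Q. d x = C})"
    using sum.group[of "?P \<times> ?Q" "Pow S" d "\<lambda>_. 1::nat"] fin assms by simp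
  also have "\<dots> \<le> (\<Sum>C\<in>Pow S. card (?P \<inter> ?Q))" by (intro sum_mono fiber)
  also have "\<dots> = 2 ^ card S * card (?P \<inter> ?Q)" using assms by (simp add: card_Pow)
  finally show ?thesis by (simp add: card_cartesian_product)
qed

text \<open>Here \<open>h\<close> is the lift that lies in the class of \<open>nu\<close>. Only its
  permutation is compared with \<open>a + b\<close>, so both signs of the product are
  covered.\<close>

lemma invariant_subsets_sum:
  assumes "lam \<in> even_partitions" "mu \<in> even_partitions" "nu \<in> even_partitions"
    and "a \<in> DD n lam" "b \<in> DD n mu" "h \<in> DD n nu" "sperm h = sperm (a + b)"
  shows "sum_list nu \<le> sum_list lam + sum_list mu"
    and "sum_list nu = sum_list lam + sum_list mu \<Longrightarrow>
      {x. sperm a x \<noteq> x \<or> sperm b x \<noteq> x} = {x. sperm h x \<noteq> x}"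
proof -
  let ?I = "\<lambda>g. invariant_subsets (sperm g) {1..n}"
  have sub: "?I a \<inter> ?I b \<subseteq> ?I h"
    by (auto simp: invariant_subsets_def assms(7) sperm_plus)
  have fin: "finite (?I g)" for g by (simp add: finite_invariant_subsets)
  have cards: "card (?I a) * 2 ^ sum_list lam = 2 ^ n" "card (?I b) * 2 ^ sum_list mu = 2 ^ n"
    "card (?I h) * 2 ^ sum_list nu = 2 ^ n"
    using card_invariant_subsets_DD assms by blast+
  have "card (?I a) * card (?I b) \<le> 2 ^ n * card (?I a \<inter> ?I b)"
    using invariant_subsets_product[of "{1..n}" "sperm a" "sperm b"] by simp
  then have "card (?I a) * card (?I b) * 2 ^ (sum_list lam + sum_list mu) \<le>
      2 ^ n * card (?I a \<inter> ?I b) * 2 ^ (sum_list lam + sum_list mu)" by simp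
  moreover have "card (?I a) * card (?I b) * 2 ^ (sum_list lam + sum_list mu) =
      (card (?I a) * 2 ^ sum_list lam) * (card (?I b) * 2 ^ sum_list mu)" by (simp add: power_add)
  ultimately have "2 ^ n * 2 ^ n \<le> 2 ^ n * (card (?I a \<inter> ?I b) * 2 ^ (sum_list lam + sum_list mu))"
    unfolding cards by (simp only: mult.assoc)
  then have le: "2 ^ n \<le> card (?I a \<inter> ?I b) * 2 ^ (sum_list lam + sum_list mu)" by simp
  also have le2: "\<dots> \<le> card (?I h) * 2 ^ (sum_list lam + sum_list mu)"
    using card_mono[OF fin sub] by simp
  finally have "card (?I h) * 2 ^ sum_list nu \<le> card (?I h) * 2 ^ (sum_list lam + sum_list mu)"
    using cards(3) by simp
  moreover have "0 < card (?I h)" using cards(3) by (cases "card (?I h) = 0") auto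
  ultimately show "sum_list nu \<le> sum_list lam + sum_list mu" by simp
  assume eq: "sum_list nu = sum_list lam + sum_list mu"
  have "card (?I h) * 2 ^ sum_list nu \<le> card (?I a \<inter> ?I b) * 2 ^ sum_list nu"
    using le cards(3) eq by simp
  then have "card (?I h) \<le> card (?I a \<inter> ?I b)" by simp
  then have Ieq: "?I a \<inter> ?I b = ?I h" by (rule card_seteq[OF fin sub])
  show "{x. sperm a x \<noteq> x \<or> sperm b x \<noteq> x} = {x. sperm h x \<noteq> x}"
  proof (intro equalityI subsetI)
    fix x assume x: "x \<in> {x. sperm a x \<noteq> x \<or> sperm b x \<noteq> x}"
    then have "x \<in> {1..n}" using moved_DD(2)[OF assms(1,4)] moved_DD(2)[OF assms(2,5)] by blast
    show "x \<in> {x. sperm h x \<noteq> x}"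
    proof (rule ccontr)
      assume "x \<notin> {x. sperm h x \<noteq> x}"
      then have "sperm h x = x" by simp
      \<comment> \<open>A fixed point of \<open>h\<close> is the same as an invariant singleton. In
        the case of equality the invariant sets of \<open>h\<close> are those common to
        \<open>a\<close> and \<open>b\<close>, so both fix the point.\<close>
      then have "sperm h y = x \<longleftrightarrow> y = x" for y using sperm_left[of h] by metis
      then have "{x} \<in> ?I h" using \<open>x \<in> {1..n}\<close> by (simp add: invariant_subsets_def)
      then have "{x} \<in> ?I a" "{x} \<in> ?I b" using Ieq by blast+
      then have "sperm a x = x" "sperm b x = x" by (simp_all add: invariant_subsets_def)
      then show False using x by simp
    qed
  qed (auto simp: assms(7) sperm_plus)
qed

section \<open>Counting factorizations\<close>

definition DI :: "nat list \<Rightarrow> spin set" where "DI lam = (\<Union>n. DD n lam)"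

lemma DI_Int_sub:
  assumes "lam \<in> even_partitions"
  shows "DI lam \<inter> sub n = DD n lam"
proof -
  have "g \<in> DD n lam" if "g \<in> DD m lam" "g \<in> sub n" for g m
    using DD_Int_sub[OF assms, of m "max m n"] DD_Int_sub[OF assms, of n "max m n"] that by auto
  then show ?thesis using DD_sub[OF assms] by (auto simp: DI_def)
qed

lemma DI_conj:
  assumes "lam \<in> even_partitions" "g \<in> DI lam"
  shows "w + g - w \<in> DI lam"
proof -
  obtain n where n: "g \<in> DD n lam" using assms(2) by (auto simp: DI_def)
  obtain m where m: "w \<in> sub m" using spin_in_sub by blast
  have "g \<in> DD (max n m) lam" using n DD_Int_sub[OF assms(1), of n "max n m"] by auto
  moreover have "w \<in> sub (max n m)" using m sub_mono[of m "max n m"] by auto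
  ultimately show ?thesis using DD_conj[OF assms(1)] by (auto simp: DI_def)
qed

lemma DI_inj:
  assumes "lam \<in> even_partitions" "g \<in> DI lam" "h \<in> DI lam" "sperm g = sperm h"
  shows "g = h"
proof -
  obtain n where n: "g \<in> DD n lam" using assms(2) by (auto simp: DI_def)
  then have "g \<in> sub n" using DD_sub assms(1) by blast
  then have "h \<in> sub n" using assms(4) by (simp add: sub_iff)
  then have "h \<in> DD n lam" using assms(3) DI_Int_sub[OF assms(1), of n] by blast
  then show ?thesis using DD_inj[OF assms(1) n] assms(4) by blast
qed

definition moved :: "spin \<Rightarrow> spin \<Rightarrow> nat set" where
  "moved a b = {x. sperm a x \<noteq> x \<or> sperm b x \<noteq> x}"

lemma moved_conj: "moved (w + a - w) (w + b - w) = sperm w ` moved a b"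
proof -
  have "sperm (w + g - w) x \<noteq> x \<longleftrightarrow> sperm g (sperm (- w) x) \<noteq> sperm (- w) x" for g x
  proof -
    have "sperm (w + g + - w) x = sperm w (sperm g (sperm (- w) x))" by (simp only: sperm_plus comp_apply)
    then show ?thesis by (metis add_uminus_conv_diff sperm_left sperm_right)
  qed
  then show ?thesis
    unfolding moved_def by (auto simp: image_iff) (metis sperm_left sperm_right)+
qed

lemma sub_iff_moved: "g \<in> sub n \<longleftrightarrow> {x. sperm g x \<noteq> x} \<subseteq> {1..n}"
proof
  assume "g \<in> sub n"
  then show "{x. sperm g x \<noteq> x} \<subseteq> {1..n}" using permutes_not_in by (fastforce simp: sub_iff)
next
  assume m: "{x. sperm g x \<noteq> x} \<subseteq> {1..n}"
  obtain k where "sperm g permutes {1..k}" using spin_in_sub sub_iff by blast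
  then show "g \<in> sub n" unfolding sub_iff by (rule permutes_superset) (use m in auto)
qed

definition factorizations :: "nat list \<Rightarrow> nat list \<Rightarrow> spin \<Rightarrow> (spin \<times> spin) set" where
  "factorizations lam mu h = {(a, b). a \<in> DI lam \<and> b \<in> DI mu \<and> a + b = h}"

lemma factorizations_conj:
  assumes "lam \<in> even_partitions" "mu \<in> even_partitions" "(a, b) \<in> factorizations lam mu h"
  shows "(w + a - w, w + b - w) \<in> factorizations lam mu (w + h - w)"
proof -
  have "(w + a - w) + (w + b - w) = w + (a + b) - w"
    by (simp only: diff_conv_add_uminus add.assoc minus_add_cancel)
  then show ?thesis using assms DI_conj by (auto simp: factorizations_def)
qed

lemma conjugate_cancel: "w + a - w = w + b - w \<longleftrightarrow> a = (b :: spin)"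
  by (metis add_left_cancel diff_add_cancel)

definition tcount :: "nat list \<Rightarrow> nat list \<Rightarrow> spin \<Rightarrow> nat set \<Rightarrow> nat" where
  "tcount lam mu h T = card {(a, b) \<in> factorizations lam mu h. moved a b = T}"

lemma finite_moved_factorizations:
  assumes "T \<subseteq> {1..n}"
  shows "finite {(a, b) \<in> factorizations lam mu h. moved a b = T}"
proof (rule finite_subset)
  show "{(a, b) \<in> factorizations lam mu h. moved a b = T} \<subseteq> sub n \<times> sub n"
    using assms by (auto simp: sub_iff_moved moved_def)
qed (simp add: finite_sub)

lemma tcount_conj_le:
  assumes "lam \<in> even_partitions" "mu \<in> even_partitions" "T \<subseteq> {1..n}" "w \<in> sub n"
  shows "tcount lam mu h T \<le> tcount lam mu (w + h - w) (sperm w ` T)"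
  unfolding tcount_def
proof (rule card_inj_on_le)
  let ?f = "\<lambda>(a, b). (w + a - w, w + b - w)"
  show "inj_on ?f {(a, b) \<in> factorizations lam mu h. moved a b = T}"
  proof (rule inj_onI)
    fix x y assume "?f x = ?f y"
    then show "x = y" by (cases x; cases y) (simp add: conjugate_cancel)
  qed
  show "?f ` {(a, b) \<in> factorizations lam mu h. moved a b = T} \<subseteq>
      {(a, b) \<in> factorizations lam mu (w + h - w). moved a b = sperm w ` T}"
    using factorizations_conj[OF assms(1,2)] moved_conj by auto
  have "sperm w ` T \<subseteq> {1..n}"
    using assms(3,4) permutes_image unfolding sub_iff by blast
  then show "finite {(a, b) \<in> factorizations lam mu (w + h - w). moved a b = sperm w ` T}"
    by (rule finite_moved_factorizations)
qed

text \<open>An element fixing the points moved by \<open>g\<close> commutes with \<open>g\<close> and may move the other points freely.\<close>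

lemma tcount_card_le:
  assumes "lam \<in> even_partitions" "mu \<in> even_partitions" "nu \<in> even_partitions"
    and "g \<in> DI nu" "h = g \<or> h = zz + g"
    and M: "{x. sperm g x \<noteq> x} = M" "M \<subseteq> T" "M \<subseteq> T'" and T: "T \<subseteq> {1..n}" "T' \<subseteq> {1..n}" "card T = card T'"
  shows "tcount lam mu h T \<le> tcount lam mu h T'"
proof -
  let ?l = "\<lambda>X. sorted_list_of_set X"
  have fin: "finite T" "finite T'" using T finite_subset by blast+
  then have finM: "finite M" using M(2) finite_subset by blast
  have len: "length (?l M @ ?l (T - M)) = length (?l M @ ?l (T' - M))"
    using T(3) fin finM M by (simp add: card_Diff_subset)
  \<comment> \<open>Listing \<open>M\<close> first on both sides makes \<open>p\<close> fix
    \<open>M\<close> pointwise while it carries \<open>T\<close> to \<open>T'\<close>.\<close>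
  obtain p where p: "p permutes {1..n}" "map p (?l M @ ?l (T - M)) = ?l M @ ?l (T' - M)"
    using permutes_extend[OF _ _ _ _ _ len, of "{1..n}"] T M(2,3) fin finM by auto
  obtain w where w: "w \<in> sub n" "sperm w = p" using sub_surj[OF p(1)] by blast
  have "set (map p (?l M @ ?l (T - M))) = set (?l M @ ?l (T' - M))" using p(2) by simp
  then have "p ` (M \<union> (T - M)) = M \<union> (T' - M)"
    using fin finM by (simp add: image_Un del: Un_Diff_cancel)
  moreover have "M \<union> (T - M) = T" "M \<union> (T' - M) = T'" using M(2,3) by blast+
  ultimately have pT: "p ` T = T'" by (simp only:)
  have "map p (?l M) = ?l M" using p(2) by simp
  then have pM: "p x = x" if "x \<in> M" for x
    using that finM by (metis map_eq_conv id_apply list.map_id set_sorted_list_of_set)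
  have "sperm (w + g - w) = sperm g"
  proof
    fix x
    define y where "y = sperm (- w) x"
    have x: "x = p y" using sperm_right[of w x] w(2) by (simp add: y_def)
    have e: "sperm (w + g - w) x = p (sperm g y)"
      using sperm_plus[of "w + g" "- w"] sperm_plus[of w g] w(2) by (simp add: y_def)
    show "sperm (w + g - w) x = sperm g x"
    proof (cases "y \<in> M")
      case True
      then have "sperm g y \<in> M" using M(1) sperm_left[of g] by (metis (mono_tags, lifting) mem_Collect_eq)
      then show ?thesis using True e x pM by simp
    next
      case False
      then have "sperm g y = y" using M(1) by auto
      moreover have "x \<notin> M"
      proof
        assume "x \<in> M"
        then have "p x = p y" using pM x by simp
        then have "x = y" using permutes_inj[OF p(1)] by (simp add: inj_eq)
        then show False using \<open>x \<in> M\<close> False by simp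
      qed
      then have "sperm g x = x" using M(1) by auto
      ultimately show ?thesis using e x by simp
    qed
  qed
  \<comment> \<open>Equal permutations leave a factor \<open>zz\<close> undetermined; it is excluded
    because both elements lie in the same class.\<close>
  then have "w + g - w = g" using DI_inj[OF assms(3) DI_conj[OF assms(3,4)] assms(4)] by blast
  moreover have "w + (zz + g) - w = zz + (w + g - w)"
    by (simp add: zz_pull add_diff_eq)
  ultimately have "w + h - w = h" using assms(5) by auto
  then show ?thesis using tcount_conj_le[OF assms(1,2) T(1) w(1), of h] w(2) pT by simp
qed

lemma sum_card_Pow:
  assumes "finite S"
  shows "(\<Sum>X\<in>Pow S. f (card X)) = (\<Sum>k\<le>card S. of_nat (card S choose k) * (f k :: int))"
proof -
  have "(\<Sum>X\<in>Pow S. f (card X)) = (\<Sum>k\<le>card S. \<Sum>X\<in>{X \<in> Pow S. card X = k}. f (card X))"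
    using assms card_mono by (intro sum.group[symmetric]) auto
  also have "\<dots> = (\<Sum>k\<le>card S. of_nat (card S choose k) * f k)"
  proof (rule sum.cong)
    fix k
    have "card {X \<in> Pow S. card X = k} = card S choose k" using n_subsets[OF assms, of k] by simp
    then show "(\<Sum>X\<in>{X \<in> Pow S. card X = k}. f (card X)) = of_nat (card S choose k) * f k" by simp
  qed simp
  finally show ?thesis .
qed

definition fcount :: "nat \<Rightarrow> nat list \<Rightarrow> nat list \<Rightarrow> spin \<Rightarrow> nat" where
  "fcount n lam mu h = card {(a, b). a \<in> DD n lam \<and> b \<in> DD n mu \<and> a + b = h}"

text \<open>The numbers \<open>tcount\<close> refer to the infinite group, so \<open>n\<close>
  enters only through the choice of the additional moved points among the \<open>n - N\<close>
  available ones.\<close>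

lemma fcount_eq_sum:
  assumes "lam \<in> even_partitions" "mu \<in> even_partitions" "nu \<in> even_partitions"
    and g: "g \<in> DI nu" "h = g \<or> h = zz + g" "{x. sperm g x \<noteq> x} = {1..N}" and "N \<le> n"
  shows "int (fcount n lam mu h) =
    (\<Sum>k\<le>n - N. of_nat (n - N choose k) * int (tcount lam mu h {1..N + k}))"
proof -
  let ?P = "{(a, b). a \<in> DD n lam \<and> b \<in> DD n mu \<and> a + b = h}"
  have P: "?P = {(a, b) \<in> factorizations lam mu h. moved a b \<subseteq> {1..n}}"
  proof -
    have "a \<in> DD n lam \<and> b \<in> DD n mu \<longleftrightarrow> a \<in> DI lam \<and> b \<in> DI mu \<and> moved a b \<subseteq> {1..n}" for a b
    proof -
      have "moved a b \<subseteq> {1..n} \<longleftrightarrow> a \<in> sub n \<and> b \<in> sub n"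
        unfolding sub_iff_moved moved_def by blast
      then show ?thesis using DI_Int_sub[OF assms(1), of n] DI_Int_sub[OF assms(2), of n] by blast
    qed
    then show ?thesis by (auto simp: factorizations_def)
  qed
  have finP: "finite ?P"
    using DD_sub[OF assms(1)] DD_sub[OF assms(2)]
    by (intro finite_subset[of ?P "sub n \<times> sub n"]) (auto simp: finite_sub)
  have "sperm h = sperm g" using g(2) by (auto simp: sperm_plus)
  \<comment> \<open>A point fixed by both factors is fixed by their product.\<close>
  have Nm: "{1..N} \<subseteq> moved a b" if "(a, b) \<in> factorizations lam mu h" for a b
  proof
    fix x assume "x \<in> {1..N}"
    then have "sperm a (sperm b x) \<noteq> x"
      using g(3) that \<open>sperm h = sperm g\<close> by (auto simp: factorizations_def sperm_plus fun_eq_iff)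
    then show "x \<in> moved a b" by (auto simp: moved_def)
  qed
  let ?m = "\<lambda>(a, b). moved a b - {1..N}"
  have maps: "?m ` ?P \<subseteq> Pow {N<..n}" unfolding P by auto
  have "int (fcount n lam mu h) = (\<Sum>x\<in>?P. 1)" by (simp add: fcount_def)
  also have "\<dots> = (\<Sum>X\<in>Pow {N<..n}. \<Sum>x\<in>{x \<in> ?P. ?m x = X}. 1)"
    using finP maps by (intro sum.group[symmetric]) auto
  also have "\<dots> = (\<Sum>X\<in>Pow {N<..n}. int (tcount lam mu h {1..N + card X}))"
  proof (rule sum.cong)
    fix X assume X: "X \<in> Pow {N<..n}"
    then have finX: "finite X" by (metis PowD finite_greaterThanAtMost finite_subset)
    have "{x \<in> ?P. ?m x = X} = {(a, b) \<in> factorizations lam mu h. moved a b = {1..N} \<union> X}"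
    proof -
      have "x \<in> {x \<in> ?P. ?m x = X} \<longleftrightarrow>
        x \<in> {(a, b) \<in> factorizations lam mu h. moved a b = {1..N} \<union> X}" if x: "x = (a, b)" for x a b
      proof (cases "(a, b) \<in> factorizations lam mu h")
        case True
        have "moved a b \<subseteq> {1..n} \<and> moved a b - {1..N} = X \<longleftrightarrow> moved a b = {1..N} \<union> X"
        proof
          assume "moved a b \<subseteq> {1..n} \<and> moved a b - {1..N} = X"
          then show "moved a b = {1..N} \<union> X" using Nm[OF True] by blast
        next
          assume "moved a b = {1..N} \<union> X"
          then show "moved a b \<subseteq> {1..n} \<and> moved a b - {1..N} = X"
            using X assms(7) by (auto simp: subset_iff)
        qed
        then show ?thesis using True x unfolding P by simp
      next
        case False
        then show ?thesis using x unfolding P by simp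
      qed
      note eq = this[OF HOL.refl]
      show ?thesis by (intro equalityI subrelI) (simp_all only: eq)
    qed
    then have "(\<Sum>x\<in>{x \<in> ?P. ?m x = X}. 1) = int (tcount lam mu h ({1..N} \<union> X))"
      by (simp add: tcount_def)
    also have "tcount lam mu h ({1..N} \<union> X) = tcount lam mu h {1..N + card X}"
    proof -
      have "card ({1..N} \<union> X) = card {1..N + card X}"
        using X finX by (subst card_Un_disjoint) auto
      moreover have "{1..N} \<union> X \<subseteq> {1..n + card X}" "{1..N + card X} \<subseteq> {1..n + card X}"
        using X assms(7) by (auto simp: subset_iff le_Suc_eq trans_le_add1)
      ultimately show ?thesis
        using tcount_card_le[OF assms(1-3) g(1,2,3), of "{1..N} \<union> X" "{1..N + card X}" "n + card X"]
          tcount_card_le[OF assms(1-3) g(1,2,3), of "{1..N + card X}" "{1..N} \<union> X" "n + card X"]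
        by (intro antisym) auto
    qed
    finally show "(\<Sum>x\<in>{x \<in> ?P. ?m x = X}. 1) = int (tcount lam mu h {1..N + card X})" .
  qed simp
  also have "\<dots> = (\<Sum>k\<le>card {N<..n}. of_nat (card {N<..n} choose k) * int (tcount lam mu h {1..N + k}))"
    by (rule sum_card_Pow[of _ "\<lambda>k. int (tcount lam mu h {1..N + k})"]) simp
  finally show ?thesis by simp
qed

section \<open>Polynomiality of the counts\<close>

lemma ex_lists_of_lengths: "length xs = sum_list ls \<Longrightarrow> \<exists>cs. map length cs = ls \<and> concat cs = xs"
proof (induction ls arbitrary: xs)
  case (Cons l ls)
  have "length (drop l xs) = sum_list ls" using Cons.prems by simp
  then obtain cs where "map length cs = ls" "concat cs = drop l xs" using Cons.IH by blast
  then show ?case using Cons.prems by (intro exI[of _ "take l xs # cs"]) auto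
qed simp

lemma DD_nonempty:
  assumes "sum_list lam + length lam \<le> n"
  shows "DD n lam \<noteq> {}"
proof -
  have "sum_list (map (\<lambda>p. p + 1) lam) = sum_list lam + length lam" by (induction lam) auto
  then have "length [1..<Suc (sum_list lam + length lam)] = sum_list (map (\<lambda>p. p + 1) lam)"
    by (simp only: length_upt diff_Suc_1' One_nat_def diff_Suc_Suc diff_zero)
  then obtain cs where cs: "map length cs = map (\<lambda>p. p + 1) lam"
    "concat cs = [1..<Suc (sum_list lam + length lam)]"
    using ex_lists_of_lengths by blast
  have "set (concat cs) \<subseteq> {1..n}" "distinct (concat cs)" unfolding cs(2) using assms by auto
  then have "cs \<in> cycle_lists n lam" using cs(1) by (simp add: cycle_lists_def)
  then show ?thesis by (auto simp: DD_def)
qed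

text \<open>The first bound makes the maximum in the theorem one over finitely many values; the
  other two conclusions give the vanishing and the constancy.\<close>

lemma pair_bounds:
  assumes "lam \<in> even_partitions" "mu \<in> even_partitions" "nu \<in> even_partitions"
    and "a \<in> DI lam" "b \<in> DI mu" "a + b \<in> DI nu \<or> zz + (a + b) \<in> DI nu"
  shows "card (moved a b) \<le> sum_list lam + length lam + (sum_list mu + length mu)"
    and "sum_list nu \<le> sum_list lam + sum_list mu"
    and "sum_list nu = sum_list lam + sum_list mu \<Longrightarrow> card (moved a b) = sum_list nu + length nu"
proof -
  obtain h where h: "h \<in> DI nu" "sperm h = sperm (a + b)"
    using assms(6) by (auto simp: sperm_plus)
  obtain i j k where ijk: "a \<in> DD i lam" "b \<in> DD j mu" "h \<in> DD k nu"
    using assms(4,5) h(1) by (auto simp: DI_def)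
  define n where "n = max i (max j k)"
  have le: "i \<le> n" "j \<le> n" "k \<le> n" by (auto simp: n_def)
  have n: "a \<in> DD n lam" "b \<in> DD n mu" "h \<in> DD n nu"
    using ijk DD_Int_sub[OF assms(1) le(1)] DD_Int_sub[OF assms(2) le(2)] DD_Int_sub[OF assms(3) le(3)]
    by blast+
  have "moved a b = {x. sperm a x \<noteq> x} \<union> {x. sperm b x \<noteq> x}" by (auto simp: moved_def)
  then have "card (moved a b) \<le> card {x. sperm a x \<noteq> x} + card {x. sperm b x \<noteq> x}"
    using card_Un_le by metis
  then show "card (moved a b) \<le> sum_list lam + length lam + (sum_list mu + length mu)"
    using moved_DD(1)[OF assms(1) n(1)] moved_DD(1)[OF assms(2) n(2)] by simp
  note inv = invariant_subsets_sum[OF assms(1-3) n h(2)]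
  show "sum_list nu \<le> sum_list lam + sum_list mu" by (rule inv(1))
  show "card (moved a b) = sum_list nu + length nu" if "sum_list nu = sum_list lam + sum_list mu"
    using inv(2)[OF that] moved_DD(1)[OF assms(3) n(3)] by (simp add: moved_def)
qed

definition scoef :: "nat \<Rightarrow> nat list \<Rightarrow> nat list \<Rightarrow> spin \<Rightarrow> int" where
  "scoef n lam mu g = int (fcount n lam mu g) - int (fcount n lam mu (zz + g))"

lemma fcount_conj_le:
  assumes "lam \<in> even_partitions" "mu \<in> even_partitions" "w \<in> sub n" "w + h = h' + w"
  shows "fcount n lam mu h \<le> fcount n lam mu h'"
  unfolding fcount_def
proof (rule card_inj_on_le)
  let ?f = "\<lambda>(a, b). (w + a - w, w + b - w)"
  have h': "h' = w + h - w" using assms(4) by (metis add_diff_cancel)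
  show "inj_on ?f {(a, b). a \<in> DD n lam \<and> b \<in> DD n mu \<and> a + b = h}"
  proof (rule inj_onI)
    fix x y assume "?f x = ?f y"
    then show "x = y" by (cases x; cases y) (simp add: conjugate_cancel)
  qed
  have "(w + a - w) + (w + b - w) = w + (a + b) - w" for a b
    by (simp only: diff_conv_add_uminus add.assoc minus_add_cancel)
  then have maps: "?f (a, b) \<in> {(a, b). a \<in> DD n lam \<and> b \<in> DD n mu \<and> a + b = h'}"
    if "a \<in> DD n lam" "b \<in> DD n mu" "a + b = h" for a b
    using DD_conj[OF assms(1) that(1) assms(3)] DD_conj[OF assms(2) that(2) assms(3)] h' that(3) by simp
  show "?f ` {(a, b). a \<in> DD n lam \<and> b \<in> DD n mu \<and> a + b = h} \<subseteq>
      {(a, b). a \<in> DD n lam \<and> b \<in> DD n mu \<and> a + b = h'}"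
  proof (rule image_subsetI)
    fix x assume "x \<in> {(a, b). a \<in> DD n lam \<and> b \<in> DD n mu \<and> a + b = h}"
    then show "?f x \<in> {(a, b). a \<in> DD n lam \<and> b \<in> DD n mu \<and> a + b = h'}"
      using maps[of "fst x" "snd x"] by (simp add: case_prod_beta)
  qed
  have "{(a, b). a \<in> DD n lam \<and> b \<in> DD n mu \<and> a + b = h'} \<subseteq> sub n \<times> sub n"
    by (rule subrelI) (simp add: DD_sub[OF assms(1)] DD_sub[OF assms(2)])
  then show "finite {(a, b). a \<in> DD n lam \<and> b \<in> DD n mu \<and> a + b = h'}"
    by (rule finite_subset) (simp add: finite_sub)
qed

lemma fcount_conj:
  assumes "lam \<in> even_partitions" "mu \<in> even_partitions" "w \<in> sub n" "w + h = h' + w"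
  shows "fcount n lam mu h = fcount n lam mu h'"
proof (rule antisym)
  have "- w + h' = h + - w"
    using assms(4) by (metis add.assoc add_minus_cancel minus_add_cancel add_diff_cancel diff_conv_add_uminus)
  then show "fcount n lam mu h' \<le> fcount n lam mu h"
    using fcount_conj_le[OF assms(1,2) sub_uminus[OF assms(3)]] by blast
qed (rule fcount_conj_le[OF assms])

lemma scoef_conj:
  assumes "lam \<in> even_partitions" "mu \<in> even_partitions" "w \<in> sub n" "w + h = h' + w"
  shows "scoef n lam mu h = scoef n lam mu h'"
proof -
  have "w + (zz + h) = (zz + h') + w"
    using assms(4) by (metis add.assoc zz_commute)
  then show ?thesis
    using fcount_conj[OF assms] fcount_conj[OF assms(1-3)] by (simp add: scoef_def)
qed

text \<open>The coefficients are read off at one element \<open>g0\<close> of the smallest group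
  that meets the class. It moves exactly the points of \<open>{1..N}\<close> and belongs to every
  larger class, so \<open>c\<close> does not depend on \<open>n\<close>. The two counts in
  \<open>c k\<close> may cancel, but a nonzero difference still provides a factorization of
  \<open>g0\<close> or \<open>zz + g0\<close> that moves \<open>N + k\<close> points.\<close>

lemma scoef_binomial:
  assumes "lam \<in> even_partitions" "mu \<in> even_partitions" "nu \<in> even_partitions"
  defines "N \<equiv> sum_list nu + length nu"
  obtains c where "\<And>n g. N \<le> n \<Longrightarrow> g \<in> DD n nu \<Longrightarrow>
      scoef n lam mu g = (\<Sum>k\<le>n - N. of_nat (n - N choose k) * c k)"
    and "\<And>k. c k \<noteq> 0 \<Longrightarrow> \<exists>a\<in>DI lam. \<exists>b\<in>DI mu.
      (a + b \<in> DI nu \<or> zz + (a + b) \<in> DI nu) \<and> card (moved a b) = N + k"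
proof -
  obtain g0 where g0: "g0 \<in> DD N nu" using DD_nonempty[of nu N] by (auto simp: N_def)
  have I: "g0 \<in> DI nu" using g0 by (auto simp: DI_def)
  have M: "{x. sperm g0 x \<noteq> x} = {1..N}"
    using moved_DD[OF assms(3) g0] by (intro card_subset_eq) (auto simp: N_def)
  define c where "c k = int (tcount lam mu g0 {1..N + k}) - int (tcount lam mu (zz + g0) {1..N + k})" for k
  show thesis
  proof (rule that)
    fix n g assume n: "N \<le> n" and g: "g \<in> DD n nu"
    have "g0 \<in> DD n nu" using g0 DD_Int_sub[OF assms(3) n] by blast
    then obtain w where "w \<in> sub n" "w + g = g0 + w" using DD_transitive[OF assms(3) g] by blast
    then have "scoef n lam mu g = scoef n lam mu g0" using scoef_conj assms(1,2) by blast
    also have "\<dots> = (\<Sum>k\<le>n - N. of_nat (n - N choose k) * c k)"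
      using fcount_eq_sum[OF assms(1-3) I _ M n, of g0] fcount_eq_sum[OF assms(1-3) I _ M n, of "zz + g0"]
      by (simp add: scoef_def c_def right_diff_distrib sum_subtractf)
    finally show "scoef n lam mu g = (\<Sum>k\<le>n - N. of_nat (n - N choose k) * c k)" .
  next
    fix k assume "c k \<noteq> 0"
    then have "tcount lam mu g0 {1..N + k} \<noteq> 0 \<or> tcount lam mu (zz + g0) {1..N + k} \<noteq> 0"
      by (auto simp: c_def)
    then obtain h where h: "h = g0 \<or> h = zz + g0" "tcount lam mu h {1..N + k} \<noteq> 0" by blast
    then have "{(a, b) \<in> factorizations lam mu h. moved a b = {1..N + k}} \<noteq> {}"
      unfolding tcount_def by (metis card.empty)
    then obtain a b where ab: "a \<in> DI lam" "b \<in> DI mu" "a + b = h" "moved a b = {1..N + k}"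
      by (auto simp: factorizations_def)
    have "a + b \<in> DI nu \<or> zz + (a + b) \<in> DI nu" using h(1) ab(3) I by auto
    then show "\<exists>a\<in>DI lam. \<exists>b\<in>DI mu. (a + b \<in> DI nu \<or> zz + (a + b) \<in> DI nu) \<and> card (moved a b) = N + k"
      using ab by (intro bexI[of _ a] bexI[of _ b]) auto
  qed
qed

section \<open>Interpolation by binomial polynomials\<close>

definition binomial_poly :: "nat \<Rightarrow> nat \<Rightarrow> rat poly" where
  "binomial_poly N k = smult (1 / fact k) (\<Prod>i<k. [:- of_nat (N + i), 1:])"

lemma poly_binomial_poly:
  assumes "N \<le> n"
  shows "poly (binomial_poly N k) (of_nat n) = of_nat (n - N choose k)"
proof -
  have "of_nat (n - N choose k) = (of_nat (n - N) gchoose k :: rat)" by (rule binomial_gbinomial)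
  also have "\<dots> = (\<Prod>i<k. of_nat n - of_nat (N + i)) / fact k"
    using assms by (simp add: gbinomial_prod_rev of_nat_diff diff_diff_eq atLeast0LessThan)
  also have "\<dots> = poly (binomial_poly N k) (of_nat n)"
    by (simp add: binomial_poly_def poly_prod algebra_simps)
  finally show ?thesis by simp
qed

lemma degree_binomial_poly: "degree (binomial_poly N k) \<le> k"
proof -
  have "degree (\<Prod>i<k. [:- of_nat (N + i), 1 :: rat:]) \<le> (\<Sum>i<k. degree [:- of_nat (N + i), 1 :: rat:])"
    using degree_prod_sum_le[of "{..<k}" "\<lambda>i. [:- of_nat (N + i), 1 :: rat:]"] by simp
  then show ?thesis by (simp add: binomial_poly_def)
qed

lemma binomial_sum_poly:
  fixes c :: "nat \<Rightarrow> int"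
  assumes "\<And>n. N \<le> n \<Longrightarrow> s n = (\<Sum>k\<le>n - N. of_nat (n - N choose k) * c k)"
    and "\<And>k. c k \<noteq> 0 \<Longrightarrow> k \<le> K"
  shows "(\<forall>n\<ge>N. of_int (s n) = poly f (of_nat n)) \<longleftrightarrow>
    f = (\<Sum>k\<le>K. smult (of_int (c k)) (binomial_poly N k))" (is "_ \<longleftrightarrow> f = ?F")
proof -
  have F: "poly ?F (of_nat n) = of_int (s n)" if n: "N \<le> n" for n
  proof -
    have "poly ?F (of_nat n) = (\<Sum>k\<le>K. of_int (c k) * of_nat (n - N choose k))"
      using n by (simp add: poly_sum poly_binomial_poly)
    \<comment> \<open>The fixed range up to \<open>K\<close> and the range up to
      \<open>n - N\<close> are compared inside a common one: terms beyond \<open>K\<close> vanish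
      with \<open>c k\<close>, terms beyond \<open>n - N\<close> with the binomial
      coefficient.\<close>
    also have "\<dots> = (\<Sum>k\<le>max K (n - N). of_int (c k) * of_nat (n - N choose k))"
      using assms(2) by (intro sum.mono_neutral_left) force+
    also have "\<dots> = (\<Sum>k\<le>n - N. of_int (c k) * of_nat (n - N choose k))"
      by (intro sum.mono_neutral_right) (auto simp: binomial_eq_0)
    also have "\<dots> = of_int (s n)" using assms(1)[OF n] by (simp add: mult.commute)
    finally show ?thesis .
  qed
  show ?thesis
  proof
    assume f: "\<forall>n\<ge>N. of_int (s n) = poly f (of_nat n)"
    have "poly (f - ?F) x = 0" if "x \<in> of_nat ` {N..}" for x
      using that f F by auto
    then have "of_nat ` {N..} \<subseteq> {x. poly (f - ?F) x = 0}" by blast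
    moreover have "infinite (of_nat ` {N..} :: rat set)"
      by (simp add: finite_image_iff inj_on_def infinite_Ici)
    ultimately have "infinite {x. poly (f - ?F) x = 0}" using finite_subset by blast
    then have "f - ?F = 0" using poly_roots_finite by blast
    then show "f = ?F" by simp
  qed (use F in auto)
qed

section \<open>Integral group rings\<close>

abbreviation sgl :: "'a \<Rightarrow> int \<Rightarrow> 'a \<Rightarrow>\<^sub>0 int" where "sgl \<equiv> Poly_Mapping.single"

abbreviation lkp :: "('a \<Rightarrow>\<^sub>0 int) \<Rightarrow> 'a \<Rightarrow> int" where "lkp \<equiv> Poly_Mapping.lookup"

lemma int_group_ring_simps [simp]:
  "carrier (int_group_ring G) = {f. Poly_Mapping.keys f \<subseteq> carrier G}"
  "one (int_group_ring G) = sgl \<one>\<^bsub>G\<^esub> 1"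
  "zero (int_group_ring G) = 0"
  "add (int_group_ring G) = (+)"
  by (simp_all add: int_group_ring_def)

text \<open>It reduces associativity and the unit laws to identities between group elements.\<close>

lemma sum_monomials: "(\<Sum>a\<in>Poly_Mapping.keys f. sgl a (lkp f a)) = f"
proof (rule poly_mapping_eqI)
  fix k
  have "lkp (\<Sum>a\<in>Poly_Mapping.keys f. sgl a (lkp f a)) k = (\<Sum>a\<in>Poly_Mapping.keys f. if a = k then lkp f a else 0)"
    by (simp add: lookup_sum lookup_single when_def)
  then show "lkp (\<Sum>a\<in>Poly_Mapping.keys f. sgl a (lkp f a)) k = lkp f k"
    by (simp add: sum.delta in_keys_iff)
qed

context
  fixes G :: "('a, 'b) monoid_scheme" (structure)
begin

abbreviation gmult (infixl \<open>\<star>\<close> 70) where "f \<star> h \<equiv> f \<otimes>\<^bsub>int_group_ring G\<^esub> h"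

text \<open>The product is defined over the supports, which change under addition. Over fixed larger
  index sets it is visibly bilinear.\<close>

lemma group_ring_mult_superset:
  assumes "finite X" "Poly_Mapping.keys f \<subseteq> X" "finite Y" "Poly_Mapping.keys h \<subseteq> Y"
  shows "f \<star> h = (\<Sum>a\<in>X. \<Sum>b\<in>Y. sgl (a \<otimes> b) (lkp f a * lkp h b))"
proof -
  have "f \<star> h = (\<Sum>a\<in>Poly_Mapping.keys f. \<Sum>b\<in>Poly_Mapping.keys h. sgl (a \<otimes> b) (lkp f a * lkp h b))"
    by (simp add: int_group_ring_def)
  also have "\<dots> = (\<Sum>a\<in>Poly_Mapping.keys f. \<Sum>b\<in>Y. sgl (a \<otimes> b) (lkp f a * lkp h b))"
    using assms by (intro sum.cong sum.mono_neutral_left) (auto simp: in_keys_iff)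
  also have "\<dots> = (\<Sum>a\<in>X. \<Sum>b\<in>Y. sgl (a \<otimes> b) (lkp f a * lkp h b))"
    using assms by (intro sum.mono_neutral_left) (auto simp: in_keys_iff)
  finally show ?thesis .
qed

lemma group_ring_mult_add_left: "(f + g) \<star> h = f \<star> h + g \<star> h"
proof -
  let ?X = "Poly_Mapping.keys f \<union> Poly_Mapping.keys g" and ?Y = "Poly_Mapping.keys h"
  have "(f + g) \<star> h = (\<Sum>a\<in>?X. \<Sum>b\<in>?Y. sgl (a \<otimes> b) (lkp (f + g) a * lkp h b))"
    by (rule group_ring_mult_superset) (use keys_add[of f g] in auto)
  also have "\<dots> = (\<Sum>a\<in>?X. \<Sum>b\<in>?Y. sgl (a \<otimes> b) (lkp f a * lkp h b)) +
      (\<Sum>a\<in>?X. \<Sum>b\<in>?Y. sgl (a \<otimes> b) (lkp g a * lkp h b))"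
    by (simp add: lookup_add distrib_right single_add sum.distrib)
  also have "\<dots> = f \<star> h + g \<star> h"
    using group_ring_mult_superset[of ?X f ?Y h] group_ring_mult_superset[of ?X g ?Y h] by simp
  finally show ?thesis .
qed

lemma group_ring_mult_add_right: "f \<star> (g + h) = f \<star> g + f \<star> h"
proof -
  let ?X = "Poly_Mapping.keys f" and ?Y = "Poly_Mapping.keys g \<union> Poly_Mapping.keys h"
  have "f \<star> (g + h) = (\<Sum>a\<in>?X. \<Sum>b\<in>?Y. sgl (a \<otimes> b) (lkp f a * lkp (g + h) b))"
    by (rule group_ring_mult_superset) (use keys_add[of g h] in auto)
  also have "\<dots> = (\<Sum>a\<in>?X. \<Sum>b\<in>?Y. sgl (a \<otimes> b) (lkp f a * lkp g b)) +
      (\<Sum>a\<in>?X. \<Sum>b\<in>?Y. sgl (a \<otimes> b) (lkp f a * lkp h b))"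
    by (simp add: lookup_add distrib_left single_add sum.distrib)
  also have "\<dots> = f \<star> g + f \<star> h"
    using group_ring_mult_superset[of ?X f ?Y g] group_ring_mult_superset[of ?X f ?Y h] by simp
  finally show ?thesis .
qed

lemma group_ring_mult_zero [simp]: "0 \<star> h = 0" "f \<star> 0 = 0"
  using group_ring_mult_superset[of "{}" 0 "Poly_Mapping.keys h" h]
    group_ring_mult_superset[of "Poly_Mapping.keys f" f "{}" 0] by simp_all

lemma group_ring_mult_sum_left: "(\<Sum>i\<in>I. f i) \<star> h = (\<Sum>i\<in>I. f i \<star> h)"
  by (induction I rule: infinite_finite_induct) (simp_all add: group_ring_mult_add_left)

lemma group_ring_mult_sum_right: "f \<star> (\<Sum>i\<in>I. h i) = (\<Sum>i\<in>I. f \<star> h i)"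
  by (induction I rule: infinite_finite_induct) (simp_all add: group_ring_mult_add_right)

lemma group_ring_mult_single: "sgl a x \<star> sgl b y = sgl (a \<otimes> b) (x * y)"
  using group_ring_mult_superset[of "{a}" "sgl a x" "{b}" "sgl b y"] by simp

lemma group_ring_mult_closed:
  assumes "group G" "Poly_Mapping.keys f \<subseteq> carrier G" "Poly_Mapping.keys h \<subseteq> carrier G"
  shows "Poly_Mapping.keys (f \<star> h) \<subseteq> carrier G"
proof -
  interpret group G by fact
  have "Poly_Mapping.keys (f \<star> h) \<subseteq>
      (\<Union>a\<in>Poly_Mapping.keys f. \<Union>b\<in>Poly_Mapping.keys h. {a \<otimes> b})"
    unfolding int_group_ring_def monoid.simps
    by (rule order_trans[OF keys_sum] UN_mono order_refl)+ (auto split: if_splits)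
  then show ?thesis using assms by auto
qed

lemma group_ring_mult_assoc:
  assumes "group G" "Poly_Mapping.keys f \<subseteq> carrier G" "Poly_Mapping.keys g \<subseteq> carrier G"
    "Poly_Mapping.keys h \<subseteq> carrier G"
  shows "(f \<star> g) \<star> h = f \<star> (g \<star> h)"
proof -
  interpret group G by fact
  let ?s = "\<lambda>f. \<Sum>a\<in>Poly_Mapping.keys f. sgl a (lkp f a)"
  have "(?s f \<star> ?s g) \<star> ?s h = ?s f \<star> (?s g \<star> ?s h)"
    unfolding group_ring_mult_sum_left group_ring_mult_sum_right group_ring_mult_single
    using assms(2-4) by (intro sum.cong) (auto simp: m_assoc mult.assoc subset_iff)
  then show ?thesis by (simp only: sum_monomials)
qed

lemma int_group_ring_ring:
  assumes "group G"
  shows "ring (int_group_ring G)"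
proof -
  interpret group G by fact
  have one: "sgl \<one> 1 \<star> f = f" "f \<star> sgl \<one> 1 = f" if "Poly_Mapping.keys f \<subseteq> carrier G" for f
  proof -
    let ?s = "\<Sum>a\<in>Poly_Mapping.keys f. sgl a (lkp f a)"
    have "sgl \<one> 1 \<star> ?s = ?s" "?s \<star> sgl \<one> 1 = ?s"
      unfolding group_ring_mult_sum_left group_ring_mult_sum_right group_ring_mult_single
      using that by (auto intro!: sum.cong simp: subset_iff)
    then show "sgl \<one> 1 \<star> f = f" "f \<star> sgl \<one> 1 = f" by (simp_all only: sum_monomials)
  qed
  have ab: "abelian_group (int_group_ring G)"
  proof (rule abelian_groupI)
    fix x assume "x \<in> carrier (int_group_ring G)"
    then show "\<exists>y\<in>carrier (int_group_ring G). y \<oplus>\<^bsub>int_group_ring G\<^esub> x = \<zero>\<^bsub>int_group_ring G\<^esub>"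
      by (intro bexI[of _ "- x"]) auto
  qed (auto simp: algebra_simps dest: subsetD[OF keys_add])
  have mon: "monoid (int_group_ring G)"
    by (rule monoidI)
      (simp_all add: group_ring_mult_closed group_ring_mult_assoc one assms)
  show ?thesis
    by (rule ringI[OF ab mon]) (simp_all add: group_ring_mult_add_left group_ring_mult_add_right)
qed

end

section \<open>Word groups as subgroups of the infinite double cover\<close>

text \<open>The translation between \<open>spin\<close> and the groups of word classes. It is used
  with \<open>W\<close> the words of one finite group and with \<open>W\<close> the union of all of
  them, for which \<open>cl W g\<close> is a different set for the same \<open>g\<close>.\<close>

definition cl :: "spin_gen word set \<Rightarrow> spin \<Rightarrow> spin_gen word set" where
  "cl W g = {w \<in> W. elt w = g}"

lemma cl_inj: "g \<in> elt ` W \<Longrightarrow> cl W g = cl W h \<Longrightarrow> g = h"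
  by (auto simp: cl_def)

context
  fixes W :: "spin_gen word set" and E :: "(spin_gen word \<times> spin_gen word) set"
  assumes W: "[] \<in> W" "\<And>u v. u \<in> W \<Longrightarrow> v \<in> W \<Longrightarrow> u @ v \<in> W" "\<And>w. w \<in> W \<Longrightarrow> inverse_word w \<in> W"
    and E: "E = {(u, v). u \<in> W \<and> v \<in> W \<and> elt u = elt v}"
begin

lemma word_class: "w \<in> W \<Longrightarrow> E `` {w} = cl W (elt w)"
  by (auto simp: E cl_def)

lemma carrier_word_group: "carrier (word_group W E) = cl W ` elt ` W"
  using word_class by (auto simp: word_group_def quotient_def)

lemma one_word_group: "\<one>\<^bsub>word_group W E\<^esub> = cl W 0"
  using word_class[OF W(1)] by (simp add: word_group_def)

lemma mult_word_group:
  assumes "g \<in> elt ` W" "h \<in> elt ` W"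
  shows "cl W g \<otimes>\<^bsub>word_group W E\<^esub> cl W h = cl W (g + h)"
proof -
  have "E `` {u @ v} = cl W (g + h)" if "u \<in> cl W g" "v \<in> cl W h" for u v
    using that word_class[of "u @ v"] W(2) by (auto simp: cl_def elt_append)
  moreover have "cl W g \<noteq> {}" "cl W h \<noteq> {}" using assms by (auto simp: cl_def)
  ultimately show ?thesis by (simp add: word_group_def)
qed

lemma elt_image_add: "g \<in> elt ` W \<Longrightarrow> h \<in> elt ` W \<Longrightarrow> g + h \<in> elt ` W"
  using W(2) by (auto simp: elt_append[symmetric])

lemma elt_image_uminus: "g \<in> elt ` W \<Longrightarrow> - g \<in> elt ` W"
  using W(3) by (auto simp: elt_inverse_word[symmetric])

lemma group_word_group: "group (word_group W E)"
proof (rule groupI)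
  have zero: "0 \<in> elt ` W" using W(1) by (metis elt_Nil image_eqI)
  show "\<one>\<^bsub>word_group W E\<^esub> \<in> carrier (word_group W E)"
    using zero by (simp add: one_word_group carrier_word_group)
  fix x assume x: "x \<in> carrier (word_group W E)"
  then obtain g where g: "g \<in> elt ` W" "x = cl W g" by (auto simp: carrier_word_group)
  show "\<one>\<^bsub>word_group W E\<^esub> \<otimes>\<^bsub>word_group W E\<^esub> x = x"
    using g zero by (simp add: one_word_group mult_word_group)
  show "\<exists>y\<in>carrier (word_group W E). y \<otimes>\<^bsub>word_group W E\<^esub> x = \<one>\<^bsub>word_group W E\<^esub>"
    using g elt_image_uminus[OF g(1)]
    by (intro bexI[of _ "cl W (- g)"]) (auto simp only: mult_word_group one_word_group carrier_word_group left_minus)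
next
  fix x y assume "x \<in> carrier (word_group W E)" "y \<in> carrier (word_group W E)"
  then obtain g h where g: "g \<in> elt ` W" "x = cl W g" and h: "h \<in> elt ` W" "y = cl W h"
    unfolding carrier_word_group by blast
  then show "x \<otimes>\<^bsub>word_group W E\<^esub> y \<in> carrier (word_group W E)"
    using elt_image_add[OF g(1) h(1)] by (simp only: mult_word_group carrier_word_group) (rule imageI)
  fix z assume "z \<in> carrier (word_group W E)"
  then obtain k where k: "k \<in> elt ` W" "z = cl W k" unfolding carrier_word_group by blast
  show "x \<otimes>\<^bsub>word_group W E\<^esub> y \<otimes>\<^bsub>word_group W E\<^esub> z = x \<otimes>\<^bsub>word_group W E\<^esub> (y \<otimes>\<^bsub>word_group W E\<^esub> z)"
    using g h k by (simp only: mult_word_group elt_image_add add.assoc)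
qed

end

abbreviation cn :: "nat \<Rightarrow> spin \<Rightarrow> spin_gen word set" where "cn n \<equiv> cl (spin_words n)"

lemma spin_rel_eq: "spin_rel n = {(u, v). u \<in> spin_words n \<and> v \<in> spin_words n \<and> elt u = elt v}"
  using elt_eq_iff spin_rel_words by blast

lemma spin_words_group_axioms:
  "[] \<in> spin_words n" "u \<in> spin_words n \<Longrightarrow> v \<in> spin_words n \<Longrightarrow> u @ v \<in> spin_words n"
  "w \<in> spin_words n \<Longrightarrow> inverse_word w \<in> spin_words n"
  by simp_all

lemmas spin_group_word_group = spin_words_group_axioms spin_rel_eq

lemma carrier_spin_group: "carrier (spin_group n) = cn n ` sub n"
  unfolding spin_group_def sub_def by (rule carrier_word_group[OF spin_group_word_group])

lemma one_spin_group: "\<one>\<^bsub>spin_group n\<^esub> = cn n 0"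
  unfolding spin_group_def by (rule one_word_group[OF spin_group_word_group])

lemma mult_spin_group:
  "g \<in> sub n \<Longrightarrow> h \<in> sub n \<Longrightarrow> cn n g \<otimes>\<^bsub>spin_group n\<^esub> cn n h = cn n (g + h)"
  unfolding spin_group_def sub_def by (rule mult_word_group[OF spin_group_word_group])

lemma group_spin_group: "group (spin_group n)"
  unfolding spin_group_def by (rule group_word_group[OF spin_group_word_group])

lemma cn_inj: "g \<in> sub n \<Longrightarrow> cn n g = cn n h \<longleftrightarrow> g = h"
  unfolding sub_def using cl_inj by blast

lemma inj_on_cn: "inj_on (cn n) (sub n)"
  using cn_inj by (auto intro: inj_onI)

lemma spin_rel_word: "w \<in> spin_words n \<Longrightarrow> spin_rel n `` {w} = cn n (elt w)"
  by (rule word_class[OF spin_group_word_group])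

lemma spin_rel_z_letter: "spin_rel n `` {[z_letter]} = cn n zz"
  using spin_rel_word[of "[z_letter]" n] by (simp add: zz_def)

lemma spin_rel_image_cn:
  assumes "g \<in> sub n" "n \<le> m"
  shows "spin_rel m `` cn n g = cn m g"
proof -
  obtain w where w: "w \<in> spin_words n" "elt w = g" using assms(1) by (auto simp: sub_def)
  have mono: "u \<in> spin_words m" if "u \<in> spin_words n" for u
    using that spin_words_mono[OF assms(2)] by blast
  show ?thesis
  proof (intro equalityI subsetI)
    fix u assume "u \<in> spin_rel m `` cn n g"
    then show "u \<in> cn m g" by (auto simp: spin_rel_eq cl_def)
  next
    fix u assume "u \<in> cn m g"
    then have "(w, u) \<in> spin_rel m" "w \<in> cn n g" using w mono by (simp_all add: spin_rel_eq cl_def)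
    then show "u \<in> spin_rel m `` cn n g" by (rule ImageI)
  qed
qed

lemma x_word_words: "1 \<le> i \<Longrightarrow> i \<le> n \<Longrightarrow> x_word n i \<in> spin_words (Suc n)"
  by (auto simp: x_word_def rev_map simp del: upt_Suc)

lemma cycle_words_words:
  assumes "cs \<in> cycle_lists n lam"
  shows "concat (map (cycle_word n) cs) \<in> spin_words (Suc n)"
proof -
  have ne: "[] \<notin> set cs"
  proof
    assume "[] \<in> set cs"
    then have "0 \<in> set (map length cs)" by force
    moreover have "map length cs = map (\<lambda>p. p + 1) lam" using assms by (simp add: cycle_lists_def)
    ultimately have "0 \<in> set (map (\<lambda>p. p + 1) lam)" by (simp only:)
    then show False by auto
  qed
  have "cycle_word n c \<in> spin_words (Suc n)" if "c \<in> set cs" for c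
  proof -
    have c: "set c \<subseteq> {1..n}" "c \<noteq> []" using that ne cycle_lists_data(1)[OF assms] by auto
    then have "hd c \<in> {1..n}" using hd_in_set by blast
    moreover have "concat (map (x_word n) xs) \<in> spin_words (Suc n)" if "set xs \<subseteq> {1..n}" for xs
      using that x_word_words by (induction xs) auto
    ultimately show ?thesis using c x_word_words unfolding cycle_word_def by simp
  qed
  then show ?thesis by (induction cs) auto
qed

text \<open>The cycle words contain the letter of \<open>t_n\<close>, so they are words for
  \<open>n + 1\<close> points. As \<open>cn (n + 1)\<close> is injective, the comparison after
  embedding is equality of elements of \<open>spin\<close>.\<close>

lemma D_class_eq:
  assumes "lam \<in> even_partitions"
  shows "D_class n lam = cn n ` DD n lam"
proof -
  have img: "spin_rel (n + 1) `` {concat (map (cycle_word n) cs)} = cn (n + 1) (cycs n cs)"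
    "cycs n cs \<in> sub (n + 1)"
    if "cs \<in> cycle_lists n lam" for cs
  proof -
    note w = cycle_words_words[OF that]
    show "spin_rel (n + 1) `` {concat (map (cycle_word n) cs)} = cn (n + 1) (cycs n cs)"
      using spin_rel_word[of _ "n + 1"] w by (simp add: cycs_elt)
    show "cycs n cs \<in> sub (n + 1)" using imageI[OF w, of elt] by (simp add: sub_def cycs_elt)
  qed
  have lists: "D_class n lam = {A \<in> carrier (spin_group n). \<exists>cs\<in>cycle_lists n lam.
      spin_rel (n + 1) `` A = spin_rel (n + 1) `` {concat (map (cycle_word n) cs)}}"
    unfolding D_class_def cycle_lists_def by blast
  show ?thesis
  proof (intro equalityI subsetI)
    fix A assume "A \<in> D_class n lam"
    then obtain g cs where g: "g \<in> sub n" "A = cn n g" and cs: "cs \<in> cycle_lists n lam"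
      "spin_rel (n + 1) `` A = spin_rel (n + 1) `` {concat (map (cycle_word n) cs)}"
      unfolding lists carrier_spin_group by blast
    have "cn (n + 1) g = cn (n + 1) (cycs n cs)"
      using cs(2) img(1)[OF cs(1)] spin_rel_image_cn[OF g(1), of "n + 1"] g(2) by simp
    then have "g = cycs n cs" using cn_inj img(2)[OF cs(1)] by metis
    then show "A \<in> cn n ` DD n lam" using g(2) cs(1) by (auto simp: DD_def)
  next
    fix A assume "A \<in> cn n ` DD n lam"
    then obtain g where g: "g \<in> DD n lam" "A = cn n g" by blast
    then obtain cs where cs: "cs \<in> cycle_lists n lam" "g = cycs n cs" by (auto simp: DD_def)
    have s: "g \<in> sub n" using DD_sub[OF assms g(1)] .
    then have "spin_rel (n + 1) `` A = spin_rel (n + 1) `` {concat (map (cycle_word n) cs)}"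
      using spin_rel_image_cn[OF s, of "n + 1"] g(2) img(1)[OF cs(1)] cs(2) by simp
    moreover have "A \<in> carrier (spin_group n)" using s g(2) by (simp add: carrier_spin_group)
    ultimately show "A \<in> D_class n lam" unfolding lists using cs(1) by blast
  qed
qed

section \<open>The spin group algebra\<close>

lemma spin_identities:
  fixes a g h :: spin
  shows "- (zz + a) + (zz + g) = - a + g"
    and "- a + (zz + g) = zz + (- a + g)"
    and "zz = zz + g \<longleftrightarrow> g = 0"
    and "0 = zz + g \<longleftrightarrow> zz = g"
    and "zz = - a + g \<longleftrightarrow> a = zz + g"
    and "0 = - a + g \<longleftrightarrow> a = g"
    and "a + h = g \<longleftrightarrow> h = - a + g"
proof -
  show "- (zz + a) + (zz + g) = - a + g"
    by (simp only: minus_add minus_zz add.assoc zz_zz_left)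
  show "- a + (zz + g) = zz + (- a + g)"
    by (metis add.assoc zz_commute)
  show "zz = zz + g \<longleftrightarrow> g = 0" by (metis add_left_cancel add_0_right)
  show "0 = zz + g \<longleftrightarrow> zz = g" by (metis zz_zz zz_zz_left)
  show eq: "a + h = g \<longleftrightarrow> h = - a + g" for h
    by (metis add_minus_cancel minus_add_cancel)
  show "zz = - a + g \<longleftrightarrow> a = zz + g"
    unfolding eq[symmetric] by (metis zz_commute zz_zz_left)
  show "0 = - a + g \<longleftrightarrow> a = g" unfolding eq[symmetric] by simp
qed

abbreviation GR :: "nat \<Rightarrow> (spin_gen word set \<Rightarrow>\<^sub>0 int) ring" where
  "GR n \<equiv> int_group_ring (spin_group n)"

lemma ring_GR: "ring (GR n)"
  by (rule int_group_ring_ring[OF group_spin_group])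

lemma carrier_GR: "f \<in> carrier (GR n) \<longleftrightarrow> Poly_Mapping.keys f \<subseteq> cn n ` sub n"
  by (simp add: carrier_spin_group)

lemma GR_ext:
  assumes "f \<in> carrier (GR n)" "h \<in> carrier (GR n)" "\<And>g. g \<in> sub n \<Longrightarrow> lkp f (cn n g) = lkp h (cn n g)"
  shows "f = h"
proof (rule poly_mapping_eqI)
  fix A
  show "lkp f A = lkp h A"
  proof (cases "A \<in> cn n ` sub n")
    case False
    then have "A \<notin> Poly_Mapping.keys f" "A \<notin> Poly_Mapping.keys h" using assms(1,2) carrier_GR by blast+
    then show ?thesis by (simp add: in_keys_iff)
  qed (use assms(3) in auto)
qed

lemma lookup_cn: "g \<in> sub n \<Longrightarrow> lkp (sgl (cn n h) x) (cn n g) = (if h = g then x else 0)"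
  using cn_inj[of g n h] by (auto simp: lookup_single when_def)

lemma GR_lookup_mult:
  assumes "f \<in> carrier (GR n)" "h \<in> carrier (GR n)" "g \<in> sub n"
  shows "lkp (f \<otimes>\<^bsub>GR n\<^esub> h) (cn n g) = (\<Sum>a\<in>sub n. lkp f (cn n a) * lkp h (cn n (- a + g)))"
proof -
  have "f \<otimes>\<^bsub>GR n\<^esub> h = (\<Sum>A\<in>cn n ` sub n. \<Sum>B\<in>cn n ` sub n.
      sgl (A \<otimes>\<^bsub>spin_group n\<^esub> B) (lkp f A * lkp h B))"
    using assms(1,2) carrier_GR finite_sub by (intro group_ring_mult_superset) blast+
  also have "\<dots> = (\<Sum>a\<in>sub n. \<Sum>b\<in>sub n. sgl (cn n (a + b)) (lkp f (cn n a) * lkp h (cn n b)))"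
    by (simp add: sum.reindex[OF inj_on_cn] mult_spin_group)
  finally have "lkp (f \<otimes>\<^bsub>GR n\<^esub> h) (cn n g) =
      (\<Sum>a\<in>sub n. \<Sum>b\<in>sub n. if a + b = g then lkp f (cn n a) * lkp h (cn n b) else 0)"
    using assms(3) by (simp add: lookup_sum lookup_cn)
  also have "\<dots> = (\<Sum>a\<in>sub n. lkp f (cn n a) * lkp h (cn n (- a + g)))"
  proof (rule sum.cong)
    fix a assume a: "a \<in> sub n"
    note eq = spin_identities(7)[of a _ g]
    have "- a + g \<in> sub n" using a assms(3) by (intro sub_plus sub_uminus)
    then show "(\<Sum>b\<in>sub n. if a + b = g then lkp f (cn n a) * lkp h (cn n b) else 0) =
        lkp f (cn n a) * lkp h (cn n (- a + g))"
      unfolding eq using finite_sub by (simp add: sum.delta')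
  qed simp
  finally show ?thesis .
qed

lemma GR_a_inv:
  assumes "f \<in> carrier (GR n)"
  shows "\<ominus>\<^bsub>GR n\<^esub> f = - f"
proof -
  interpret ring "GR n" by (rule ring_GR)
  show ?thesis by (rule minus_equality) (use assms in auto)
qed

text \<open>The coefficient of \<open>g\<close> after setting \<open>z = -1\<close>.\<close>

definition anti :: "nat \<Rightarrow> (spin_gen word set \<Rightarrow>\<^sub>0 int) \<Rightarrow> spin \<Rightarrow> int" where
  "anti n f g = lkp f (cn n g) - lkp f (cn n (zz + g))"

lemma sub_zz_plus: "g \<in> sub n \<Longrightarrow> zz + g \<in> sub n"
  by (intro sub_plus) auto

text \<open>The ideal generated by \<open>z + 1\<close> consists of the functions invariant under \<open>z\<close>.\<close>

definition zinv :: "nat \<Rightarrow> (spin_gen word set \<Rightarrow>\<^sub>0 int) set" where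
  "zinv n = {f \<in> carrier (GR n). \<forall>g\<in>sub n. anti n f g = 0}"

lemma zinv_lookup: "f \<in> zinv n \<Longrightarrow> g \<in> sub n \<Longrightarrow> lkp f (cn n (zz + g)) = lkp f (cn n g)"
  by (auto simp: zinv_def anti_def)

lemma ideal_zinv: "ideal (zinv n) (GR n)"
proof (rule idealI[OF ring_GR])
  interpret ring "GR n" by (rule ring_GR)
  show "subgroup (zinv n) (add_monoid (GR n))"
  proof (rule add.subgroupI)
    show "zinv n \<subseteq> carrier (GR n)" by (auto simp: zinv_def)
    have "0 \<in> zinv n" by (simp add: zinv_def anti_def)
    then show "zinv n \<noteq> {}" by blast
    show "\<ominus>\<^bsub>GR n\<^esub> f \<in> zinv n" if "f \<in> zinv n" for f
      using that by (subst GR_a_inv) (auto simp: zinv_def anti_def)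
    show "f \<oplus>\<^bsub>GR n\<^esub> h \<in> zinv n" if "f \<in> zinv n" "h \<in> zinv n" for f h
    proof -
      have "f \<oplus>\<^bsub>GR n\<^esub> h \<in> carrier (GR n)" using that by (intro a_closed) (auto simp: zinv_def)
      then show ?thesis using that by (auto simp: zinv_def anti_def lookup_add)
    qed
  qed
  fix f h assume f: "f \<in> zinv n" and h: "h \<in> carrier (GR n)"
  have fc: "f \<in> carrier (GR n)" using f by (simp add: zinv_def)
  have "lkp (h \<otimes>\<^bsub>GR n\<^esub> f) (cn n (zz + g)) = lkp (h \<otimes>\<^bsub>GR n\<^esub> f) (cn n g)" if g: "g \<in> sub n" for g
  proof -
    have "lkp f (cn n (- a + (zz + g))) = lkp f (cn n (- a + g))" if "a \<in> sub n" for a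
      using zinv_lookup[OF f, of "- a + g"] sub_plus[OF sub_uminus[OF that] g]
      unfolding spin_identities(2) by blast
    then show ?thesis
      using GR_lookup_mult[OF h fc g] GR_lookup_mult[OF h fc sub_zz_plus[OF g]] by simp
  qed
  then show "h \<otimes>\<^bsub>GR n\<^esub> f \<in> zinv n" using m_closed[OF h fc] unfolding zinv_def anti_def by simp
  have "lkp (f \<otimes>\<^bsub>GR n\<^esub> h) (cn n (zz + g)) = lkp (f \<otimes>\<^bsub>GR n\<^esub> h) (cn n g)" if g: "g \<in> sub n" for g
  proof -
    have "(\<Sum>a\<in>sub n. lkp f (cn n a) * lkp h (cn n (- a + g))) =
        (\<Sum>a\<in>sub n. lkp f (cn n a) * lkp h (cn n (- a + (zz + g))))"
    \<comment> \<open>Now the invariant factor is the left one, so the \<open>zz\<close> in front of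
      \<open>g\<close> is absorbed by replacing the summation index \<open>a\<close> with
      \<open>zz + a\<close>.\<close>
    proof (rule sum.reindex_bij_witness[of _ "\<lambda>a. zz + a" "\<lambda>a. zz + a"])
      fix a assume a: "a \<in> sub n"
      show "lkp f (cn n (zz + a)) * lkp h (cn n (- (zz + a) + (zz + g))) =
          lkp f (cn n a) * lkp h (cn n (- a + g))"
        unfolding spin_identities(1) using zinv_lookup[OF f a] by simp
    qed (auto intro: sub_zz_plus)
    then show ?thesis
      using GR_lookup_mult[OF fc h g] GR_lookup_mult[OF fc h sub_zz_plus[OF g]] by simp
  qed
  then show "f \<otimes>\<^bsub>GR n\<^esub> h \<in> zinv n" using m_closed[OF fc h] unfolding zinv_def anti_def by simp
qed

text \<open>For the harder inclusion, an invariant \<open>f\<close> is a multiple of the generator: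
  restrict \<open>f\<close> to a set \<open>T\<close> containing one element of each pair
  \<open>g\<close>, \<open>zz + g\<close>, and multiply by \<open>z + 1\<close>.\<close>

lemma spin_ideal_eq: "spin_ideal n = zinv n"
proof -
  interpret ring "GR n" by (rule ring_GR)
  let ?z = "sgl (cn n zz) 1" and ?o = "sgl (cn n 0) (1 :: int)"
  have def: "spin_ideal n = Idl\<^bsub>GR n\<^esub> {?z + ?o}"
    by (simp add: spin_ideal_def spin_rel_z_letter one_spin_group)
  have zc: "?z \<in> carrier (GR n)" and oc: "?o \<in> carrier (GR n)" by (auto simp: carrier_spin_group)
  then have zoc: "?z + ?o \<in> carrier (GR n)" using a_closed[OF zc oc] by simp
  have "anti n (?z + ?o) g = 0" if "g \<in> sub n" for g
  proof -
    have "anti n (?z + ?o) g = (if zz = g then 1 else 0) + (if 0 = g then 1 else 0) -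
        ((if zz = zz + g then 1 else 0) + (if 0 = zz + g then 1 else 0))"
      using that sub_zz_plus[OF that] by (simp only: anti_def lookup_add lookup_cn)
    then show ?thesis unfolding spin_identities(3,4) by auto
  qed
  then have "?z + ?o \<in> zinv n" using zoc unfolding zinv_def by blast
  then have "Idl\<^bsub>GR n\<^esub> {?z + ?o} \<subseteq> zinv n" using genideal_minimal[OF ideal_zinv] by blast
  moreover have "zinv n \<subseteq> Idl\<^bsub>GR n\<^esub> {?z + ?o}"
  proof
    fix f assume f: "f \<in> zinv n"
    then have fc: "f \<in> carrier (GR n)" by (simp add: zinv_def)
    \<comment> \<open>The choice depends only on the unordered pair, so it is the same for
      \<open>g\<close> and \<open>zz + g\<close> and selects exactly one of them.\<close>
    define T where "T = {g \<in> sub n. (SOME h. h = g \<or> h = zz + g) = g}"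
    have T: "zz + g \<in> T \<longleftrightarrow> g \<notin> T" if "g \<in> sub n" for g
    proof -
      have "(SOME h. h = zz + g \<or> h = zz + (zz + g)) = (SOME h. h = g \<or> h = zz + g)"
        by (rule arg_cong[where f = Eps]) auto
      moreover have "(SOME h. h = g \<or> h = zz + g) = g \<or> (SOME h. h = g \<or> h = zz + g) = zz + g"
        by (rule someI[of "\<lambda>h. h = g \<or> h = zz + g" g]) simp
      ultimately show ?thesis
        using that sub_zz_plus[OF that] zz_plus_neq[of g] unfolding T_def by auto
    qed
    have Tsub: "T \<subseteq> sub n" by (auto simp: T_def)
    then have finT: "finite T" using finite_sub finite_subset by blast
    define k where "k = (\<Sum>g\<in>T. sgl (cn n g) (lkp f (cn n g)))"
    have kl: "lkp k (cn n g) = (if g \<in> T then lkp f (cn n g) else 0)" if "g \<in> sub n" for g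
      using that finT by (simp add: k_def lookup_sum lookup_cn)
    have kc: "k \<in> carrier (GR n)"
    proof -
      have "Poly_Mapping.keys k \<subseteq> (\<Union>g\<in>T. Poly_Mapping.keys (sgl (cn n g) (lkp f (cn n g))))"
        unfolding k_def by (rule keys_sum)
      also have "\<dots> \<subseteq> cn n ` sub n" using Tsub by (auto split: if_splits)
      finally show ?thesis unfolding carrier_GR .
    qed
    have "k \<otimes>\<^bsub>GR n\<^esub> (?z + ?o) = f"
    proof (rule GR_ext[OF m_closed[OF kc zoc] fc])
      fix g assume g: "g \<in> sub n"
      have "lkp (k \<otimes>\<^bsub>GR n\<^esub> (?z + ?o)) (cn n g) =
          (\<Sum>a\<in>sub n. lkp k (cn n a) * lkp (?z + ?o) (cn n (- a + g)))"
        by (rule GR_lookup_mult[OF kc zoc g])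
      also have "\<dots> = (\<Sum>a\<in>sub n. (if a = zz + g then lkp k (cn n a) else 0) + (if a = g then lkp k (cn n a) else 0))"
      proof (rule sum.cong)
        fix a assume a: "a \<in> sub n"
        have "lkp (?z + ?o) (cn n (- a + g)) = (if a = zz + g then 1 else 0) + (if a = g then 1 else 0)"
          using lookup_cn[OF sub_plus[OF sub_uminus[OF a] g]] by (simp only: lookup_add spin_identities(5,6))
        then show "lkp k (cn n a) * lkp (?z + ?o) (cn n (- a + g)) =
            (if a = zz + g then lkp k (cn n a) else 0) + (if a = g then lkp k (cn n a) else 0)"
          by simp
      qed simp
      also have "\<dots> = lkp k (cn n (zz + g)) + lkp k (cn n g)"
        using g sub_zz_plus[OF g] finite_sub by (simp add: sum.distrib)
      also have "\<dots> = lkp f (cn n g)"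
        using kl[OF g] kl[OF sub_zz_plus[OF g]] T[OF g] zinv_lookup[OF f g] by auto
      finally show "lkp (k \<otimes>\<^bsub>GR n\<^esub> (?z + ?o)) (cn n g) = lkp f (cn n g)" .
    qed
    moreover have "?z + ?o \<in> Idl\<^bsub>GR n\<^esub> {?z + ?o}" using genideal_self'[OF zoc] .
    moreover have "ideal (Idl\<^bsub>GR n\<^esub> {?z + ?o}) (GR n)" by (rule genideal_ideal) (use zoc in simp)
    ultimately show "f \<in> Idl\<^bsub>GR n\<^esub> {?z + ?o}" using ideal.I_l_closed kc by metis
  qed
  ultimately show ?thesis using def by blast
qed

lemma ideal_spin_ideal: "ideal (spin_ideal n) (GR n)"
  by (simp only: spin_ideal_eq ideal_zinv)

lemma spin_image_eq_iff:
  assumes "f \<in> carrier (GR n)" "h \<in> carrier (GR n)"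
  shows "spin_image n f = spin_image n h \<longleftrightarrow> (\<forall>g\<in>sub n. anti n f g = anti n h g)"
proof -
  interpret ring "GR n" by (rule ring_GR)
  have m: "f \<ominus>\<^bsub>GR n\<^esub> h = f - h" using GR_a_inv[OF assms(2)] by (simp add: a_minus_def)
  have "f \<ominus>\<^bsub>GR n\<^esub> h \<in> carrier (GR n)" using assms by (rule minus_closed)
  then have "f - h \<in> spin_ideal n \<longleftrightarrow> (\<forall>g\<in>sub n. anti n (f - h) g = 0)"
    unfolding spin_ideal_eq zinv_def m by blast
  moreover have "anti n (f - h) g = anti n f g - anti n h g" for g
    by (simp add: anti_def lookup_minus)
  ultimately show ?thesis
    using quotient_eq_iff_same_a_r_cos[OF ideal_spin_ideal assms] by (simp add: spin_image_def m)
qed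

lemma ring_spin_ring: "ring (spin_ring n)"
  unfolding spin_ring_def by (rule ideal.quotient_is_ring[OF ideal_spin_ideal])

lemma spin_image_hom: "spin_image n \<in> ring_hom (GR n) (spin_ring n)"
  using ideal.rcos_ring_hom[OF ideal_spin_ideal] unfolding spin_ring_def spin_image_def by simp

lemma spin_image_mult:
  "f \<in> carrier (GR n) \<Longrightarrow> h \<in> carrier (GR n) \<Longrightarrow>
    spin_image n f \<otimes>\<^bsub>spin_ring n\<^esub> spin_image n h = spin_image n (f \<otimes>\<^bsub>GR n\<^esub> h)"
  using ring_hom_mult[OF spin_image_hom] by metis

lemma spin_image_add:
  "f \<in> carrier (GR n) \<Longrightarrow> h \<in> carrier (GR n) \<Longrightarrow>
    spin_image n f \<oplus>\<^bsub>spin_ring n\<^esub> spin_image n h = spin_image n (f + h)"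
  using ring_hom_add[OF spin_image_hom, of f n h] by simp

lemma spin_image_zero: "spin_image n 0 = \<zero>\<^bsub>spin_ring n\<^esub>"
  using ring_hom_zero[OF spin_image_hom ring_GR ring_spin_ring] by simp

lemma carrier_spin_ring: "carrier (spin_ring n) = spin_image n ` carrier (GR n)"
  unfolding spin_ring_def spin_image_def FactRing_def A_RCOSETS_def' by auto

section \<open>Structure constants of the even center\<close>

lemma even_word_cn:
  assumes "g \<in> sub n"
  shows "(\<exists>w\<in>cn n g. even_word w) \<longleftrightarrow> \<not> sodd g"
proof -
  obtain w where "w \<in> spin_words n" "elt w = g" using assms by (auto simp: sub_def)
  then show ?thesis using sodd_elt unfolding cl_def by blast
qed

definition even_supp :: "(spin_gen word set \<Rightarrow>\<^sub>0 int) \<Rightarrow> bool" where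
  "even_supp f \<longleftrightarrow> (\<forall>A\<in>Poly_Mapping.keys f. \<exists>w\<in>A. even_word w)"

lemma even_part_eq: "spin_ring_even_part n = spin_image n ` {f \<in> carrier (GR n). even_supp f}"
  by (simp add: spin_ring_even_part_def even_supp_def)

lemma even_center_simps [simp]:
  "\<zero>\<^bsub>even_center n\<^esub> = \<zero>\<^bsub>spin_ring n\<^esub>" "add (even_center n) = add (spin_ring n)"
  "monoid.mult (even_center n) = monoid.mult (spin_ring n)"
  by (simp_all add: even_center_def)

lemma carrier_even_center:
  "x \<in> carrier (even_center n) \<longleftrightarrow> x \<in> spin_ring_even_part n \<and>
    (\<forall>b\<in>carrier (spin_ring n). x \<otimes>\<^bsub>spin_ring n\<^esub> b = b \<otimes>\<^bsub>spin_ring n\<^esub> x)"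
  by (simp add: even_center_def)

lemma carrier_even_center_spin_ring: "x \<in> carrier (even_center n) \<Longrightarrow> x \<in> carrier (spin_ring n)"
  by (auto simp: carrier_even_center even_part_eq carrier_spin_ring)

text \<open>The additive structure is what gives \<open>finsum\<close> and the integer multiples in
  \<open>structure_constant\<close> their meaning.\<close>

lemma abelian_group_even_center: "abelian_group (even_center n)"
proof -
  interpret Q: ring "spin_ring n" by (rule ring_spin_ring)
  note c = carrier_even_center_spin_ring
  show ?thesis
  proof (rule abelian_groupI)
    fix x y assume x: "x \<in> carrier (even_center n)" and y: "y \<in> carrier (even_center n)"
    obtain f where f: "f \<in> carrier (GR n)" "even_supp f" "x = spin_image n f"
      using x by (auto simp: carrier_even_center even_part_eq)
    obtain h where h: "h \<in> carrier (GR n)" "even_supp h" "y = spin_image n h"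
      using y by (auto simp: carrier_even_center even_part_eq)
    interpret ring "GR n" by (rule ring_GR)
    have "f + h \<in> carrier (GR n)" using a_closed[OF f(1) h(1)] by simp
    moreover have "even_supp (f + h)" using f(2) h(2) keys_add[of f h] unfolding even_supp_def by blast
    ultimately have "x \<oplus>\<^bsub>spin_ring n\<^esub> y \<in> spin_ring_even_part n"
      using spin_image_add[OF f(1) h(1)] f(3) h(3) by (auto simp: even_part_eq)
    moreover have "(x \<oplus>\<^bsub>spin_ring n\<^esub> y) \<otimes>\<^bsub>spin_ring n\<^esub> b = b \<otimes>\<^bsub>spin_ring n\<^esub> (x \<oplus>\<^bsub>spin_ring n\<^esub> y)"
      if "b \<in> carrier (spin_ring n)" for b
      using x y that c[OF x] c[OF y] by (simp add: Q.l_distr Q.r_distr carrier_even_center)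
    ultimately show "x \<oplus>\<^bsub>even_center n\<^esub> y \<in> carrier (even_center n)"
      by (simp add: carrier_even_center)
    show "x \<oplus>\<^bsub>even_center n\<^esub> y = y \<oplus>\<^bsub>even_center n\<^esub> x"
      using c[OF x] c[OF y] by (simp add: Q.a_comm)
    fix z assume z: "z \<in> carrier (even_center n)"
    show "x \<oplus>\<^bsub>even_center n\<^esub> y \<oplus>\<^bsub>even_center n\<^esub> z = x \<oplus>\<^bsub>even_center n\<^esub> (y \<oplus>\<^bsub>even_center n\<^esub> z)"
      using c[OF x] c[OF y] c[OF z] by (simp add: Q.a_assoc)
  next
    have "\<zero>\<^bsub>spin_ring n\<^esub> \<in> spin_ring_even_part n"
      unfolding even_part_eq spin_image_zero[symmetric] by (rule imageI) (simp add: even_supp_def)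
    then show "\<zero>\<^bsub>even_center n\<^esub> \<in> carrier (even_center n)" by (simp add: carrier_even_center)
  next
    fix x assume x: "x \<in> carrier (even_center n)"
    show "\<zero>\<^bsub>even_center n\<^esub> \<oplus>\<^bsub>even_center n\<^esub> x = x" using c[OF x] by simp
    obtain f where f: "f \<in> carrier (GR n)" "even_supp f" "x = spin_image n f"
      using x by (auto simp: carrier_even_center even_part_eq)
    have mf: "- f \<in> carrier (GR n)" "even_supp (- f)" using f(1,2) by (simp_all add: even_supp_def)
    have sum: "spin_image n (- f) \<oplus>\<^bsub>spin_ring n\<^esub> x = \<zero>\<^bsub>spin_ring n\<^esub>"
      using spin_image_add[OF mf(1) f(1)] f(3) spin_image_zero by simp
    have mQ: "spin_image n (- f) \<in> carrier (spin_ring n)"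
      unfolding carrier_spin_ring using mf(1) by (rule imageI)
    have eq: "spin_image n (- f) = \<ominus>\<^bsub>spin_ring n\<^esub> x"
      using Q.minus_equality[OF sum c[OF x] mQ] by simp
    have "spin_image n (- f) \<in> spin_ring_even_part n" using mf by (auto simp: even_part_eq)
    moreover have "spin_image n (- f) \<otimes>\<^bsub>spin_ring n\<^esub> b = b \<otimes>\<^bsub>spin_ring n\<^esub> spin_image n (- f)"
      if "b \<in> carrier (spin_ring n)" for b
      unfolding eq using x that c[OF x] by (simp add: Q.l_minus Q.r_minus carrier_even_center)
    ultimately have "spin_image n (- f) \<in> carrier (even_center n)" by (simp add: carrier_even_center)
    then show "\<exists>y\<in>carrier (even_center n). y \<oplus>\<^bsub>even_center n\<^esub> x = \<zero>\<^bsub>even_center n\<^esub>"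
      using sum by (intro bexI[of _ "spin_image n (- f)"]) auto
  qed
qed

lemma zz_conjugate:
  assumes "w + h = zz + h + w"
  shows "w + h - w = zz + h" "w + (zz + h) - w = h"
proof -
  show "w + h - w = zz + h" using assms by (metis add_diff_cancel)
  have "w + (zz + h) = zz + (w + h)" by (metis add.assoc zz_commute)
  also have "\<dots> = h + w" using assms by (simp add: add.assoc)
  finally show "w + (zz + h) - w = h" by (metis add_diff_cancel)
qed

definition dsum :: "nat \<Rightarrow> nat list \<Rightarrow> int \<Rightarrow> spin_gen word set \<Rightarrow>\<^sub>0 int" where
  "dsum n lam k = (\<Sum>g\<in>DD n lam. sgl (cn n g) k)"

lemma spin_conj_identities:
  fixes a g :: spin
  shows "g - (- a + g) = a" "- (g - a) + g = a" "- (- a + g) + g = - g + a - - g"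
    "g + (- g + a - - g) - g = a"
  by (simp_all only: diff_conv_add_uminus minus_add minus_minus add.assoc minus_add_cancel
      add_minus_cancel right_minus left_minus add_0_right)

context
  fixes n :: nat and lam :: "nat list"
  assumes lam: "lam \<in> even_partitions"
begin

lemma finite_DD: "finite (DD n lam)"
  using DD_sub[OF lam] finite_sub finite_subset by (metis subsetI)

lemma keys_dsum: "Poly_Mapping.keys (dsum n lam k) \<subseteq> cn n ` DD n lam"
proof -
  have "Poly_Mapping.keys (dsum n lam k) \<subseteq> (\<Union>g\<in>DD n lam. Poly_Mapping.keys (sgl (cn n g) k))"
    unfolding dsum_def by (rule keys_sum)
  also have "\<dots> \<subseteq> cn n ` DD n lam" by (auto split: if_splits)
  finally show ?thesis .
qed

lemma dsum_carrier: "dsum n lam k \<in> carrier (GR n)"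
  using keys_dsum[of k] DD_sub[OF lam] unfolding carrier_GR by blast

lemma lookup_dsum: "g \<in> sub n \<Longrightarrow> lkp (dsum n lam k) (cn n g) = (if g \<in> DD n lam then k else 0)"
  using finite_DD by (simp add: dsum_def lookup_sum lookup_cn)

lemma even_supp_dsum: "even_supp (dsum n lam k)"
  using keys_dsum[of k] even_word_cn DD_even[OF lam] DD_sub[OF lam] unfolding even_supp_def by blast

lemma dsum_add: "dsum n lam (k + l) = dsum n lam k + dsum n lam l"
  by (simp add: dsum_def single_add sum.distrib)

lemma d_elem_eq: "d_elem n lam = spin_image n (dsum n lam 1)"
proof -
  have "inj_on (cn n) (DD n lam)" using inj_on_cn DD_sub[OF lam] by (metis inj_on_subset subsetI)
  then show ?thesis
    by (simp add: d_elem_def D_class_eq[OF lam] dsum_def sum.reindex)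
qed

lemma dsum_commute:
  assumes h: "h \<in> carrier (GR n)"
  shows "dsum n lam k \<otimes>\<^bsub>GR n\<^esub> h = h \<otimes>\<^bsub>GR n\<^esub> dsum n lam k"
proof -
  interpret ring "GR n" by (rule ring_GR)
  note d = dsum_carrier[of k]
  show ?thesis
  proof (rule GR_ext[OF m_closed[OF d h] m_closed[OF h d]])
    fix g assume g: "g \<in> sub n"
    have "lkp (dsum n lam k \<otimes>\<^bsub>GR n\<^esub> h) (cn n g) =
        (\<Sum>a\<in>sub n. (if a \<in> DD n lam then k else 0) * lkp h (cn n (- a + g)))"
      by (simp add: GR_lookup_mult[OF d h g] lookup_dsum)
    also have "\<dots> = (\<Sum>a\<in>sub n. lkp h (cn n a) * (if - a + g \<in> DD n lam then k else 0))"
    \<comment> \<open>Substituting \<open>b = - a + g\<close> turns \<open>- b + g\<close> into the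
      conjugate of \<open>a\<close> by \<open>- g\<close>, and the class is closed under
      conjugation.\<close>
    proof (rule sum.reindex_bij_witness[of _ "\<lambda>a. g - a" "\<lambda>a. - a + g"])
      fix a assume a: "a \<in> sub n"
      show "g - (- a + g) = a" by (rule spin_conj_identities)
      show "- a + g \<in> sub n" using a g by (intro sub_plus sub_uminus)
      show "- (g - a) + g = a" by (rule spin_conj_identities)
      show "g - a \<in> sub n" using a g by (rule sub_minus[rotated])
      have "- (- a + g) + g \<in> DD n lam \<longleftrightarrow> - g + a - - g \<in> DD n lam"
        by (simp only: spin_conj_identities)
      also have "\<dots> \<longleftrightarrow> a \<in> DD n lam"
      proof
        assume "- g + a - - g \<in> DD n lam"
        then have "g + (- g + a - - g) - g \<in> DD n lam" using DD_conj[OF lam _ g] by blast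
        then show "a \<in> DD n lam" by (simp only: spin_conj_identities)
      qed (rule DD_conj[OF lam _ sub_uminus[OF g]])
      finally show "lkp h (cn n (- a + g)) * (if - (- a + g) + g \<in> DD n lam then k else 0) =
          (if a \<in> DD n lam then k else 0) * lkp h (cn n (- a + g))"
        by simp
    qed
    also have "\<dots> = lkp (h \<otimes>\<^bsub>GR n\<^esub> dsum n lam k) (cn n g)"
    proof -
      have "- a + g \<in> sub n" if "a \<in> sub n" for a using that g by (intro sub_plus sub_uminus)
      then show ?thesis by (simp add: GR_lookup_mult[OF h d g] lookup_dsum)
    qed
    finally show "lkp (dsum n lam k \<otimes>\<^bsub>GR n\<^esub> h) (cn n g) = lkp (h \<otimes>\<^bsub>GR n\<^esub> dsum n lam k) (cn n g)" .
  qed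
qed

lemma dsum_even_center: "spin_image n (dsum n lam k) \<in> carrier (even_center n)"
proof -
  have "spin_image n (dsum n lam k) \<in> spin_ring_even_part n"
    using dsum_carrier even_supp_dsum by (auto simp: even_part_eq)
  moreover have "spin_image n (dsum n lam k) \<otimes>\<^bsub>spin_ring n\<^esub> b = b \<otimes>\<^bsub>spin_ring n\<^esub> spin_image n (dsum n lam k)"
    if b: "b \<in> carrier (spin_ring n)" for b
  proof -
    obtain h where h: "b = spin_image n h" "h \<in> carrier (GR n)"
      by (rule imageE[OF b[unfolded carrier_spin_ring]])
    show ?thesis
      by (simp only: h(1) spin_image_mult[OF dsum_carrier h(2)] spin_image_mult[OF h(2) dsum_carrier]
          dsum_commute[OF h(2)])
  qed
  ultimately show ?thesis by (simp add: carrier_even_center)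
qed

lemma add_pow_d_elem: "[k] \<cdot>\<^bsub>even_center n\<^esub> d_elem n lam = spin_image n (dsum n lam k)"
proof -
  interpret abelian_group "even_center n" by (rule abelian_group_even_center)
  have nat: "[m] \<cdot>\<^bsub>even_center n\<^esub> d_elem n lam = spin_image n (dsum n lam (int m))" for m :: nat
  proof (induction m)
    case 0
    have "dsum n lam 0 = 0" by (simp add: dsum_def)
    then show ?case by (simp add: spin_image_zero)
  next
    case (Suc m)
    have "[Suc m] \<cdot>\<^bsub>even_center n\<^esub> d_elem n lam =
        [m] \<cdot>\<^bsub>even_center n\<^esub> d_elem n lam \<oplus>\<^bsub>even_center n\<^esub> d_elem n lam"
      by (rule add.nat_pow_Suc)
    also have "\<dots> = spin_image n (dsum n lam (int m) + dsum n lam 1)"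
      using Suc spin_image_add[OF dsum_carrier dsum_carrier] by (simp add: d_elem_eq)
    finally show ?case by (simp add: add.commute flip: dsum_add)
  qed
  show ?thesis
  proof (cases "k \<ge> 0")
    case True
    then show ?thesis using nat[of "nat k"] by (simp add: add_pow_int_ge)
  next
    case False
    have "spin_image n (dsum n lam k) \<oplus>\<^bsub>even_center n\<^esub> spin_image n (dsum n lam (- k)) = \<zero>\<^bsub>even_center n\<^esub>"
    proof -
      have "dsum n lam 0 = 0" by (simp add: dsum_def)
      then show ?thesis
        using spin_image_add[OF dsum_carrier dsum_carrier, of k "- k"] dsum_add[of k "- k"]
        by (simp add: spin_image_zero)
    qed
    then have "\<ominus>\<^bsub>even_center n\<^esub> spin_image n (dsum n lam (- k)) = spin_image n (dsum n lam k)"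
      by (rule minus_equality) (rule dsum_even_center)+
    then show ?thesis using False nat[of "nat (- k)"] by (simp add: add_pow_int_lt)
  qed
qed

end

lemma finite_basis_index: "finite (basis_index n)"
proof (rule finite_subset)
  show "basis_index n \<subseteq> {xs. set xs \<subseteq> {..n} \<and> length xs \<le> n}"
    using member_le_sum_list by (fastforce simp: basis_index_def)
qed (rule finite_lists_length_le, simp)

lemma finsum_d_elem:
  assumes "B \<subseteq> basis_index n" "finite B"
  shows "finsum (even_center n) (\<lambda>kap. [a kap] \<cdot>\<^bsub>even_center n\<^esub> d_elem n kap) B =
    spin_image n (\<Sum>kap\<in>B. dsum n kap (a kap)) \<and> (\<Sum>kap\<in>B. dsum n kap (a kap)) \<in> carrier (GR n)"
  using assms(2,1)
proof (induction B rule: finite_induct)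
  interpret abelian_group "even_center n" by (rule abelian_group_even_center)
  interpret R: ring "GR n" by (rule ring_GR)
  {
    case empty
    then show ?case by (simp add: spin_image_zero)
  next
    case (insert kap B)
    have ep: "kap \<in> even_partitions" if "kap \<in> basis_index n" for kap using that by (simp add: basis_index_def)
    have e: "[a kap] \<cdot>\<^bsub>even_center n\<^esub> d_elem n kap = spin_image n (dsum n kap (a kap))"
      if "kap \<in> basis_index n" for kap using add_pow_d_elem ep that by blast
    have "finsum (even_center n) (\<lambda>kap. [a kap] \<cdot>\<^bsub>even_center n\<^esub> d_elem n kap) (insert kap B) =
        [a kap] \<cdot>\<^bsub>even_center n\<^esub> d_elem n kap \<oplus>\<^bsub>even_center n\<^esub>
        finsum (even_center n) (\<lambda>kap. [a kap] \<cdot>\<^bsub>even_center n\<^esub> d_elem n kap) B"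
      using insert e dsum_even_center ep by (intro finsum_insert) (auto simp: Pi_iff subset_iff)
    moreover have "dsum n kap (a kap) \<in> carrier (GR n)" using dsum_carrier ep insert.prems by blast
    ultimately show ?case
      using insert e R.a_closed[of "dsum n kap (a kap)" "\<Sum>kap\<in>B. dsum n kap (a kap)"]
        spin_image_add[of "dsum n kap (a kap)" n "\<Sum>kap\<in>B. dsum n kap (a kap)"]
      by simp
  }
qed

lemma lookup_dsum_mult:
  assumes "lam \<in> even_partitions" "mu \<in> even_partitions" "g \<in> sub n"
  shows "lkp (dsum n lam 1 \<otimes>\<^bsub>GR n\<^esub> dsum n mu 1) (cn n g) = int (fcount n lam mu g)"
proof -
  have s: "- a + g \<in> sub n" if "a \<in> sub n" for a using that assms(3) by (intro sub_plus sub_uminus)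
  have "lkp (dsum n lam 1 \<otimes>\<^bsub>GR n\<^esub> dsum n mu 1) (cn n g) =
      (\<Sum>a\<in>sub n. (if a \<in> DD n lam then 1 else 0) * (if - a + g \<in> DD n mu then 1 else 0))"
    using s by (simp add: GR_lookup_mult[OF dsum_carrier[OF assms(1)] dsum_carrier[OF assms(2)] assms(3)]
        lookup_dsum[OF assms(1)] lookup_dsum[OF assms(2)])
  also have "\<dots> = (\<Sum>a\<in>sub n. if a \<in> DD n lam \<and> - a + g \<in> DD n mu then 1 else 0)"
    by (intro sum.cong) auto
  also have "\<dots> = int (card {a \<in> sub n. a \<in> DD n lam \<and> - a + g \<in> DD n mu})"
    using finite_sub by (simp add: sum.If_cases Int_def)
  also have "card {a \<in> sub n. a \<in> DD n lam \<and> - a + g \<in> DD n mu} = fcount n lam mu g"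
    unfolding fcount_def
  proof (rule bij_betw_same_card[of "\<lambda>a. (a, - a + g)"], rule bij_betw_byWitness[of _ fst])
    show "(\<lambda>a. (a, - a + g)) ` {a \<in> sub n. a \<in> DD n lam \<and> - a + g \<in> DD n mu}
        \<subseteq> {(a, b). a \<in> DD n lam \<and> b \<in> DD n mu \<and> a + b = g}"
      using add_minus_cancel by (auto simp del: add_uminus_conv_diff)
    show "fst ` {(a, b). a \<in> DD n lam \<and> b \<in> DD n mu \<and> a + b = g}
        \<subseteq> {a \<in> sub n. a \<in> DD n lam \<and> - a + g \<in> DD n mu}"
      using DD_sub[OF assms(1)] by (auto simp: minus_add_cancel)
    show "\<forall>x\<in>{(a, b). a \<in> DD n lam \<and> b \<in> DD n mu \<and> a + b = g}. (fst x, - fst x + g) = x"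
      by (auto simp: minus_add_cancel)
  qed simp
  finally show ?thesis .
qed

text \<open>The coordinates must be shown to exist and to be unique. Elements of the quotient agree
  if their antisymmetrized coefficients agree at each \<open>h\<close> in \<open>sub n\<close>. At
  odd \<open>h\<close> both sides vanish. If \<open>h\<close> is a product of odd cycles up to
  \<open>zz\<close>, its own class alone contributes. Any other even \<open>h\<close> is conjugate
  to \<open>zz + h\<close>, and both sides vanish again. Evaluation at representatives of the
  classes gives uniqueness.\<close>

lemma structure_constant_eq:
  assumes lam: "lam \<in> even_partitions" and mu: "mu \<in> even_partitions"
    and nu: "nu \<in> even_partitions" and g: "g \<in> DD n nu"
  shows "structure_constant n lam mu nu = scoef n lam mu g"
proof -
  interpret R: ring "GR n" by (rule ring_GR)
  let ?p = "dsum n lam 1 \<otimes>\<^bsub>GR n\<^esub> dsum n mu 1"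
  let ?s = "\<lambda>a. \<Sum>kap\<in>basis_index n. dsum n kap (a kap)"
  let ?P = "\<lambda>a. (\<forall>kap. kap \<notin> basis_index n \<longrightarrow> a kap = 0) \<and>
     d_elem n lam \<otimes>\<^bsub>even_center n\<^esub> d_elem n mu =
       finsum (even_center n) (\<lambda>kap. [a kap] \<cdot>\<^bsub>even_center n\<^esub> d_elem n kap) (basis_index n)"
  have ep: "kap \<in> even_partitions" if "kap \<in> basis_index n" for kap using that by (simp add: basis_index_def)
  have pc: "?p \<in> carrier (GR n)" by (rule R.m_closed[OF dsum_carrier[OF lam] dsum_carrier[OF mu]])
  have anti_p: "anti n ?p g = scoef n lam mu g" if "g \<in> sub n" for g
    using that sub_zz_plus[OF that] by (simp add: anti_def scoef_def lookup_dsum_mult[OF lam mu])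
  have anti_s: "anti n (?s a) g = (\<Sum>kap\<in>basis_index n. if g \<in> DD n kap then a kap else 0) -
      (\<Sum>kap\<in>basis_index n. if zz + g \<in> DD n kap then a kap else 0)" if "g \<in> sub n" for g a
    using that sub_zz_plus[OF that] by (simp add: anti_def lookup_sum lookup_dsum[OF ep])
  have P: "?P a \<longleftrightarrow> (\<forall>kap. kap \<notin> basis_index n \<longrightarrow> a kap = 0) \<and>
      (\<forall>g\<in>sub n. scoef n lam mu g = anti n (?s a) g)" for a
  proof -
    note fs = finsum_d_elem[OF order_refl finite_basis_index, of n a]
    have "d_elem n lam \<otimes>\<^bsub>even_center n\<^esub> d_elem n mu = spin_image n ?p"
      using spin_image_mult[OF dsum_carrier[OF lam] dsum_carrier[OF mu]]
      by (simp add: d_elem_eq[OF lam] d_elem_eq[OF mu])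
    then show ?thesis using fs spin_image_eq_iff[OF pc conjunct2[OF fs]] anti_p by simp
  qed
  have on_class: "anti n (?s a) h = a kap" if "kap \<in> basis_index n" "h \<in> DD n kap" for a kap h
  proof -
    have 1: "h \<in> DD n k \<longleftrightarrow> k = kap" if "k \<in> basis_index n" for k
      using DD_type_unique ep that \<open>kap \<in> basis_index n\<close> \<open>h \<in> DD n kap\<close> by metis
    \<comment> \<open>Since \<open>zz + h\<close> and \<open>h\<close> have the same permutation,
      only the class of \<open>h\<close> itself could contain it, and that class does not meet its
      \<open>zz\<close> multiple.\<close>
    have 2: "zz + h \<notin> DD n k" if "k \<in> basis_index n" for k
    proof
      assume z: "zz + h \<in> DD n k"
      then have "k = kap"
        using DD_type_unique[OF ep[OF that] ep[OF \<open>kap \<in> basis_index n\<close>] z \<open>h \<in> DD n kap\<close>]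
        by (simp add: sperm_plus)
      then show False using DD_not_zz[OF ep[OF that]] z \<open>h \<in> DD n kap\<close> by blast
    qed
    have "anti n (?s a) h = (\<Sum>k\<in>basis_index n. if k = kap then a k else 0) -
        (\<Sum>k\<in>basis_index n. 0)"
      unfolding anti_s[OF DD_sub[OF ep[OF that(1)] that(2)]] using 1 2 by simp
    then show ?thesis using that(1) finite_basis_index by simp
  qed
  define rep where "rep kap = (SOME h. h \<in> DD n kap)" for kap
  have rep: "rep kap \<in> DD n kap" if "kap \<in> basis_index n" for kap
  proof -
    have "DD n kap \<noteq> {}" using that by (intro DD_nonempty) (simp add: basis_index_def)
    then show ?thesis unfolding rep_def by (metis ex_in_conv someI_ex)
  qed
  define a where "a kap = (if kap \<in> basis_index n then scoef n lam mu (rep kap) else 0)" for kap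
  have sc_rep: "scoef n lam mu h = a kap" if "kap \<in> basis_index n" "h \<in> DD n kap" for h kap
    using DD_transitive[OF ep[OF that(1)] that(2) rep[OF that(1)]] scoef_conj[OF lam mu] that(1)
    by (auto simp: a_def)
  have sc_zz: "scoef n lam mu (zz + h) = - scoef n lam mu h" for h by (simp add: scoef_def)
  have anti_zz: "anti n f (zz + h) = - anti n f h" for f h by (simp add: anti_def)
  have "scoef n lam mu h = anti n (?s a) h" if h: "h \<in> sub n" for h
  proof (cases "sodd h")
    case True
    have "fcount n lam mu k = 0" if "sodd k" for k
    proof -
      have "{(a, b). a \<in> DD n lam \<and> b \<in> DD n mu \<and> a + b = k} = {}"
        using DD_even[OF lam] DD_even[OF mu] that sodd_plus by fastforce
      then show ?thesis by (simp only: fcount_def card.empty)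
    qed
    then have "scoef n lam mu h = 0" using True by (simp add: scoef_def sodd_plus)
    moreover have "h \<notin> DD n kap" "zz + h \<notin> DD n kap" if "kap \<in> basis_index n" for kap
      using True DD_even[OF ep[OF that]] sodd_plus[of zz h] by auto
    then have "anti n (?s a) h = 0" by (simp add: anti_s[OF h])
    ultimately show ?thesis by simp
  next
    case False
    from h False show ?thesis
    proof (cases rule: even_element_cases)
      case (DD kap)
      from DD(2) show ?thesis
      proof
        assume "h \<in> DD n kap"
        then show ?thesis using sc_rep on_class DD(1) by simp
      next
        assume "zz + h \<in> DD n kap"
        then have "scoef n lam mu (zz + h) = anti n (?s a) (zz + h)" using sc_rep on_class DD(1) by simp
        then show ?thesis by (simp add: sc_zz anti_zz)
      qed
    next
      \<comment> \<open>A class function that changes sign under \<open>zz\<close> equals its own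
        negative at an element conjugate to its \<open>zz\<close> multiple.\<close>
      case (conj w)
      have "scoef n lam mu h = scoef n lam mu (zz + h)" using scoef_conj[OF lam mu conj] .
      then have "scoef n lam mu h = 0" by (simp add: sc_zz)
      moreover have "h \<notin> DD n kap \<and> zz + h \<notin> DD n kap" if "kap \<in> basis_index n" for kap
      proof -
        have "w + h - w = zz + h" "w + (zz + h) - w = h" using zz_conjugate[OF conj(2)] by simp_all
        then show ?thesis using DD_conj[OF ep[OF that] _ conj(1)] DD_not_zz[OF ep[OF that]] by metis
      qed
      then have "anti n (?s a) h = 0" by (simp add: anti_s[OF h])
      ultimately show ?thesis by simp
    qed
  qed
  then have ex: "?P a" unfolding P by (simp add: a_def)
  have val: "b kap = a kap" if "?P b" for b kap
  proof (cases "kap \<in> basis_index n")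
    case True
    have "scoef n lam mu (rep kap) = anti n (?s b) (rep kap)"
      using that DD_sub[OF ep[OF True] rep[OF True]] unfolding P by blast
    then show ?thesis using on_class[OF True rep[OF True]] sc_rep[OF True rep[OF True]] by simp
  next
    case False
    then show ?thesis using that by (simp add: a_def)
  qed
  have "structure_constant n lam mu = a"
    unfolding structure_constant_def
  proof (rule the_equality)
    show "?P a" by (rule ex)
    show "b = a" if "?P b" for b using val[OF that] by (rule ext)
  qed
  \<comment> \<open>Coordinates outside \<open>basis_index n\<close> are 0 by convention, so
    \<open>nu\<close> has to be an index; this holds because its class is nonempty.\<close>
  moreover have "nu \<in> basis_index n"
  proof -
    obtain cs where cs: "cs \<in> cycle_lists n nu" using g by (auto simp: DD_def)
    have "length (concat cs) \<le> card {1..n}"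
      using cycle_lists_data[OF cs] by (metis card_mono distinct_card finite_atLeastAtMost)
    then show ?thesis using cycle_lists_data(3)[OF cs] nu by (simp add: basis_index_def)
  qed
  ultimately show ?thesis using sc_rep g by simp
qed

section \<open>Conjugacy classes of pairs\<close>

abbreviation winf :: "spin_gen word set" where "winf \<equiv> \<Union>n. spin_words n"

abbreviation ci :: "spin \<Rightarrow> spin_gen word set" where "ci \<equiv> cl winf"

lemma winf_append:
  assumes "u \<in> winf" "v \<in> winf"
  shows "u @ v \<in> winf"
proof -
  obtain m n where "u \<in> spin_words m" "v \<in> spin_words n" using assms by blast
  then have "u @ v \<in> spin_words (max m n)"
    using spin_words_mono[of m "max m n"] spin_words_mono[of n "max m n"] by auto
  then show ?thesis by blast
qed

lemma spin_rel_inf_eq: "spin_rel_inf = {(u, v). u \<in> winf \<and> v \<in> winf \<and> elt u = elt v}"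
proof (intro equalityI subrelI)
  fix u v assume "(u, v) \<in> spin_rel_inf"
  then obtain n where "(u, v) \<in> spin_rel n" unfolding spin_rel_inf_iff by blast
  from elt_eqI[OF this] spin_rel_words[OF this]
  show "(u, v) \<in> {(u, v). u \<in> winf \<and> v \<in> winf \<and> elt u = elt v}" by auto
next
  fix u v assume "(u, v) \<in> {(u, v). u \<in> winf \<and> v \<in> winf \<and> elt u = elt v}"
  then obtain m n where w: "u \<in> spin_words m" "v \<in> spin_words n" "elt u = elt v" by blast
  then have "u \<in> spin_words (max m n)" "v \<in> spin_words (max m n)"
    using spin_words_mono[of m "max m n"] spin_words_mono[of n "max m n"] by auto
  then show "(u, v) \<in> spin_rel_inf" using elt_eq_iff_inf w(3) by blast
qed

lemma winf_axioms:
  "[] \<in> winf" "u \<in> winf \<Longrightarrow> v \<in> winf \<Longrightarrow> u @ v \<in> winf" "w \<in> winf \<Longrightarrow> inverse_word w \<in> winf"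
  using winf_append by auto

lemmas winf_word_group = winf_axioms spin_rel_inf_eq

lemma elt_winf: "elt ` winf = UNIV"
proof -
  have "g \<in> elt ` winf" for g by (rule spin_cases[of g]) blast
  then show ?thesis by blast
qed

lemma carrier_spin_group_inf: "carrier spin_group_inf = range ci"
  unfolding spin_group_inf_def using carrier_word_group[OF winf_word_group] elt_winf by simp

lemma mult_spin_group_inf: "ci g \<otimes>\<^bsub>spin_group_inf\<^esub> ci h = ci (g + h)"
  unfolding spin_group_inf_def using mult_word_group[OF winf_word_group] elt_winf by simp

lemma one_spin_group_inf: "\<one>\<^bsub>spin_group_inf\<^esub> = ci 0"
  unfolding spin_group_inf_def by (rule one_word_group[OF winf_word_group])

lemma group_spin_group_inf: "group spin_group_inf"
  unfolding spin_group_inf_def by (rule group_word_group[OF winf_word_group])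

lemma ci_inj: "ci g = ci h \<longleftrightarrow> g = h"
  using cl_inj[of g winf h] elt_winf by auto

lemma inv_spin_group_inf: "inv\<^bsub>spin_group_inf\<^esub> (ci g) = ci (- g)"
proof -
  interpret group spin_group_inf by (rule group_spin_group_inf)
  show ?thesis
    by (rule inv_equality) (simp_all add: carrier_spin_group_inf mult_spin_group_inf one_spin_group_inf)
qed

lemma theta_ci: "theta (ci g) = sperm g"
proof -
  obtain w where w: "w \<in> winf" "elt w = g" using elt_winf by (metis UNIV_I imageE)
  have perm: "word_perm u = sperm g" if "u \<in> ci g" for u
    using that sperm_elt by (auto simp: cl_def)
  have "w \<in> ci g" using w by (simp add: cl_def)
  then show ?thesis unfolding theta_def using perm by (intro the_equality) auto
qed

lemma z_inf_eq: "z_inf = ci zz"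
  using word_class[OF winf_word_group, of "[z_letter]"] by (auto simp: z_inf_def zz_def)

lemma spin_rel_inf_cn: "g \<in> sub n \<Longrightarrow> spin_rel_inf `` cn n g = ci g"
proof (intro equalityI subsetI)
  fix u assume "u \<in> spin_rel_inf `` cn n g"
  then show "u \<in> ci g" by (auto simp: spin_rel_inf_eq cl_def)
next
  fix u assume g: "g \<in> sub n" and u: "u \<in> ci g"
  obtain w where "w \<in> spin_words n" "elt w = g" using g by (auto simp: sub_def)
  then have "(w, u) \<in> spin_rel_inf" "w \<in> cn n g" using u by (auto simp: spin_rel_inf_eq cl_def)
  then show "u \<in> spin_rel_inf `` cn n g" by (rule ImageI)
qed

lemma D_class_inf_eq:
  assumes "lam \<in> even_partitions"
  shows "D_class_inf lam = ci ` DI lam"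
proof -
  have "(\<lambda>A. spin_rel_inf `` A) ` D_class n lam = ci ` DD n lam" for n
    unfolding D_class_eq[OF assms] image_image
    by (rule image_cong) (simp_all add: spin_rel_inf_cn DD_sub[OF assms])
  then show ?thesis by (simp add: D_class_inf_def DI_def image_UN)
qed

lemma ci_mem_D_class_inf: "lam \<in> even_partitions \<Longrightarrow> ci g \<in> D_class_inf lam \<longleftrightarrow> g \<in> DI lam"
  by (auto simp: D_class_inf_eq ci_inj)

lemma ci_mem_z_D_class_inf:
  assumes "lam \<in> even_partitions"
  shows "ci g \<in> z_inf <#\<^bsub>spin_group_inf\<^esub> D_class_inf lam \<longleftrightarrow> zz + g \<in> DI lam"
proof -
  have "z_inf <#\<^bsub>spin_group_inf\<^esub> D_class_inf lam = (\<lambda>h. ci (zz + h)) ` DI lam"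
    by (auto simp: l_coset_def D_class_inf_eq[OF assms] z_inf_eq mult_spin_group_inf)
  moreover have "g = zz + h \<longleftrightarrow> zz + g = h" for h by (metis zz_zz_left)
  ultimately show ?thesis by (auto simp: ci_inj)
qed

definition pclass :: "spin \<Rightarrow> spin \<Rightarrow> (spin_gen word set \<times> spin_gen word set) set" where
  "pclass a b = range (\<lambda>w. (ci (w + a - w), ci (w + b - w)))"

lemma pair_conj_class: "pair_conj `` {(ci a, ci b)} = pclass a b"
proof -
  have c: "ci w \<otimes>\<^bsub>spin_group_inf\<^esub> ci a \<otimes>\<^bsub>spin_group_inf\<^esub> inv\<^bsub>spin_group_inf\<^esub> (ci w) = ci (w + a - w)" for w a
    by (simp add: inv_spin_group_inf mult_spin_group_inf)
  show ?thesis
    unfolding pair_conj_def pclass_def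
    by (auto simp: carrier_spin_group_inf c ci_inj)
qed

lemma pair_classes_eq: "pair_classes = {pclass a b | a b. True}"
proof -
  have "pair_classes = (\<lambda>(x, y). pair_conj `` {(x, y)}) ` (range ci \<times> range ci)"
    unfolding pair_classes_def quotient_def carrier_spin_group_inf by auto
  also have "\<dots> = {pair_conj `` {(ci a, ci b)} | a b. True}" by fast
  finally show ?thesis by (simp only: pair_conj_class)
qed

text \<open>Conjugating a pair by \<open>w\<close> maps its set of moved points bijectively by the
  permutation of \<open>w\<close>, so the description is well defined. The number 0 is fixed by
  every permutation and never counts.\<close>

lemma moved_points_pclass: "moved_points (pclass a b) = card (moved a b)"
proof -
  have set: "{j. 1 \<le> j \<and> (theta (ci a) j \<noteq> j \<or> theta (ci b) j \<noteq> j)} = moved a b" for a b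
  proof -
    have "sperm g 0 = 0" for g
    proof -
      obtain n where "sperm g permutes {1..n}" using spin_in_sub sub_iff by blast
      then show ?thesis by (rule permutes_not_in) simp
    qed
    then show ?thesis unfolding theta_ci moved_def by (metis (mono_tags, lifting) Suc_leI neq0_conv One_nat_def)
  qed
  have card: "card (moved (w + a - w) (w + b - w)) = card (moved a b)" for w
  proof -
    obtain n where "sperm w permutes {1..n}" using spin_in_sub sub_iff by blast
    then show ?thesis unfolding moved_conj by (intro card_image permutes_inj_on)
  qed
  show ?thesis
    unfolding moved_points_def
  proof (rule the_equality)
    show "\<forall>(x, y)\<in>pclass a b. card (moved a b) = card {j. 1 \<le> j \<and> (theta x j \<noteq> j \<or> theta y j \<noteq> j)}"
      unfolding pclass_def using card by (auto simp only: set)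
    fix k assume k: "\<forall>(x, y)\<in>pclass a b. k = card {j. 1 \<le> j \<and> (theta x j \<noteq> j \<or> theta y j \<noteq> j)}"
    have "(ci (0 + a - 0), ci (0 + b - 0)) \<in> pclass a b" unfolding pclass_def by (rule rangeI)
    then show "k = card (moved a b)" using k set[of a b] by auto
  qed
qed

text \<open>The definition tests every pair of the class; as all conditions are invariant under
  conjugation, one representative decides.\<close>

lemma pair_classes_over_eq:
  assumes "lam \<in> even_partitions" "mu \<in> even_partitions" "nu \<in> even_partitions"
  shows "pair_classes_over lam mu nu = {pclass a b | a b. a \<in> DI lam \<and> b \<in> DI mu \<and>
    (a + b \<in> DI nu \<or> zz + (a + b) \<in> DI nu)}"
proof -
  let ?Q = "\<lambda>a b. a \<in> DI lam \<and> b \<in> DI mu \<and> (a + b \<in> DI nu \<or> zz + (a + b) \<in> DI nu)"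
  let ?R = "\<lambda>(a, b). a \<in> D_class_inf lam \<and> b \<in> D_class_inf mu \<and>
     (a \<otimes>\<^bsub>spin_group_inf\<^esub> b \<in> D_class_inf nu \<or>
      a \<otimes>\<^bsub>spin_group_inf\<^esub> b \<in> z_inf <#\<^bsub>spin_group_inf\<^esub> D_class_inf nu)"
  have R: "?R (ci a, ci b) \<longleftrightarrow> ?Q a b" for a b
    using assms by (simp add: ci_mem_D_class_inf ci_mem_z_D_class_inf mult_spin_group_inf)
  have conj: "?Q (w + a - w) (w + b - w)" if "?Q a b" for a b w
  proof -
    have s: "(w + a - w) + (w + b - w) = w + (a + b) - w"
      by (simp only: diff_conv_add_uminus add.assoc minus_add_cancel)
    have z: "zz + (w + (a + b) - w) = w + (zz + (a + b)) - w"
      by (metis add.assoc diff_conv_add_uminus zz_commute)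
    show ?thesis using that DI_conj[OF assms(1)] DI_conj[OF assms(2)] DI_conj[OF assms(3)]
      unfolding s z by blast
  qed
  have "(\<forall>x\<in>pclass a b. ?R x) \<longleftrightarrow> ?Q a b" for a b
  proof
    assume "\<forall>x\<in>pclass a b. ?R x"
    \<comment> \<open>The conjugator 0 exhibits the pair itself as a member of its class.\<close>
    moreover have "(ci (0 + a - 0), ci (0 + b - 0)) \<in> pclass a b" unfolding pclass_def by (rule rangeI)
    ultimately have "?R (ci (0 + a - 0), ci (0 + b - 0))" by blast
    then show "?Q a b" unfolding R by simp
  next
    assume q: "?Q a b"
    show "\<forall>x\<in>pclass a b. ?R x"
    proof
      fix x assume "x \<in> pclass a b"
      then obtain w where "x = (ci (w + a - w), ci (w + b - w))" unfolding pclass_def by blast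
      then show "?R x" using R conj[OF q, of w] by (simp only:)
    qed
  qed
  then show ?thesis unfolding pair_classes_over_def pair_classes_eq by blast
qed

theorem theorem3p4:
  fixes lam mu nu :: "nat list"
  assumes "lam \<in> even_partitions" and "mu \<in> even_partitions" and "nu \<in> even_partitions"
  shows "(\<exists>!f :: rat poly. interpolates f lam mu nu) \<and>
    (\<forall>f :: rat poly. interpolates f lam mu nu \<longrightarrow>
      (f \<noteq> 0 \<longrightarrow> int (degree f) \<le>
         (MAX C\<in>pair_classes_over lam mu nu.
            int (moved_points C) - int (sum_list nu) - int (length nu))) \<and>
      (\<not> sum_list nu \<le> sum_list lam + sum_list mu \<longrightarrow> f = 0) \<and>
      (sum_list nu = sum_list lam + sum_list mu \<longrightarrow>
         (\<exists>c. f = [:c:]) \<and>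
         (\<forall>m \<ge> sum_list nu + length nu. \<forall>n \<ge> sum_list nu + length nu.
            structure_constant m lam mu nu = structure_constant n lam mu nu)))"
proof -
  define N where "N = sum_list nu + length nu"
  \<comment> \<open>No product of members of the two classes involves more than \<open>L\<close>
    points, so \<open>L\<close> bounds the \<open>k\<close> that occur, uniformly in
    \<open>n\<close>.\<close>
  define L where "L = sum_list lam + length lam + (sum_list mu + length mu)"
  let ?s = "\<lambda>n. structure_constant n lam mu nu"
  let ?Q = "\<lambda>a b. a \<in> DI lam \<and> b \<in> DI mu \<and> (a + b \<in> DI nu \<or> zz + (a + b) \<in> DI nu)"
  obtain c where c: "\<And>n g. N \<le> n \<Longrightarrow> g \<in> DD n nu \<Longrightarrow>
      scoef n lam mu g = (\<Sum>k\<le>n - N. of_nat (n - N choose k) * c k)"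
    and pair: "\<And>k. c k \<noteq> 0 \<Longrightarrow> \<exists>a\<in>DI lam. \<exists>b\<in>DI mu.
      (a + b \<in> DI nu \<or> zz + (a + b) \<in> DI nu) \<and> card (moved a b) = N + k"
    using scoef_binomial[OF assms] unfolding N_def by blast
  have s: "?s n = (\<Sum>k\<le>n - N. of_nat (n - N choose k) * c k)" if n: "N \<le> n" for n
  proof -
    have "DD n nu \<noteq> {}" using n unfolding N_def by (rule DD_nonempty)
    then obtain g where "g \<in> DD n nu" by blast
    then show ?thesis using structure_constant_eq[OF assms] c[OF n] by simp
  qed
  have bound: "k \<le> L" if "c k \<noteq> 0" for k
    using pair[OF that] pair_bounds(1)[OF assms] unfolding L_def by fastforce
  let ?F = "\<Sum>k\<le>L. smult (of_int (c k)) (binomial_poly N k)"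
  \<comment> \<open>Existence and uniqueness at once; all other claims about an interpolating
    \<open>f\<close> become claims about \<open>?F\<close>.\<close>
  have interp: "interpolates f lam mu nu \<longleftrightarrow> f = ?F" for f
    using binomial_sum_poly[OF s bound] by (simp add: interpolates_def N_def)
  have deg: "int (degree ?F) \<le> (MAX C\<in>pair_classes_over lam mu nu.
      int (moved_points C) - int (sum_list nu) - int (length nu))" (is "_ \<le> ?M") if F: "?F \<noteq> 0"
  proof -
    let ?f = "\<lambda>C. int (moved_points C) - int (sum_list nu) - int (length nu)"
    \<comment> \<open>\<open>Max\<close> requires a finite set of values; the upper end comes from
      the bound on moved points, and \<open>- N\<close> is a crude lower end.\<close>
    have "?f ` pair_classes_over lam mu nu \<subseteq> {- int N..int L}"
    proof
      fix x assume "x \<in> ?f ` pair_classes_over lam mu nu"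
      then obtain C where C: "C \<in> pair_classes_over lam mu nu" "x = ?f C" by blast
      from C(1) obtain a b where "?Q a b" "C = pclass a b"
        unfolding pair_classes_over_eq[OF assms] by blast
      moreover from this have "x = int (card (moved a b)) - int N"
        using C(2) by (simp add: moved_points_pclass N_def)
      ultimately show "x \<in> {- int N..int L}" using pair_bounds(1)[OF assms, of a b] by (auto simp: L_def)
    qed
    then have fin: "finite (?f ` pair_classes_over lam mu nu)" by (rule finite_subset) simp
    have le: "int k \<le> ?M" if k: "c k \<noteq> 0" for k
    proof -
      obtain a b where ab: "?Q a b" "card (moved a b) = N + k" using pair[OF k] by blast
      have "pclass a b \<in> pair_classes_over lam mu nu"
        unfolding pair_classes_over_eq[OF assms] using ab(1) by blast
      moreover have "int k = ?f (pclass a b)" using ab(2) by (simp add: moved_points_pclass N_def)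
      ultimately show ?thesis using Max_ge[OF fin] by blast
    qed
    \<comment> \<open>Since \<open>?F\<close> is nonzero, some coefficient is nonzero, and the
      maximum is at least its index. Hence it is nonnegative and passing to \<open>nat ?M\<close>
      loses nothing.\<close>
    obtain k0 where "c k0 \<noteq> 0"
    proof (rule ccontr)
      assume "\<not> thesis"
      then have "c k = 0" for k using that by blast
      then have "?F = 0" by simp
      then show False using F by simp
    qed
    then have M: "0 \<le> ?M" using le[of k0] by simp
    have "degree ?F \<le> nat ?M"
    proof (rule degree_sum_le)
      fix k
      show "degree (smult (of_int (c k)) (binomial_poly N k)) \<le> nat ?M"
      proof (cases "c k = 0")
        case False
        then show ?thesis using degree_binomial_poly[of N k] le[OF False] by simp
      qed simp
    qed simp
    then show ?thesis using M by simp
  qed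
  have zero: "?F = 0" if "\<not> sum_list nu \<le> sum_list lam + sum_list mu"
  proof -
    have "c k = 0" for k using pair[of k] pair_bounds(2)[OF assms] that by blast
    then show ?thesis by simp
  qed
  have const: "c k = 0" if "sum_list nu = sum_list lam + sum_list mu" "k \<noteq> 0" for k
  proof (rule ccontr)
    assume "c k \<noteq> 0"
    then obtain a b where "?Q a b" "card (moved a b) = N + k" using pair by blast
    then show False using pair_bounds(3)[OF assms, of a b] that by (simp add: N_def)
  qed
  have top: "?s n = c 0" if "sum_list nu = sum_list lam + sum_list mu" "N \<le> n" for n
  proof -
    have "?s n = (\<Sum>k\<in>{0}. of_nat (n - N choose k) * c k)"
      unfolding s[OF that(2)] using const[OF that(1)] by (intro sum.mono_neutral_right) auto
    then show ?thesis by simp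
  qed
  have topF: "\<exists>d. ?F = [:d:]" if "sum_list nu = sum_list lam + sum_list mu"
  proof -
    have "?F = (\<Sum>k\<in>{0}. smult (of_int (c k)) (binomial_poly N k))"
      using const[OF that] by (intro sum.mono_neutral_right) auto
    then have "degree ?F = 0" using degree_binomial_poly[of N 0] by simp
    then show ?thesis by (metis degree_0_id)
  qed
  show ?thesis
    unfolding interp using deg zero top topF by (auto simp: N_def)
qed

end
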